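(* Let $n,m\ge0$ be integers with $n+m\ge1$ and let $p$ be any complex number. The linear map $\rho:U_q[sl(n+1|m)]\to W(n|m)$ defined on the Jacobson generators $H_i,a_i^\pm$ ($i\in[1;n+m]$) by $$\rho(H_i)=p-(-1)^{\theta_i}c_i^+c_i^--\sum_{j=1}^{n+m}c_j^+c_j^-=p-(-1)^{\theta_i}N_i-N,$$ $$\rho(a_i^-)=q^{N_1+\cdots+N_{i-1}}\frac{[N_i+1]}{N_i+1}[p-N]\,c_i^-,$$ $$\rho(a_i^+)=\bar q^{\,N_1+\cdots+N_{i-1}}c_i^+$$ is an (associative algebra) homomorphism of $U_q[sl(n+1|m)]$ into $W(n|m)$ (the Dyson realization).
   Context: Notation: $h$ is an indeterminate, $q=e^h$, $\bar q=q^{-1}$, $[x]=\frac{q^x-q^{-x}}{q-q^{-1}}$; $[r;s]=\{r,r+1,\dots,s\}$; $\theta_i=0$ for $i\in[0;n]$ and $\theta_i=1$ for $i\in[n+1;n+m]$ (in $\mathbb Z_2$, read as integers $0,1$ where needed); $\theta_{ij}=\theta_i+\theta_j$. For homogeneous $a,b$ in a superalgebra, $[a,b]=ab-ba$, $[\![a,b]\!]=ab-(-1)^{\deg(a)\deg(b)}ba$, $[\![a,b]\!]_x=ab-(-1)^{\deg(a)\deg(b)}x\,ba$. $\theta(i_1>\dots>i_r)=1$ if the inequalities hold and $0$ otherwise. The algebra: $U_q[sl(n+1|m)]$ is the (topologically free, $h$-adically complete) associative superalgebra over $\mathbb C[[h]]$ generated by even elements $H_i$ ($i\in[1;n+m]$)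 and elements $e_{ij}$ ($i\neq j\in[0;n+m]$) of degree $\theta_{ij}$, with the relations below. Put $L_i=q^{H_i}$, $\bar L_i=q^{-H_i}$, $L_0=\bar L_0=1$. Call $e_{ij}$ a positive (negative) root vector if $i<j$ ($i>j$); among the positive ones, and likewise among the negative ones, set $e_{ij}<e_{kl}$ if $i<k$, or $i=k$ and $j<l$. (1) $[H_i,H_j]=0$; $[H_i,e_{jk}]=(\delta_{0j}-\delta_{0k}-(-1)^{\theta_i}(\delta_{ij}-\delta_{ik}))e_{jk}$; $(e_{ij})^2=0$ if $\theta_{ij}=1$. (2) For positive root vectors $e_{ij}<e_{kl}$: $[\![e_{ij},e_{kl}]\!]_{x}=\delta_{jk}e_{il}+(q-q^{-1})(-1)^{\theta_k}\theta(l>j>k>i)e_{kj}e_{il}$ with $x=q^{(-1)^{\theta_j}\delta_{jl}-(-1)^{\theta_j}\delta_{jk}+(-1)^{\theta_i}\delta_{ik}}$. (3) For negative root vectors $e_{ij}>e_{kl}$: $[\![e_{ij},e_{kl}]\!]_{x}=\delta_{jk}e_{il}-(q-q^{-1})(-1)^{\theta_k}\theta(i>k>j>l)e_{kj}e_{il}$ with $x=q^{-(-1)^{\theta_j}\delta_{jl}+(-1)^{\theta_j}\delta_{jk}-(-1)^{\theta_i}\delta_{ik}}$. (4) For $e_{ij}$ positive and $e_{kl}$ negative: $[\![e_{ij},e_{kl}]\!]=\frac{\delta_{il}\delta_{jk}}{q-q^{-1}}\bigl(L_j^{(-1)^{\theta_i}}\bar L_i^{(-1)^{\theta_i}}-\bar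 L_j^{(-1)^{\theta_i}}L_i^{(-1)^{\theta_i}}\bigr)+\bigl((q-q^{-1})\theta(j>k>i>l)(-1)^{\theta_k}e_{kj}e_{il}-\delta_{il}\theta(j>k)(-1)^{\theta_{kl}}e_{kj}+\delta_{jk}\theta(i>l)e_{il}\bigr)L_i\bar L_k+L_j\bar L_l\bigl(-(q-q^{-1})\theta(k>j>l>i)(-1)^{\theta_j}e_{il}e_{kj}-\delta_{il}\theta(k>j)(-1)^{\theta_{ij}}e_{kj}+\delta_{jk}\theta(l>i)e_{il}\bigr).$ The Jacobson generators are the $H_i$ together with $a_i^-=e_{0i}$, $a_i^+=e_{i0}$, $i\in[1;n+m]$; they generate the algebra, since $[\![a_i^-,a_j^+]\!]=-(-1)^{\theta_i}L_ie_{ji}$ for $i<j$ and $[\![a_i^-,a_j^+]\!]=-(-1)^{\theta_j}e_{ji}\bar L_j$ for $i>j$. "Defined on the Jacobson generators" means extended multiplicatively from them. The target: $W(n|m)$ is the ($h$-adically completed) associative superalgebra over $\mathbb C[[h]]$ generated by $c_i^\pm$ ($i\in[1;n+m]$), $\deg(c_i^\pm)=\theta_i$, with relations $[\![c_i^-,c_j^+]\!]=\delta_{ij}$, $[\![c_i^+,c_j^+]\!]=[\![c_i^-,c_j^-]\!]=0$ ($n$ pairs of Bose and $m$ pairs of Fermi creation and annihilation operators). $N_i=c_i^+c_i^-$, $N=\sum_{j=1}^{n+m}N_j$. Functions of the commuting $N_i$ such as $q^{N_i}=e^{hN_i}$, $[p-N]$ and $\frac{[N_i+1]}{N_i+1}$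 are defined by expansion as power series in $h$ with coefficients polynomial in the $N_i$ (note $\frac{[x]}{x}=\frac{\sinh(hx)}{x\sinh h}\in\mathbb C[x][[h]]$). *)

theory Defs
  imports
    "HOL-Library.Poly_Mapping"
    "HOL-Library.FuncSet"
    "HOL-Computational_Algebra.Formal_Power_Series"
    "HOL-Algebra.QuotRing"
begin

section \<open>Completed free algebras\<close>

text \<open>Words under concatenation, so that the convolution product of
  \<^theory>\<open>HOL-Library.Poly_Mapping\<close> makes \<open>'x list \<Rightarrow>\<^sub>0 complex\<close> the free associative
  \<open>\<complex>\<close>-algebra on the letters \<open>'x\<close>.\<close>

instantiation list :: (type) monoid_add
begin

definition zero_list :: "'a list" where "0 = []"
definition plus_list :: "'a list \<Rightarrow> 'a list \<Rightarrow> 'a list" where "xs + ys = xs @ ys"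

instance by standard (simp_all add: zero_list_def plus_list_def)

end

type_synonym 'x free_alg = "'x list \<Rightarrow>\<^sub>0 complex"

definition const :: "complex \<Rightarrow> 'x free_alg" where
  "const c = Poly_Mapping.single [] c"

definition letter :: "'x \<Rightarrow> 'x free_alg" where
  "letter x = Poly_Mapping.single [x] 1"

text \<open>The \<open>h\<close>-adic completion of the free \<open>\<complex>[[h]]\<close>-algebra is \<open>\<complex>\<langle>X\<rangle>[[h]]\<close>, where \<open>h\<close> is the
  variable of the power series (which commutes with all coefficients). The metric of the type
  \<^typ>\<open>'x free_alg fps\<close> induces the \<open>h\<close>-adic topology.\<close>

definition scal :: "complex fps \<Rightarrow> 'x free_alg fps" where
  "scal s = Abs_fps (\<lambda>k. const (fps_nth s k))"

definition gen :: "'x \<Rightarrow> 'x free_alg fps" where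
  "gen x = fps_const (letter x)"

definition free_ring :: "'x set \<Rightarrow> 'x free_alg fps ring" where
  "free_ring X =
     \<lparr>carrier = {f. \<forall>k. Poly_Mapping.keys (fps_nth f k) \<subseteq> lists X},
      monoid.mult = (*), one = 1, ring.zero = 0, add = (+)\<rparr>"


section \<open>Presentations by generators and relations\<close>

definition closed_idl :: "('a::topological_space) ring \<Rightarrow> 'a set \<Rightarrow> 'a set" where
  "closed_idl A S = \<Inter>{I. ideal I A \<and> closed I \<and> S \<subseteq> I}"

text \<open>A relation \<open>R l r\<close> imposes \<open>l = r\<close>. Dividing by the closed ideal makes the quotient
  \<open>h\<close>-adically separated and complete.\<close>

definition rel_idl ::
    "'x set \<Rightarrow> ('x free_alg fps \<Rightarrow> 'x free_alg fps \<Rightarrow> bool) \<Rightarrow> 'x free_alg fps set" where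
  "rel_idl X R = closed_idl (free_ring X) {l - r | l r. R l r}"

definition presented ::
    "'x set \<Rightarrow> ('x free_alg fps \<Rightarrow> 'x free_alg fps \<Rightarrow> bool) \<Rightarrow> 'x free_alg fps set ring" where
  "presented X R = free_ring X Quot rel_idl X R"

definition cls ::
    "'x set \<Rightarrow> ('x free_alg fps \<Rightarrow> 'x free_alg fps \<Rightarrow> bool) \<Rightarrow> 'x free_alg fps
      \<Rightarrow> 'x free_alg fps set" where
  "cls X R f = rel_idl X R +>\<^bsub>free_ring X\<^esub> f"

text \<open>Unital \<open>\<complex>[[h]]\<close>-algebra homomorphisms. They map \<open>h\<^sup>k A\<close> into \<open>h\<^sup>k B\<close>, so
  \<open>h\<close>-adic continuity is automatic.\<close>

definition presented_hom where
  "presented_hom X R Y S \<rho> \<longleftrightarrow>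
     \<rho> \<in> ring_hom (presented X R) (presented Y S) \<and>
     (\<forall>s. \<rho> (cls X R (scal s)) = cls Y S (scal s))"


section \<open>Functions of an element, as power series in \<open>h\<close>\<close>

text \<open>\<open>q\<close>-powers \<open>q\<^sup>a = e\<^sup>h\<^sup>a\<close>; the scalar \<open>q\<^sup>c\<close> with \<open>c \<in> \<complex>\<close> is \<^term>\<open>fps_exp c\<close>.\<close>

definition qpow :: "'x free_alg \<Rightarrow> 'x free_alg fps" where
  "qpow a = Abs_fps (\<lambda>k. const (1 / fact k) * a ^ k)"

definition qdiff :: "complex fps" where
  "qdiff = fps_exp 1 - fps_exp (-1)"

text \<open>Division by \<open>q - q\<^sup>-\<^sup>1\<close>, meaningful for series without constant term.\<close>

definition over_qdiff :: "'x free_alg fps \<Rightarrow> 'x free_alg fps" where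
  "over_qdiff z = fps_shift 1 z * scal (inverse (fps_shift 1 qdiff))"

definition qnum :: "'x free_alg \<Rightarrow> 'x free_alg fps" where
  "qnum a = over_qdiff (qpow a - qpow (- a))"

text \<open>\<open>[a]/a = ((q\<^sup>a - q\<^sup>-\<^sup>a)/a) / (q - q\<^sup>-\<^sup>1)\<close>, where only the odd powers of \<open>h\<close> survive
  in \<open>q\<^sup>a - q\<^sup>-\<^sup>a\<close>, each with coefficient \<open>2 a\<^sup>k / k!\<close>.\<close>

definition qnum_ratio :: "'x free_alg \<Rightarrow> 'x free_alg fps" where
  "qnum_ratio a = over_qdiff (Abs_fps (\<lambda>k. if odd k then const (2 / fact k) * a ^ (k - 1) else 0))"


section \<open>Parity and the deformed superbracket\<close>

definition \<theta> :: "nat \<Rightarrow> nat \<Rightarrow> nat" where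
  "\<theta> n i = (if i \<le> n then 0 else 1)"

definition \<theta>2 :: "nat \<Rightarrow> nat \<Rightarrow> nat \<Rightarrow> nat" where
  "\<theta>2 n i j = (\<theta> n i + \<theta> n j) mod 2"

definition sbracket :: "('x \<Rightarrow> nat) \<Rightarrow> complex fps \<Rightarrow> 'x \<Rightarrow> 'x \<Rightarrow> 'x free_alg fps" where
  "sbracket dg x a b = gen a * gen b - (-1) ^ (dg a * dg b) * scal x * gen b * gen a"


section \<open>The algebra \<open>U\<^sub>q[sl(n+1|m)]\<close>\<close>

datatype ugen = Hgen nat | Egen nat nat

definition U_gens :: "nat \<Rightarrow> nat \<Rightarrow> ugen set" where
  "U_gens n m = {Hgen i | i. i \<in> {1..n+m}} \<union> {Egen i j | i j. i \<in> {0..n+m} \<and> j \<in> {0..n+m} \<and> i \<noteq> j}"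

fun udeg :: "nat \<Rightarrow> ugen \<Rightarrow> nat" where
  "udeg n (Hgen i) = 0"
| "udeg n (Egen i j) = \<theta>2 n i j"

abbreviation rv :: "nat \<Rightarrow> nat \<Rightarrow> ugen free_alg fps" where
  "rv i j \<equiv> gen (Egen i j)"

text \<open>\<open>Lq i s\<close> is \<open>L\<^sub>i\<close> to the power \<open>s\<close>, so \<open>Lq i (- 1)\<close> is \<open>L\<^sub>i\<close> barred.\<close>

definition Lq :: "nat \<Rightarrow> int \<Rightarrow> ugen free_alg fps" where
  "Lq i s = (if i = 0 then 1 else qpow (of_int s * letter (Hgen i)))"

definition is_root :: "nat \<Rightarrow> nat \<Rightarrow> nat \<Rightarrow> nat \<Rightarrow> bool" where
  "is_root n m i j \<longleftrightarrow> i \<in> {0..n+m} \<and> j \<in> {0..n+m} \<and> i \<noteq> j"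

definition pos_root :: "nat \<Rightarrow> nat \<Rightarrow> nat \<Rightarrow> nat \<Rightarrow> bool" where
  "pos_root n m i j \<longleftrightarrow> is_root n m i j \<and> i < j"

definition neg_root :: "nat \<Rightarrow> nat \<Rightarrow> nat \<Rightarrow> nat \<Rightarrow> bool" where
  "neg_root n m i j \<longleftrightarrow> is_root n m i j \<and> i > j"

definition root_less :: "nat \<Rightarrow> nat \<Rightarrow> nat \<Rightarrow> nat \<Rightarrow> bool" where
  "root_less i j k l \<longleftrightarrow> i < k \<or> (i = k \<and> j < l)"

inductive U_rel :: "nat \<Rightarrow> nat \<Rightarrow> ugen free_alg fps \<Rightarrow> ugen free_alg fps \<Rightarrow> bool"
  for n m :: nat where
  HH: "i \<in> {1..n+m} \<Longrightarrow> j \<in> {1..n+m} \<Longrightarrow>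
    U_rel n m (gen (Hgen i) * gen (Hgen j) - gen (Hgen j) * gen (Hgen i)) 0"
| HE: "i \<in> {1..n+m} \<Longrightarrow> is_root n m j k \<Longrightarrow>
    U_rel n m (gen (Hgen i) * rv j k - rv j k * gen (Hgen i))
      (of_int (of_bool (0 = j) - of_bool (0 = k)
         - (-1) ^ \<theta> n i * (of_bool (i = j) - of_bool (i = k))) * rv j k)"
| sq: "is_root n m i j \<Longrightarrow> \<theta>2 n i j = 1 \<Longrightarrow> U_rel n m ((rv i j)\<^sup>2) 0"
| pos: "pos_root n m i j \<Longrightarrow> pos_root n m k l \<Longrightarrow> root_less i j k l \<Longrightarrow>
    U_rel n m
      (sbracket (udeg n)
         (fps_exp (of_int ((-1) ^ \<theta> n j * of_bool (j = l) - (-1) ^ \<theta> n j * of_bool (j = k)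
            + (-1) ^ \<theta> n i * of_bool (i = k))))
         (Egen i j) (Egen k l))
      (of_bool (j = k) * rv i l
       + scal qdiff * (-1) ^ \<theta> n k * of_bool (l > j \<and> j > k \<and> k > i) * rv k j * rv i l)"
| neg: "neg_root n m i j \<Longrightarrow> neg_root n m k l \<Longrightarrow> root_less k l i j \<Longrightarrow>
    U_rel n m
      (sbracket (udeg n)
         (fps_exp (of_int (- ((-1) ^ \<theta> n j) * of_bool (j = l) + (-1) ^ \<theta> n j * of_bool (j = k)
            - (-1) ^ \<theta> n i * of_bool (i = k))))
         (Egen i j) (Egen k l))
      (of_bool (j = k) * rv i l
       - scal qdiff * (-1) ^ \<theta> n k * of_bool (i > k \<and> k > j \<and> j > l) * rv k j * rv i l)"
| mixed: "pos_root n m i j \<Longrightarrow> neg_root n m k l \<Longrightarrow>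
    U_rel n m
      (sbracket (udeg n) 1 (Egen i j) (Egen k l))
      (of_bool (i = l) * of_bool (j = k)
         * over_qdiff (Lq j ((-1) ^ \<theta> n i) * Lq i (- ((-1) ^ \<theta> n i))
                       - Lq j (- ((-1) ^ \<theta> n i)) * Lq i ((-1) ^ \<theta> n i))
       + (scal qdiff * of_bool (j > k \<and> k > i \<and> i > l) * (-1) ^ \<theta> n k * rv k j * rv i l
          - of_bool (i = l) * of_bool (j > k) * (-1) ^ \<theta>2 n k l * rv k j
          + of_bool (j = k) * of_bool (i > l) * rv i l) * Lq i 1 * Lq k (- 1)
       + Lq j 1 * Lq l (- 1)
         * (- scal qdiff * of_bool (k > j \<and> j > l \<and> l > i) * (-1) ^ \<theta> n j * rv i l * rv k j
            - of_bool (i = l) * of_bool (k > j) * (-1) ^ \<theta>2 n i j * rv k j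
            + of_bool (j = k) * of_bool (l > i) * rv i l))"

definition Uq :: "nat \<Rightarrow> nat \<Rightarrow> ugen free_alg fps set ring" where
  "Uq n m = presented (U_gens n m) (U_rel n m)"

definition clsU :: "nat \<Rightarrow> nat \<Rightarrow> ugen free_alg fps \<Rightarrow> ugen free_alg fps set" where
  "clsU n m = cls (U_gens n m) (U_rel n m)"

abbreviation jac_minus :: "nat \<Rightarrow> ugen free_alg fps" where
  "jac_minus i \<equiv> rv 0 i"

abbreviation jac_plus :: "nat \<Rightarrow> ugen free_alg fps" where
  "jac_plus i \<equiv> rv i 0"


section \<open>The oscillator superalgebra \<open>W(n|m)\<close>\<close>

datatype wgen = Cplus nat | Cminus nat

definition W_gens :: "nat \<Rightarrow> nat \<Rightarrow> wgen set" where
  "W_gens n m = {Cplus i | i. i \<in> {1..n+m}} \<union> {Cminus i | i. i \<in> {1..n+m}}"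

fun wdeg :: "nat \<Rightarrow> wgen \<Rightarrow> nat" where
  "wdeg n (Cplus i) = \<theta> n i"
| "wdeg n (Cminus i) = \<theta> n i"

inductive W_rel :: "nat \<Rightarrow> nat \<Rightarrow> wgen free_alg fps \<Rightarrow> wgen free_alg fps \<Rightarrow> bool"
  for n m :: nat where
  "i \<in> {1..n+m} \<Longrightarrow> j \<in> {1..n+m} \<Longrightarrow>
    W_rel n m (sbracket (wdeg n) 1 (Cminus i) (Cplus j)) (of_bool (i = j))"
| "i \<in> {1..n+m} \<Longrightarrow> j \<in> {1..n+m} \<Longrightarrow>
    W_rel n m (sbracket (wdeg n) 1 (Cplus i) (Cplus j)) 0"
| "i \<in> {1..n+m} \<Longrightarrow> j \<in> {1..n+m} \<Longrightarrow>
    W_rel n m (sbracket (wdeg n) 1 (Cminus i) (Cminus j)) 0"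

definition Wq :: "nat \<Rightarrow> nat \<Rightarrow> wgen free_alg fps set ring" where
  "Wq n m = presented (W_gens n m) (W_rel n m)"

definition clsW :: "nat \<Rightarrow> nat \<Rightarrow> wgen free_alg fps \<Rightarrow> wgen free_alg fps set" where
  "clsW n m = cls (W_gens n m) (W_rel n m)"

definition Num :: "nat \<Rightarrow> wgen free_alg" where
  "Num i = letter (Cplus i) * letter (Cminus i)"

definition NumTot :: "nat \<Rightarrow> nat \<Rightarrow> wgen free_alg" where
  "NumTot n m = (\<Sum>j=1..n+m. Num j)"

definition is_hom_U_W :: "nat \<Rightarrow> nat \<Rightarrow> (ugen free_alg fps set \<Rightarrow> wgen free_alg fps set) \<Rightarrow> bool" where
  "is_hom_U_W n m = presented_hom (U_gens n m) (U_rel n m) (W_gens n m) (W_rel n m)"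


section \<open>Consistency of the encoding\<close>

lemma keys_mult_lists:
  assumes "Poly_Mapping.keys a \<subseteq> lists X" "Poly_Mapping.keys b \<subseteq> lists X"
  shows "Poly_Mapping.keys (a * b) \<subseteq> lists X"
  using keys_mult[of a b] assms by (fastforce simp: plus_list_def)

lemma ring_free_ring: "ring (free_ring X)"
proof (rule ringI)
  show "abelian_group (free_ring X)"
  proof (rule abelian_groupI)
    fix f g assume "f \<in> carrier (free_ring X)" "g \<in> carrier (free_ring X)"
    then show "f \<oplus>\<^bsub>free_ring X\<^esub> g \<in> carrier (free_ring X)"
      using keys_add by (fastforce simp: free_ring_def)
  next
    fix f assume "f \<in> carrier (free_ring X)"
    then show "\<exists>g\<in>carrier (free_ring X). g \<oplus>\<^bsub>free_ring X\<^esub> f = \<zero>\<^bsub>free_ring X\<^esub>"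
      by (intro bexI[of _ "- f"]) (auto simp: free_ring_def)
  qed (simp_all add: free_ring_def add.assoc add.commute)
  show "Group.monoid (free_ring X)"
  proof (rule monoidI)
    fix f g assume f: "f \<in> carrier (free_ring X)" and g: "g \<in> carrier (free_ring X)"
    have "Poly_Mapping.keys (fps_nth (f * g) k) \<subseteq> lists X" for k
    proof -
      have "Poly_Mapping.keys (\<Sum>i\<in>A. fps_nth f i * fps_nth g (k - i)) \<subseteq> lists X" if "finite A" for A
        using that
      proof (induction A)
        case (insert a A)
        have "Poly_Mapping.keys (fps_nth f a * fps_nth g (k - a)) \<subseteq> lists X"
          using f g by (intro keys_mult_lists) (auto simp: free_ring_def)
        then show ?case using insert keys_add[of "fps_nth f a * fps_nth g (k - a)"]
          by fastforce
      qed auto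
      then show ?thesis by (simp add: fps_mult_nth)
    qed
    then show "f \<otimes>\<^bsub>free_ring X\<^esub> g \<in> carrier (free_ring X)"
      by (simp add: free_ring_def)
  qed (simp_all add: free_ring_def mult.assoc zero_list_def)
qed (simp_all add: free_ring_def distrib_left distrib_right)

lemma const_mult: "const a * const b = const (a * b)"
  by (simp add: const_def mult_single plus_list_def)

lemma single_commute_const: "const a * Poly_Mapping.single k v = Poly_Mapping.single k v * const a"
  by (simp add: const_def mult_single plus_list_def mult.commute)

lemma const_commute: "const a * x = x * const a"
proof (induction x rule: update_induct)
  case const
  then show ?case by simp
next
  case (update f k v)
  have "Poly_Mapping.update k v f = f + Poly_Mapping.single k v"
    using update.hyps
    by (intro poly_mapping_eqI)
       (auto simp: lookup_update lookup_add lookup_single in_keys_iff when_def)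
  then show ?case
    by (simp add: distrib_left distrib_right update.IH single_commute_const)
qed

lemma scal_commute: "scal s * f = f * scal s"
proof (rule fps_ext)
  fix k
  have "fps_nth (scal s * f) k = (\<Sum>i=0..k. fps_nth f (k - i) * const (fps_nth s i))"
    by (simp add: fps_mult_nth scal_def const_commute)
  also have "\<dots> = (\<Sum>i=0..k. fps_nth f i * const (fps_nth s (k - i)))"
    by (rule sum.reindex_bij_witness[of _ "\<lambda>i. k - i" "\<lambda>i. k - i"]) auto
  finally show "fps_nth (scal s * f) k = fps_nth (f * scal s) k"
    by (simp add: fps_mult_nth scal_def)
qed

lemma const_sum: "const (sum f A) = (\<Sum>i\<in>A. const (f i))"
  by (induction A rule: infinite_finite_induct) (auto simp: const_def single_add)

lemma scal_mult: "scal (s * t) = scal s * scal t"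
  by (rule fps_ext) (simp add: scal_def fps_mult_nth const_mult const_sum)

lemma scal_one: "scal 1 = 1"
  by (rule fps_ext) (simp add: scal_def const_def flip: zero_list_def)

lemma over_qdiff:
  assumes "fps_nth z 0 = 0"
  shows "scal qdiff * over_qdiff z = z"
proof -
  define u where "u = fps_shift 1 qdiff"
  have u0: "fps_nth u 0 \<noteq> 0" by (simp add: u_def qdiff_def)
  have X: "qdiff = fps_X * u"
    unfolding u_def by (rule fps_ext) (simp add: qdiff_def)
  have sX: "scal fps_X = fps_X"
    by (rule fps_ext) (simp add: scal_def const_def fps_X_def flip: zero_list_def)
  have z: "z = fps_X * fps_shift 1 z"
    using assms by (intro fps_ext) auto
  have "scal qdiff * over_qdiff z = fps_X * (scal u * (fps_shift 1 z * scal (inverse u)))"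
    unfolding over_qdiff_def u_def[symmetric] unfolding X scal_mult sX by (simp only: mult.assoc)
  also have "scal u * (fps_shift 1 z * scal (inverse u)) = fps_shift 1 z * scal (u * inverse u)"
    by (simp only: scal_mult scal_commute[of u "fps_shift 1 z"] mult.assoc[symmetric])
  also have "fps_X * (fps_shift 1 z * scal (u * inverse u)) = z"
    unfolding inverse_mult_eq_1'[OF u0] scal_one mult_1_right by (rule z[symmetric])
  finally show ?thesis .
qed

lemma qnum_ratio: "qnum a = fps_const a * qnum_ratio a"
proof -
  define F where "F = Abs_fps (\<lambda>k. if odd k then const (2 / fact k) * a ^ (k - 1) else 0)"
  have "fps_nth (qpow a - qpow (- a)) k = fps_nth (fps_const a * F) k" for k
  proof (cases "odd k")
    case True
    then obtain j where k: "k = Suc j" by (cases k) auto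
    have c: "const (1 / fact k) + const (1 / fact k) = const (2 / fact k)"
      by (simp add: const_def flip: single_add)
    have "fps_nth (qpow a - qpow (- a)) k = const (2 / fact k) * a ^ k"
      unfolding c[symmetric] using True by (simp add: qpow_def distrib_right)
    also have "\<dots> = a * (const (2 / fact k) * a ^ (k - 1))"
      unfolding k power_Suc diff_Suc_1 by (metis const_commute mult.assoc)
    finally show ?thesis using True by (simp add: F_def)
  next
    case False
    then show ?thesis by (simp add: qpow_def F_def)
  qed
  then have 1: "qpow a - qpow (- a) = fps_const a * F"
    by (rule fps_ext)
  have 2: "fps_shift 1 (fps_const a * F) = fps_const a * fps_shift 1 F"
    by (rule fps_ext) simp
  show ?thesis
    unfolding qnum_def qnum_ratio_def over_qdiff_def 1 2 F_def[symmetric] by (simp only: mult.assoc)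
qed

end

theory Submission
  imports Defs
begin

text \<open>
  Put \<open>N\<^sub>0 = p - N\<close>, \<open>x\<^sub>i = c\<^sub>i\<^sup>+\<close> and \<open>y\<^sub>i = [N\<^sub>i+1]/(N\<^sub>i+1) c\<^sub>i\<^sup>-\<close>. The \<open>x\<^sub>i\<close>, \<open>y\<^sub>i\<close> are
  \<open>q\<close>-oscillators: \<open>x\<^sub>i y\<^sub>i = [N\<^sub>i]\<close>, and \<open>y\<^sub>i x\<^sub>i = [N\<^sub>i+1]\<close> or \<open>[1-N\<^sub>i]\<close> in the Bose and Fermi case.
  With \<open>x\<^sub>0 = [N\<^sub>0]\<close> and \<open>y\<^sub>0 = 1\<close>, the index \<open>0\<close> behaves like one more Bose oscillator, and all root vectors
  are realized by a single formula: \<open>e\<^sub>i\<^sub>j\<close> is mapped to \<open>x\<^sub>i y\<^sub>j\<close> times \<open>q\<close> (for \<open>i < j\<close>) or \<open>q\<^sup>-\<^sup>1\<close> (for \<open>i > j\<close>) to the power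
  \<open>\<Sum> N\<^sub>k\<close>, the sum being over the \<open>k\<close> strictly between \<open>i\<close> and \<open>j\<close>; moreover \<open>L\<^sub>i\<close> is \<open>q\<close> to the power
  \<open>N\<^sub>0 - (-1)^\<theta>\<^sub>i N\<^sub>i\<close> for all \<open>i\<close>. Every defining relation
  then splits into a comparison of exponents and an identity between products \<open>x\<^sub>i y\<^sub>j x\<^sub>k y\<^sub>l\<close>. Since the
  relations of \<open>W(n|m)\<close> do not involve \<open>h\<close>, the identities can be checked in \<open>W\<^sub>0[[h]]\<close> for the quotient
  \<open>W\<^sub>0\<close> of the free \<open>\<complex>\<close>-algebra, where \<open>q - q\<^sup>-\<^sup>1\<close> can be cancelled. For uniqueness, the subring on
  which two such homomorphisms agree is \<open>h\<close>-adically closed and contains \<open>e\<^sub>j\<^sub>i\<close>, because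
  \<open>L\<^sub>i\<close> is invertible.
\<close>

section \<open>Quantum oscillators\<close>

text \<open>\<open>T_fx\<close> and \<open>T_fy\<close> carry the super case. In the mixed relations
  the torus exponents of the two sides agree at Bose indices but may differ at Fermi ones, because
  the parity sign enters the exponent of L_i and not that of e_ij. Such a misplaced N_i always meets
  x_i or y_i on its right, where a Fermi number operator is 1 or 0, so the discrepancy is a scalar
  or disappears. The choice y_0 = 1 is possible because N_0 = p - N: every x_i lowers N_0 and every
  y_i raises it, so the shift of N_0 expected from an oscillator with index 0 is already made by its
  partner. Splitting [N_0] in this one-sided way puts all of [p - N] on the a_i^-. The parameter p
  enters through N_0 alone, and only differences of N_0 have to be integers; hence any complex p is
  allowed.\<close>

text \<open>\<open>qz a\<close> stands for \<open>q\<^sup>a\<close>, \<open>T u\<close> for \<open>q\<close> to the power \<open>\<Sum>\<^sub>k u\<^sub>k N\<^sub>k\<close>, \<open>P\<close> for \<open>[N\<^sub>0]\<close>, and \<open>fm\<close> marks the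
  Fermi indices.\<close>

locale qosc =
  fixes M :: nat and fm :: "nat \<Rightarrow> bool" and qz :: "int \<Rightarrow> 'a::ring_1"
    and T :: "(nat \<Rightarrow> int) \<Rightarrow> 'a" and x y :: "nat \<Rightarrow> 'a" and P :: 'a
  assumes fm_0: "\<not> fm 0" and fm_mono: "i \<le> j \<Longrightarrow> fm i \<Longrightarrow> fm j"
    and qz_0: "qz 0 = 1" and qz_add: "qz (a + b) = qz a * qz b"
    and qz_central: "qz a * z = z * qz a"
    and lam_cancel: "(qz 1 - qz (-1)) * z = (qz 1 - qz (-1)) * z' \<Longrightarrow> z = z'"
    and T_0: "T (\<lambda>_. 0) = 1" and T_add: "T u * T v = T (\<lambda>k. u k + v k)"
    and T_x: "i \<in> {1..M} \<Longrightarrow> x i * T u = qz (u 0 - u i) * (T u * x i)"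
    and T_y: "i \<in> {1..M} \<Longrightarrow> y i * T u = qz (u i - u 0) * (T u * y i)"
    and T_P: "P * T u = T u * P"
    and xx: "i \<in> {1..M} \<Longrightarrow> j \<in> {1..M} \<Longrightarrow> i \<noteq> j \<Longrightarrow>
      x i * x j = (if fm i \<and> fm j then - (x j * x i) else x j * x i)"
    and yy: "i \<in> {1..M} \<Longrightarrow> j \<in> {1..M} \<Longrightarrow> i \<noteq> j \<Longrightarrow>
      y i * y j = (if fm i \<and> fm j then - (y j * y i) else y j * y i)"
    and yx: "i \<in> {1..M} \<Longrightarrow> j \<in> {1..M} \<Longrightarrow> i \<noteq> j \<Longrightarrow>
      y i * x j = (if fm i \<and> fm j then - (x j * y i) else x j * y i)"
    and x_sq: "i \<in> {1..M} \<Longrightarrow> fm i \<Longrightarrow> x i * x i = 0"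
    and y_sq: "i \<in> {1..M} \<Longrightarrow> fm i \<Longrightarrow> y i * y i = 0"
    and lam_xy: "i \<in> {1..M} \<Longrightarrow> (qz 1 - qz (-1)) * (x i * y i) =
      T (\<lambda>k. of_bool (k = i)) - T (\<lambda>k. - of_bool (k = i))"
    and lam_yx: "i \<in> {1..M} \<Longrightarrow> (qz 1 - qz (-1)) * (y i * x i) =
      (if fm i then qz 1 * T (\<lambda>k. - of_bool (k = i)) - qz (-1) * T (\<lambda>k. of_bool (k = i))
       else qz 1 * T (\<lambda>k. of_bool (k = i)) - qz (-1) * T (\<lambda>k. - of_bool (k = i)))"
    and lam_P: "(qz 1 - qz (-1)) * P = T (\<lambda>k. of_bool (k = 0)) - T (\<lambda>k. - of_bool (k = 0))"
    and T_fx: "i \<in> {1..M} \<Longrightarrow> fm i \<Longrightarrow> T (u(i := a)) * x i = qz (a - u i) * (T u * x i)"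
    and T_fy: "i \<in> {1..M} \<Longrightarrow> fm i \<Longrightarrow> T (u(i := a)) * y i = T u * y i"
begin

definition lam :: 'a where "lam = qz 1 - qz (-1)"

definition d :: "nat \<Rightarrow> nat \<Rightarrow> int" where "d i k = of_bool (k = i)"

text \<open>\<open>B i j\<close> is \<open>x\<^sub>i y\<^sub>j\<close> under the convention \<open>x\<^sub>0 = P\<close>, \<open>y\<^sub>0 = 1\<close>.\<close>

definition B :: "nat \<Rightarrow> nat \<Rightarrow> 'a" where
  "B i j = (if i = 0 then P * y j else if j = 0 then x i else x i * y j)"

definition sg :: "nat \<Rightarrow> int" where "sg i = (if fm i then -1 else 1)"

lemma qz_left: "z * (qz a * w) = qz a * (z * w)"
  by (metis mult.assoc qz_central)

lemmas qz_left' = qz_left[of "x i" for i] qz_left[of "y i" for i] qz_left[of "T u" for u] qz_left[of P]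

lemma lam_left: "lam * (z * w) = z * (lam * w)"
  by (simp add: lam_def left_diff_distrib right_diff_distrib qz_left)

lemmas lam_rules = lam_cancel[folded lam_def] lam_xy[folded lam_def d_def] lam_yx[folded lam_def d_def]
  lam_P[folded lam_def d_def]

lemma qz_mult: "qz a * qz b = qz (a + b)" "qz a * (qz b * w) = qz (a + b) * w"
  by (simp_all add: qz_add mult.assoc)

lemma T_mult: "T u * (T v * w) = T (\<lambda>k. u k + v k) * w"
  by (simp add: T_add flip: mult.assoc)

text \<open>\<open>B i j\<close> raises N_i and lowers N_j by one. For \<open>i = 0\<close> or
  \<open>j = 0\<close> the shift of N_0 comes from the one remaining oscillator; for positive
  indices the shifts of N_0 by \<open>x i\<close> and \<open>y j\<close> cancel.\<close>

lemma B_T: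
  assumes "i \<le> M" "j \<le> M" "i \<noteq> j"
  shows "B i j * T u = qz (u j - u i) * (T u * B i j)"
proof -
  have 0: ?thesis if "i = 0"
  proof -
    have "P * (y j * T u) = qz (u j - u 0) * ((P * T u) * y j)"
      using that assms T_y[of j u] by (simp add: qz_left' mult.assoc)
    then have "P * (y j * T u) = qz (u j - u 0) * (T u * (P * y j))"
      by (simp only: T_P mult.assoc)
    then show ?thesis using that by (simp add: B_def mult.assoc)
  qed
  have 1: ?thesis if "i \<noteq> 0" "j = 0"
    using that assms T_x[of i u] by (simp add: B_def)
  have 2: ?thesis if "i \<noteq> 0" "j \<noteq> 0"
  proof -
    have "x i * (y j * T u) = qz (u j - u 0) * ((x i * T u) * y j)"
      using that assms T_y[of j u] by (simp add: qz_left' mult.assoc)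
    also have "\<dots> = qz (u j - u i) * (T u * (x i * y j))"
      using that assms T_x[of i u] by (simp add: mult.assoc qz_mult)
    finally show ?thesis using that by (simp add: B_def mult.assoc)
  qed
  show ?thesis using 0 1 2 by blast
qed

text \<open>Multiplication by \<open>\<lambda> = q - q\<^sup>-\<^sup>1\<close> reduces the oscillator relations to the torus.\<close>

lemma q_comm_pos:
  assumes "i \<in> {1..M}"
  shows "y i * x i = (if fm i then T (\<lambda>k. d i k) - qz 1 * (x i * y i)
      else T (\<lambda>k. - d i k) + qz 1 * (x i * y i))"
proof (rule lam_rules(1))
  have "lam * (qz 1 * (x i * y i)) = qz 1 * (T (\<lambda>k. d i k) - T (\<lambda>k. - d i k))"
    by (simp only: lam_left[of "qz 1"] lam_rules(2)[OF assms])
  then show "lam * (y i * x i) = lam * (if fm i then T (\<lambda>k. d i k) - qz 1 * (x i * y i)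
      else T (\<lambda>k. - d i k) + qz 1 * (x i * y i))"
    unfolding lam_rules(3)[OF assms]
    by (simp add: distrib_left[of lam] right_diff_distrib[of lam]) (simp add: lam_def algebra_simps)
qed

text \<open>In the Bose case [N+1] = q[N] + q^(-N) = q^(-1)[N] + q^N, in the Fermi case [1-N] = q^N
  - q[N] = q^(-N) - q^(-1)[N]. Both forms are needed, since the deformed bracket dictates the power
  of q before the reversed product.\<close>

lemma q_comm_neg:
  assumes "i \<in> {1..M}"
  shows "y i * x i = (if fm i then T (\<lambda>k. - d i k) - qz (-1) * (x i * y i)
      else T (\<lambda>k. d i k) + qz (-1) * (x i * y i))"
proof (rule lam_rules(1))
  have "lam * (qz (-1) * (x i * y i)) = qz (-1) * (T (\<lambda>k. d i k) - T (\<lambda>k. - d i k))"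
    by (simp only: lam_left[of "qz (-1)"] lam_rules(2)[OF assms])
  then show "lam * (y i * x i) = lam * (if fm i then T (\<lambda>k. - d i k) - qz (-1) * (x i * y i)
      else T (\<lambda>k. d i k) + qz (-1) * (x i * y i))"
    unfolding lam_rules(3)[OF assms]
    by (simp add: distrib_left[of lam] right_diff_distrib[of lam]) (simp add: lam_def algebra_simps)
qed

text \<open>\<open>P\<close> stands for \<open>[N\<^sub>0]\<close>; moving it across \<open>x\<^sub>i\<close> or \<open>y\<^sub>i\<close> shifts \<open>N\<^sub>0\<close>.\<close>

lemma lam_P_left: "lam * (qz s * (P * z)) = qz s * (T (\<lambda>k. d 0 k) * z - T (\<lambda>k. - d 0 k) * z)"
proof -
  have "lam * (qz s * (P * z)) = qz s * ((lam * P) * z)"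
    by (simp only: lam_left[of "qz s"] mult.assoc)
  then show ?thesis by (simp add: lam_rules(4) left_diff_distrib)
qed

text \<open>Since \<open>x i\<close> lowers N_0, \<open>P\<close> passes to its left as [N_0+1], and
  [a+1] = q[a] + q^(-a) = q^(-1)[a] + q^a.\<close>

lemma x_P:
  assumes "i \<in> {1..M}"
  shows "x i * P = qz 1 * (P * x i) + T (\<lambda>k. - d 0 k) * x i"
    and "x i * P = qz (-1) * (P * x i) + T (\<lambda>k. d 0 k) * x i"
proof -
  have "lam * (x i * P) = x i * T (\<lambda>k. d 0 k) - x i * T (\<lambda>k. - d 0 k)"
    unfolding lam_left lam_rules(4) right_diff_distrib ..
  then have A: "lam * (x i * P) = qz 1 * (T (\<lambda>k. d 0 k) * x i) - qz (-1) * (T (\<lambda>k. - d 0 k) * x i)"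
    using assms by (simp add: T_x d_def)
  show "x i * P = qz 1 * (P * x i) + T (\<lambda>k. - d 0 k) * x i"
    by (rule lam_rules(1), unfold A distrib_left[of lam] lam_P_left) (simp add: lam_def algebra_simps)
  show "x i * P = qz (-1) * (P * x i) + T (\<lambda>k. d 0 k) * x i"
    by (rule lam_rules(1), unfold A distrib_left[of lam] lam_P_left) (simp add: lam_def algebra_simps)
qed

lemma y_P:
  assumes "i \<in> {1..M}"
  shows "y i * P = qz 1 * (P * y i) - T (\<lambda>k. d 0 k) * y i"
proof -
  have "lam * (y i * P) = y i * T (\<lambda>k. d 0 k) - y i * T (\<lambda>k. - d 0 k)"
    unfolding lam_left lam_rules(4) right_diff_distrib ..
  then have A: "lam * (y i * P) = qz (-1) * (T (\<lambda>k. d 0 k) * y i) - qz 1 * (T (\<lambda>k. - d 0 k) * y i)"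
    using assms by (simp add: T_y d_def)
  show ?thesis
    by (rule lam_rules(1), unfold A right_diff_distrib[of lam] lam_P_left) (simp add: lam_def algebra_simps)
qed


lemma xx': "i \<in> {1..M} \<Longrightarrow> j \<in> {1..M} \<Longrightarrow> i \<noteq> j \<Longrightarrow>
    x i * (x j * z) = (if fm i \<and> fm j then - (x j * (x i * z)) else x j * (x i * z))"
  and yy': "i \<in> {1..M} \<Longrightarrow> j \<in> {1..M} \<Longrightarrow> i \<noteq> j \<Longrightarrow>
    y i * (y j * z) = (if fm i \<and> fm j then - (y j * (y i * z)) else y j * (y i * z))"
  and yx': "i \<in> {1..M} \<Longrightarrow> j \<in> {1..M} \<Longrightarrow> i \<noteq> j \<Longrightarrow>
    y i * (x j * z) = (if fm i \<and> fm j then - (x j * (y i * z)) else x j * (y i * z))"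
  using xx[of i j] yy[of i j] yx[of i j] by (simp_all flip: mult.assoc)

lemma x_sq': "i \<in> {1..M} \<Longrightarrow> fm i \<Longrightarrow> x i * (x i * z) = 0"
  and y_sq': "i \<in> {1..M} \<Longrightarrow> fm i \<Longrightarrow> y i * (y i * z) = 0"
  by (simp_all add: x_sq y_sq flip: mult.assoc)

lemma xy_T:
  assumes "i \<in> {1..M}" "j \<in> {1..M}"
  shows "x i * (y j * T u) = qz (u j - u i) * (T u * (x i * y j))"
proof -
  have "x i * (y j * T u) = qz (u j - u 0) * ((x i * T u) * y j)"
    using assms by (simp add: T_y qz_left' mult.assoc)
  also have "\<dots> = qz (u j - u i) * (T u * (x i * y j))"
    using assms by (simp add: T_x mult.assoc qz_mult)
  finally show ?thesis .
qed

text \<open>The product \<open>x i * y j\<close> preserves the total number N, hence N_0;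
  \<open>i = j\<close> is included.\<close>

lemma xy_P:
  assumes "i \<in> {1..M}" "j \<in> {1..M}"
  shows "x i * (y j * P) = P * (x i * y j)" "x i * (y j * (P * z)) = P * (x i * (y j * z))"
proof -
  have d0: "d 0 j = 0" "d 0 i = 0" using assms by (auto simp: d_def)
  have "lam * (x i * (y j * P)) = x i * (y j * (lam * P))"
    unfolding lam_left ..
  also have "\<dots> = T (\<lambda>k. d 0 k) * (x i * y j) - T (\<lambda>k. - d 0 k) * (x i * y j)"
    unfolding lam_rules(4) right_diff_distrib using assms by (simp add: xy_T d0 qz_0)
  also have "\<dots> = lam * (P * (x i * y j))"
    using lam_P_left[of 0 "x i * y j"] by (simp add: qz_0)
  finally show "x i * (y j * P) = P * (x i * y j)" by (rule lam_rules(1))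
  then show "x i * (y j * (P * z)) = P * (x i * (y j * z))"
    by (metis mult.assoc)
qed

text \<open>Of four distinct indices at most one is 0, and oscillators with distinct indices
  supercommute. The parity condition in the second part is the sign of first bringing x_k to the
  front, past x_i and y_j, and then exchanging x_i with y_j.\<close>

lemma B_disjoint:
  assumes "i \<le> M" "j \<le> M" "k \<le> M" "l \<le> M" "distinct [i, j, k, l]"
  shows "B i j * B k l = (if (fm i \<noteq> fm j) \<and> (fm k \<noteq> fm l) then - (B k l * B i j) else B k l * B i j)"
      (is ?A)
    and "B i j * B k l =
      (if (fm i \<and> fm j) = (fm k \<and> (fm i \<noteq> fm j)) then B k j * B i l else - (B k j * B i l))"
      (is ?B)
proof -
  have ne: "i \<noteq> j" "i \<noteq> k" "i \<noteq> l" "j \<noteq> k" "j \<noteq> l" "k \<noteq> l" "j \<noteq> i" "k \<noteq> i" "l \<noteq> i" "k \<noteq> j" "l \<noteq> j" "l \<noteq> k"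
    using assms by auto
  consider "i = 0" "j \<noteq> 0" "k \<noteq> 0" "l \<noteq> 0" | "j = 0" "i \<noteq> 0" "k \<noteq> 0" "l \<noteq> 0"
    | "k = 0" "i \<noteq> 0" "j \<noteq> 0" "l \<noteq> 0" | "l = 0" "i \<noteq> 0" "j \<noteq> 0" "k \<noteq> 0"
    | "i \<noteq> 0" "j \<noteq> 0" "k \<noteq> 0" "l \<noteq> 0" using ne by metis
  then have "?A \<and> ?B"
  proof cases
    case 1
    have m: "j \<in> {1..M}" "k \<in> {1..M}" "l \<in> {1..M}"
      using 1 assms by simp_all
    have z: "B i j = P * y j" "B i l = P * y l" "B k l = x k * y l" "B k j = x k * y j"
      using 1 by (simp_all add: B_def)
    show ?thesis
      unfolding z mult.assoc yx'[OF m(1,2) ne(4)] yx[OF m(1,2) ne(4)] xy_P(2)[OF m(2,3)] xy_P(2)[OF m(2,1)]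
      by (cases "fm j"; cases "fm k"; cases "fm l"; simp add: 1 fm_0 yy[OF m(3,1) ne(11)] yy'[OF m(3,1) ne(11)])
  next
    case 2
    have m: "i \<in> {1..M}" "k \<in> {1..M}" "l \<in> {1..M}"
      using 2 assms by simp_all
    have z: "B i j = x i" "B k j = x k" "B k l = x k * y l" "B i l = x i * y l"
      using 2 by (simp_all add: B_def)
    show ?thesis
      unfolding z mult.assoc yx[OF m(3,1) ne(9)]
      by (cases "fm i"; cases "fm k"; cases "fm l"; simp add: 2 fm_0 xx'[OF m(2,1) ne(8)])
  next
    case 3
    have m: "i \<in> {1..M}" "j \<in> {1..M}" "l \<in> {1..M}"
      using 3 assms by simp_all
    have z: "B k l = P * y l" "B k j = P * y j" "B i j = x i * y j" "B i l = x i * y l"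
      using 3 by (simp_all add: B_def)
    show ?thesis
      unfolding z mult.assoc xy_P(2)[OF m(1,2)] yx'[OF m(3,1) ne(9)] yx'[OF m(2,1) ne(7)]
      by (cases "fm i"; cases "fm j"; cases "fm l"; simp add: 3 fm_0 yy[OF m(3,2) ne(11)])
  next
    case 4
    have m: "i \<in> {1..M}" "j \<in> {1..M}" "k \<in> {1..M}"
      using 4 assms by simp_all
    have z: "B k l = x k" "B i l = x i" "B i j = x i * y j" "B k j = x k * y j"
      using 4 by (simp_all add: B_def)
    show ?thesis
      unfolding z mult.assoc yx[OF m(2,3) ne(4)] yx[OF m(2,1) ne(7)]
      by (cases "fm i"; cases "fm j"; cases "fm k"; simp add: 4 fm_0 xx'[OF m(3,1) ne(8)])
  next
    case 5
    have m: "i \<in> {1..M}" "j \<in> {1..M}" "k \<in> {1..M}" "l \<in> {1..M}"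
      using 5 assms by simp_all
    have z: "B i j = x i * y j" "B k l = x k * y l" "B k j = x k * y j" "B i l = x i * y l"
      using 5 by (simp_all add: B_def)
    show ?thesis
      unfolding z mult.assoc yx'[OF m(2,3) ne(4)] yx'[OF m(4,1) ne(9)] yx'[OF m(2,1) ne(7)]
      by (cases "fm i"; cases "fm j"; cases "fm k"; cases "fm l"; simp add: 5 fm_0 xx'[OF m(3,1) ne(8)] yy[OF m(4,2) ne(11)])
  qed
  then show ?A ?B by blast+
qed

text \<open>For Fermi \<open>i\<close> the square of x_i vanishes. For \<open>i = 0\<close> the
  inner \<open>P\<close> does not commute with the y's, but \<open>y j\<close> and
  \<open>y l\<close> shift N_0 alike, so both orders produce the same function of N_0.\<close>

lemma B_same_left:
  assumes "i \<le> M" "j \<le> M" "l \<le> M" "distinct [i, j, l]"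
  shows "B i j * B i l = (if fm i then 0 else if fm j \<and> fm l then - (B i l * B i j) else B i l * B i j)"
proof -
  note sw = x_sq x_sq' yy[of l j] yy'[of l j] yx yx' xy_P y_P mult.assoc
  have P: "y a * (P * z) = qz 1 * (P * (y a * z)) - T (\<lambda>k. d 0 k) * (y a * z)" if "a \<in> {1..M}" for a z
    using y_P[OF that] by (simp add: left_diff_distrib flip: mult.assoc)
  show ?thesis
    using assms fm_0
    by (cases "fm i"; cases "fm j"; cases "fm l"; cases "i = 0"; cases "j = 0"; cases "l = 0"; simp add: B_def sw P right_diff_distrib qz_left')
qed

lemma B_same_right:
  assumes "i \<le> M" "j \<le> M" "k \<le> M" "distinct [i, j, k]"
  shows "B i j * B k j = (if fm j then 0 else if fm i \<and> fm k then - (B k j * B i j) else B k j * B i j)"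
proof -
  note sw = y_sq y_sq' xx[of k i] xx'[of k i] yx yx' xy_P mult.assoc
  show ?thesis
    using assms fm_0
    by (cases "fm i"; cases "fm j"; cases "fm k"; cases "i = 0"; cases "j = 0"; cases "k = 0"; simp add: B_def sw)
qed

text \<open>Exactly one of the two indices is Fermi, and its oscillator occurs twice.\<close>

lemma B_sq:
  assumes "i \<le> M" "j \<le> M" "fm i \<noteq> fm j"
  shows "B i j * B i j = 0"
proof -
  have P: "y a * (P * z) = qz 1 * (P * (y a * z)) - T (\<lambda>k. d 0 k) * (y a * z)" if "a \<in> {1..M}" for a z
    using y_P[OF that] by (simp add: left_diff_distrib flip: mult.assoc)
  have "i \<noteq> j" using assms by auto
  then show ?thesis
    using assms fm_0
    by (cases "fm i"; cases "fm j"; cases "i = 0"; cases "j = 0"; simp add: B_def yx yx' x_sq x_sq' y_sq y_sq' P mult.assoc right_diff_distrib qz_left')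
qed

text \<open>The middle product y_j x_j is reordered by one of the two forms of the q-commutation
  relation. Passing from Bose to Fermi \<open>j\<close> exchanges q and q^(-1) in the coefficient,
  which is why \<open>sg j\<close> appears. For \<open>j = 0\<close> the middle product is just
  \<open>P\<close>, and the extra term arises from moving \<open>x i\<close> across it.\<close>

lemma B_chain:
  assumes "i \<le> M" "j \<le> M" "l \<le> M" "distinct [i, j, l]"
  shows "B i j * B j l = T (\<lambda>k. d j k) * B i l
      + (if (fm i \<noteq> fm j) \<and> (fm j \<noteq> fm l) then - 1 else 1) * (qz (- sg j) * (B j l * B i j))"
    and "B i j * B j l = T (\<lambda>k. - d j k) * B i l
      + (if (fm i \<noteq> fm j) \<and> (fm j \<noteq> fm l) then - 1 else 1) * (qz (sg j) * (B j l * B i j))"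
proof -
  have qc1: "y j * (x j * z) = (if fm j then T (\<lambda>k. d j k) * z - qz 1 * (x j * (y j * z))
      else T (\<lambda>k. - d j k) * z + qz 1 * (x j * (y j * z)))" if "j \<in> {1..M}" for z
    using q_comm_pos[OF that] by (simp add: distrib_right left_diff_distrib mult.assoc flip: mult.assoc[of "y j"])
  have qc2: "y j * (x j * z) = (if fm j then T (\<lambda>k. - d j k) * z - qz (-1) * (x j * (y j * z))
      else T (\<lambda>k. d j k) * z + qz (-1) * (x j * (y j * z)))" if "j \<in> {1..M}" for z
    using q_comm_neg[OF that] by (simp add: distrib_right left_diff_distrib mult.assoc flip: mult.assoc[of "y j"])
  have T_x': "x a * (T u * z) = qz (u 0 - u a) * (T u * (x a * z))" if "a \<in> {1..M}" for a u z
    using T_x[OF that] by (simp flip: mult.assoc)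
  have T_P': "P * (T u * z) = T u * (P * z)" for u z
    using T_P by (simp flip: mult.assoc)
  have x_P1: "x i * (P * z) = qz 1 * (P * (x i * z)) + T (\<lambda>k. - d 0 k) * (x i * z)" if "i \<in> {1..M}" for z
    using x_P(1)[OF that] by (simp add: distrib_right mult.assoc flip: mult.assoc[of "x i"])
  have x_P2: "x i * (P * z) = qz (-1) * (P * (x i * z)) + T (\<lambda>k. d 0 k) * (x i * z)" if "i \<in> {1..M}" for z
    using x_P(2)[OF that] by (simp add: distrib_right mult.assoc flip: mult.assoc[of "x i"])
  note rl = xx[of j i] xx'[of j i] yy[of l j] yy'[of l j] yx[of l i] yx'[of l i] yx[of l j] yx'[of l j]
    yx[of j i] yx'[of j i] xy_P mult.assoc qz_left' T_x T_x' T_P T_P' qz_0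
    distrib_left right_diff_distrib sg_def
  have d: "d j i = 0" "d j l = 0" "d j j = 1" "j \<noteq> 0 \<Longrightarrow> d j 0 = 0" using assms by (auto simp: d_def)
  show "B i j * B j l = T (\<lambda>k. d j k) * B i l
      + (if (fm i \<noteq> fm j) \<and> (fm j \<noteq> fm l) then - 1 else 1) * (qz (- sg j) * (B j l * B i j))"
  proof (cases "j = 0")
    case True
    then show ?thesis
      using assms fm_0 by (cases "fm i"; cases "fm l"; simp add: B_def rl d x_P2 x_P(2))
  next
    case False
    show ?thesis
    proof (cases "fm j")
      case True
      then show ?thesis
        using False assms fm_0
        by (cases "fm i"; cases "fm l"; cases "i = 0"; cases "l = 0"; simp add: B_def rl d qc1 q_comm_pos[of j])
    next
      case f: False
      then show ?thesis
        using False assms fm_0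
        by (cases "fm i"; cases "fm l"; cases "i = 0"; cases "l = 0"; simp add: B_def rl d qc2 q_comm_neg[of j])
    qed
  qed
  show "B i j * B j l = T (\<lambda>k. - d j k) * B i l
      + (if (fm i \<noteq> fm j) \<and> (fm j \<noteq> fm l) then - 1 else 1) * (qz (sg j) * (B j l * B i j))"
  proof (cases "j = 0")
    case True
    then show ?thesis
      using assms fm_0 by (cases "fm i"; cases "fm l"; simp add: B_def rl d x_P1 x_P(1))
  next
    case False
    show ?thesis
    proof (cases "fm j")
      case True
      then show ?thesis
        using False assms fm_0
        by (cases "fm i"; cases "fm l"; cases "i = 0"; cases "l = 0"; simp add: B_def rl d qc2 q_comm_neg[of j])
    next
      case f: False
      then show ?thesis
        using False assms fm_0
        by (cases "fm i"; cases "fm l"; cases "i = 0"; cases "l = 0"; simp add: B_def rl d qc1 q_comm_pos[of j])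
    qed
  qed
qed

end

section \<open>Root vectors in the oscillator algebra\<close>

context qosc begin

definition s :: "nat \<Rightarrow> nat \<Rightarrow> nat \<Rightarrow> int" where
  "s i j k = (if i < j then of_bool (i < k \<and> k < j) else - of_bool (j < k \<and> k < i))"

definition E :: "nat \<Rightarrow> nat \<Rightarrow> 'a" where "E i j = T (s i j) * B i j"

definition sgn2 :: "nat \<Rightarrow> nat \<Rightarrow> nat \<Rightarrow> nat \<Rightarrow> 'a" where
  "sgn2 i j k l = (if (fm i \<noteq> fm j) \<and> (fm k \<noteq> fm l) then -1 else 1)"

text \<open>The scalar records how \<open>B i j\<close> changes the number weighted by
  \<open>s k l\<close>. Once the torus factors stand on the left, two products are compared through
  this scalar and the \<open>B\<close> factors alone.\<close>

lemma E_E: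
  assumes "i \<le> M" "j \<le> M" "i \<noteq> j"
  shows "E i j * E k l = qz (s k l j - s k l i) * (T (\<lambda>m. s i j m + s k l m) * (B i j * B k l))"
proof -
  have "E i j * E k l = T (s i j) * ((B i j * T (s k l)) * B k l)"
    by (simp add: E_def mult.assoc)
  also have "\<dots> = qz (s k l j - s k l i) * (T (s i j) * (T (s k l) * (B i j * B k l)))"
    unfolding B_T[OF assms] by (simp add: mult.assoc qz_left')
  finally show ?thesis unfolding T_mult .
qed

lemma E_E':
  assumes "k \<le> M" "l \<le> M" "k \<noteq> l"
  shows "E k l * E i j = qz (s i j l - s i j k) * (T (\<lambda>m. s i j m + s k l m) * (B k l * B i j))"
  using E_E[OF assms] by (simp add: add.commute)

text \<open>The \<open>B\<close> factors supercommute, so the bracket survives only through the two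
  scalars. These agree for separated or nested intervals; for crossing ones they are q and
  q^(-1).\<close>

lemma E_bracket_disjoint:
  assumes "i \<le> M" "j \<le> M" "k \<le> M" "l \<le> M" "distinct [i, j, k, l]"
  shows "E i j * E k l - sgn2 i j k l * (E k l * E i j) =
    (qz (s k l j - s k l i) - qz (s i j l - s i j k)) * (T (\<lambda>m. s i j m + s k l m) * (B i j * B k l))"
proof -
  have "sgn2 i j k l * (B k l * B i j) = B i j * B k l"
    using B_disjoint(1)[OF assms] by (simp add: sgn2_def)
  moreover have "sgn2 i j k l * (a * (b * c)) = a * (b * (sgn2 i j k l * c))" for a b c
    by (simp add: sgn2_def)
  ultimately show ?thesis
    using assms E_E[of i j k l] E_E'[of k l i j] by (simp add: left_diff_distrib)
qed

text \<open>For a Fermi index N_i x_i = x_i, so a change of the exponent at \<open>i\<close> costs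
  only a scalar.\<close>

lemma T_B_left:
  assumes "fm i" "i \<le> M" "j \<le> M" "i \<noteq> j" "\<And>m. m \<noteq> i \<Longrightarrow> u m = v m"
  shows "T u * B i j = qz (u i - v i) * (T v * B i j)"
proof -
  have u: "u = v(i := u i)" using assms(5) by auto
  have i: "i \<noteq> 0" "i \<in> {1..M}" using assms fm_0 by (auto intro: gr0I Suc_leI)
  have "T u * x i = qz (u i - v i) * (T v * x i)"
    by (subst u) (rule T_fx[OF i(2) assms(1)])
  then have "(T u * x i) * y j = (qz (u i - v i) * (T v * x i)) * y j" by simp
  then show ?thesis
    using i assms(1) T_fx[OF i(2) assms(1), of v "u i"] u by (simp add: B_def mult.assoc)
qed

text \<open>For a Fermi index N_j y_j = 0, so the exponent at \<open>j\<close> may be changed freely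
  before y_j.\<close>

lemma T_B_right:
  assumes "fm j" "i \<le> M" "j \<le> M" "i \<noteq> j" "\<And>m. m \<noteq> j \<Longrightarrow> u m = v m"
  shows "T u * B i j = T v * B i j"
proof -
  have u: "u = v(j := u j)" using assms(5) by auto
  have j: "j \<noteq> 0" "j \<in> {1..M}" using assms fm_0 by (auto intro: gr0I Suc_leI)
  have e: "T u * y j = T v * y j"
    by (subst u) (rule T_fy[OF j(2) assms(1)])
  show ?thesis
  proof (cases "i = 0")
    case True
    have "T w * (P * y j) = P * (T w * y j)" for w
      using T_P by (simp flip: mult.assoc)
    then show ?thesis using True e by (simp add: B_def)
  next
    case False
    then have i: "i \<in> {1..M}" using assms by simp
    \<comment> \<open>Passing \<open>x i\<close> involves the exponents at \<open>i\<close> and 0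
      only, and \<open>j\<close> is neither of them.\<close>
    have "T w * (x i * y j) = qz (w i - w 0) * (x i * (T w * y j))" for w
      using i by (simp add: T_x mult.assoc flip: mult.assoc[of "x i"]) (simp add: qz_mult qz_0 mult.assoc)
    moreover have "u i - u 0 = v i - v 0" using assms j by simp
    ultimately show ?thesis using False j e by (simp add: B_def)
  qed
qed

lemma T_BB_left:
  assumes "fm i" "i \<le> M" "j \<le> M" "k \<le> M" "l \<le> M" "distinct [i, j, k, l]" "\<And>m. m \<noteq> i \<Longrightarrow> u m = v m"
  shows "T u * (B i j * B k l) = qz (u i - v i) * (T v * (B i j * B k l))"
    and "T u * (B k l * B i j) = qz (u i - v i) * (T v * (B k l * B i j))"
proof -
  have "T u * B i j = qz (u i - v i) * (T v * B i j)"
    using assms by (intro T_B_left) auto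
  then show 1: "T u * (B i j * B k l) = qz (u i - v i) * (T v * (B i j * B k l))"
    by (simp flip: mult.assoc)
  have "B i j * B k l = B k l * B i j \<or> B i j * B k l = - (B k l * B i j)"
    by (metis B_disjoint(1)[OF assms(2-6)])
  then show "T u * (B k l * B i j) = qz (u i - v i) * (T v * (B k l * B i j))"
    using 1 by (elim disjE) simp_all
qed

lemma T_BB_right:
  assumes "fm j" "i \<le> M" "j \<le> M" "k \<le> M" "l \<le> M" "distinct [i, j, k, l]" "\<And>m. m \<noteq> j \<Longrightarrow> u m = v m"
  shows "T u * (B i j * B k l) = T v * (B i j * B k l)"
    and "T u * (B k l * B i j) = T v * (B k l * B i j)"
proof -
  have "T u * B i j = T v * B i j"
    using assms by (intro T_B_right) auto
  then show 1: "T u * (B i j * B k l) = T v * (B i j * B k l)"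
    by (simp flip: mult.assoc)
  have "B i j * B k l = B k l * B i j \<or> B i j * B k l = - (B k l * B i j)"
    by (metis B_disjoint(1)[OF assms(2-6)])
  then show "T u * (B k l * B i j) = T v * (B k l * B i j)"
    using 1 by (elim disjE) simp_all
qed

lemma sgn2_central: "a * (sgn2 i j k l * b) = sgn2 i j k l * (a * b)"
  by (simp add: sgn2_def)

text \<open>The open intervals of \<open>s i j\<close> and \<open>s j l\<close> leave out
  \<open>j\<close>; the factor \<open>T (d j)\<close> of the first form of \<open>B_chain\<close>
  fills the gap. This choice of form determines the power of q in the bracket.\<close>

lemma E_chain_pos:
  assumes "i < j" "j < l" "l \<le> M"
  shows "E i j * E j l = E i l + sgn2 i j j l * (qz (- sg j) * (E j l * E i j))"
proof -
  have a: "s j l j - s j l i = 0" "s i j l - s i j j = 0"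
    using assms by (simp_all add: s_def)
  have b: "(\<lambda>m. s i j m + s j l m + d j m) = s i l"
    using assms by (auto simp: s_def d_def fun_eq_iff)
  have "B i j * B j l = T (\<lambda>k. d j k) * B i l + sgn2 i j j l * (qz (- sg j) * (B j l * B i j))"
    using assms B_chain(1)[of i j l] by (simp add: sgn2_def)
  then show ?thesis
    using assms E_E[of i j j l] E_E'[of j l i j]
    unfolding a by (simp add: qz_0 distrib_left T_mult b sgn2_central qz_left' flip: E_def)
qed

text \<open>For descending indices the gap at \<open>j\<close> must be filled by -1, which calls for
  the second form of \<open>B_chain\<close> and inverts the power of q.\<close>

lemma E_chain_neg:
  assumes "l < j" "j < i" "i \<le> M"
  shows "E i j * E j l = E i l + sgn2 i j j l * (qz (sg j) * (E j l * E i j))"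
proof -
  have a: "s j l j - s j l i = 0" "s i j l - s i j j = 0"
    using assms by (simp_all add: s_def)
  have b: "(\<lambda>m. s i j m + s j l m - d j m) = s i l"
    using assms by (auto simp: s_def d_def fun_eq_iff)
  have "B i j * B j l = T (\<lambda>k. - d j k) * B i l + sgn2 i j j l * (qz (sg j) * (B j l * B i j))"
    using assms B_chain(2)[of i j l] by (simp add: sgn2_def)
  then show ?thesis
    using assms E_E[of i j j l] E_E'[of j l i j]
    unfolding a by (simp add: qz_0 distrib_left T_mult b sgn2_central qz_left' flip: E_def)
qed

text \<open>For Fermi \<open>i\<close> both products vanish, as x_i squares to zero. For Bose
  \<open>i\<close> the factor q arises because \<open>j\<close> lies inside the interval of
  \<open>s i l\<close>.\<close>

lemma E_same_left_pos:
  assumes "i < j" "j < l" "l \<le> M"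
  shows "E i j * E i l = sgn2 i j i l * (qz (sg i) * (E i l * E i j))"
proof -
  have a: "s i l j - s i l i = 1" "s i j l - s i j i = 0"
    using assms by (simp_all add: s_def)
  show ?thesis
  proof (cases "fm i")
    case True
    then show ?thesis using assms E_E[of i j i l] E_E'[of i l i j] B_same_left[of i j l] B_same_left[of i l j] by simp
  next
    case False
    then show ?thesis using assms E_E[of i j i l] E_E'[of i l i j] B_same_left[of i j l]
      unfolding a by (simp_all add: sgn2_def qz_0 sg_def)
  qed
qed

lemma E_same_left_neg:
  assumes "l < j" "j < i" "i \<le> M"
  shows "E i j * E i l = sgn2 i j i l * (qz (- sg i) * (E i l * E i j))"
proof -
  have a: "s i l j - s i l i = - 1" "s i j l - s i j i = 0"
    using assms by (simp_all add: s_def)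
  show ?thesis
  proof (cases "fm i")
    case True
    then show ?thesis using assms E_E[of i j i l] E_E'[of i l i j] B_same_left[of i j l] B_same_left[of i l j] by simp
  next
    case False
    then show ?thesis using assms E_E[of i j i l] E_E'[of i l i j] B_same_left[of i j l]
      unfolding a by (simp_all add: sgn2_def qz_0 sg_def)
  qed
qed

text \<open>For Fermi \<open>j\<close> both products vanish. For Bose \<open>j\<close> the scalar
  sits in the reversed product: \<open>k\<close> lies inside the interval of \<open>s i j\<close>,
  which gives q^(-1) there.\<close>

lemma E_same_right_pos:
  assumes "i < k" "k < j" "j \<le> M"
  shows "E i j * E k j = sgn2 i j k j * (qz (sg j) * (E k j * E i j))"
proof -
  have a: "s k j j - s k j i = 0" "s i j j - s i j k = - 1"
    using assms by (simp_all add: s_def)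
  show ?thesis
  proof (cases "fm j")
    case True
    then show ?thesis using assms E_E[of i j k j] E_E'[of k j i j] B_same_right[of i j k] B_same_right[of k j i] by simp
  next
    case False
    then show ?thesis using assms E_E[of i j k j] E_E'[of k j i j] B_same_right[of i j k]
      unfolding a by (simp_all add: sgn2_def qz_0 sg_def qz_mult)
  qed
qed

lemma E_same_right_neg:
  assumes "j < k" "k < i" "i \<le> M"
  shows "E i j * E k j = sgn2 i j k j * (qz (- sg j) * (E k j * E i j))"
proof -
  have a: "s k j j - s k j i = 0" "s i j j - s i j k = 1"
    using assms by (simp_all add: s_def)
  show ?thesis
  proof (cases "fm j")
    case True
    then show ?thesis using assms E_E[of i j k j] E_E'[of k j i j] B_same_right[of i j k] B_same_right[of k j i] by simp
  next
    case False
    then show ?thesis using assms E_E[of i j k j] E_E'[of k j i j] B_same_right[of i j k]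
      unfolding a by (simp_all add: sgn2_def qz_0 sg_def qz_mult)
  qed
qed

lemma E_sq: "i \<le> M \<Longrightarrow> j \<le> M \<Longrightarrow> fm i \<noteq> fm j \<Longrightarrow> E i j * E i j = 0"
  using E_E[of i j i j] B_sq[of i j] by (cases "i = j") auto

text \<open>The open intervals (i,j) and (k,l) have intersection (k,j) and union (i,l), which
  explains the indices on the right; the two scalars q and q^(-1) combine to
  \<open>lam\<close>.\<close>

lemma E_cross_pos:
  assumes "i < k" "k < j" "j < l" "l \<le> M"
  shows "E i j * E k l - sgn2 i j k l * (E k l * E i j) = lam * (of_int (sg k) * (E k j * E i l))"
proof -
  have a: "s k l j - s k l i = 1" "s i j l - s i j k = - 1" "s i l j - s i l k = 0"
    using assms by (simp_all add: s_def)
  have b: "(\<lambda>m. s i j m + s k l m) = (\<lambda>m. s k j m + s i l m)"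
    using assms by (auto simp: s_def fun_eq_iff)
  \<comment> \<open>Parity is monotone in the index, so with \<open>i < k < j\<close> the sign of
    the regrouping depends on \<open>k\<close> alone.\<close>
  have "B i j * B k l = of_int (sg k) * (B k j * B i l)"
    using assms B_disjoint(2)[of i j k l] fm_mono[of i k] fm_mono[of k j] by (auto simp: sg_def)
  then show ?thesis
    using assms E_bracket_disjoint[of i j k l] E_E[of k j i l]
    unfolding a b by (simp add: lam_def qz_0 sg_def)
qed

lemma E_cross_neg:
  assumes "l < j" "j < k" "k < i" "i \<le> M"
  shows "E i j * E k l - sgn2 i j k l * (E k l * E i j) = - (lam * (of_int (sg k) * (E k j * E i l)))"
proof -
  have a: "s k l j - s k l i = - 1" "s i j l - s i j k = 1" "s i l j - s i l k = 0"
    using assms by (simp_all add: s_def)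
  have b: "(\<lambda>m. s i j m + s k l m) = (\<lambda>m. s k j m + s i l m)"
    using assms by (auto simp: s_def fun_eq_iff)
  have "B i j * B k l = of_int (sg k) * (B k j * B i l)"
    using assms B_disjoint(2)[of i j k l] fm_mono[of j k] fm_mono[of k i] by (auto simp: sg_def)
  then show ?thesis
    using assms E_bracket_disjoint[of i j k l] E_E[of k j i l]
    unfolding a b by (simp add: lam_def qz_0 sg_def left_diff_distrib)
qed

theorem E_pos:
  assumes "i < j" "k < l" "i < k \<or> i = k \<and> j < l" "j \<le> M" "l \<le> M"
  shows "E i j * E k l - sgn2 i j k l * (qz (sg j * of_bool (j = l) - sg j * of_bool (j = k)
        + sg i * of_bool (i = k)) * (E k l * E i j))
      = of_bool (j = k) * E i l
        + lam * (of_int (sg k) * (of_bool (l > j \<and> j > k \<and> k > i) * (E k j * E i l)))"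
proof -
  \<comment> \<open>The intervals have a common left end, a common right end, or are adjacent,
    separated, crossing, nested.\<close>
  consider "i = k" "j < l" | "j = l" "i < k" | "j = k" | "j < k" | "i < k" "k < j" "j < l" | "i < k" "l < j"
    using assms(3) by linarith
  then show ?thesis
  proof cases
    case 1 then show ?thesis using assms E_same_left_pos[of i j l] by simp
  next
    case 2 then show ?thesis using assms E_same_right_pos[of i k j] by simp
  next
    case 3 then show ?thesis using assms E_chain_pos[of i j l] by simp
  next
    case 4 then show ?thesis using assms E_bracket_disjoint[of i j k l] by (simp add: s_def qz_0)
  next
    case 5 then show ?thesis using assms E_cross_pos[of i k j l] by (simp add: qz_0)
  next
    case 6 then show ?thesis using assms E_bracket_disjoint[of i j k l] by (simp add: s_def qz_0)
  qed
qed

theorem E_neg: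
  assumes "i > j" "k > l" "k < i \<or> k = i \<and> l < j" "i \<le> M" "k \<le> M"
  shows "E i j * E k l - sgn2 i j k l * (qz (- sg j * of_bool (j = l) + sg j * of_bool (j = k)
        - sg i * of_bool (i = k)) * (E k l * E i j))
      = of_bool (j = k) * E i l
        - lam * (of_int (sg k) * (of_bool (i > k \<and> k > j \<and> j > l) * (E k j * E i l)))"
proof -
  consider "i = k" "l < j" | "j = l" "k < i" | "j = k" | "k < j" | "k < i" "j < k" "l < j" | "k < i" "j < l"
    using assms(3) by linarith
  then show ?thesis
  proof cases
    case 1 then show ?thesis using assms E_same_left_neg[of l j i] by simp
  next
    case 2 then show ?thesis using assms E_same_right_neg[of j k i] by simp
  next
    case 3 then show ?thesis using assms E_chain_neg[of l j i] by simp
  next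
    case 4 then show ?thesis using assms E_bracket_disjoint[of i j k l] by (simp add: s_def qz_0)
  next
    case 5 then show ?thesis using assms E_cross_neg[of l j k i] by (simp add: qz_0)
  next
    case 6 then show ?thesis using assms E_bracket_disjoint[of i j k l] by (simp add: s_def qz_0)
  qed
qed

end

section \<open>Brackets of a positive with a negative root vector\<close>

context qosc begin

text \<open>This is the exponent of L_i times the inverse of L_k, in which the N_0 parts cancel. It
  also covers index 0: as \<open>sg 0 = 1\<close>, the exponent of L_0 is zero.\<close>

definition V :: "nat \<Rightarrow> nat \<Rightarrow> nat \<Rightarrow> int" where
  "V i k = (\<lambda>m. sg k * d k m - sg i * d i m)"

definition sgn1 :: "nat \<Rightarrow> nat \<Rightarrow> 'a" where "sgn1 i j = (if fm i \<noteq> fm j then -1 else 1)"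

lemma E_T:
  assumes "i \<le> M" "j \<le> M" "i \<noteq> j"
  shows "E i j * T u = qz (u j - u i) * (T (\<lambda>m. s i j m + u m) * B i j)"
  by (simp add: E_def mult.assoc B_T[OF assms] qz_left' T_mult)

text \<open>The repeated index is \<open>i\<close>, and y_i stands before x_i in the reversed
  product \<open>B k i * B i j\<close>; hence that product is expanded by
  \<open>B_chain\<close>.\<close>

lemma mixed_left_lt:
  assumes "i < k" "k < j" "j \<le> M"
  shows "E i j * E k i - sgn2 i j k i * (E k i * E i j) = - (sgn1 k i * (E k j * T (V i k)))"
proof -
  have a: "s k i j - s k i i = 0" "s i j i - s i j k = - 1"
    using assms by (simp_all add: s_def)
  have f: "fm i \<Longrightarrow> fm k" "fm k \<Longrightarrow> fm j" using assms fm_mono[of i k] fm_mono[of k j] by auto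
  have V: "V i k j - V i k k = - sg k" using assms by (simp add: V_def d_def)
  let ?u = "\<lambda>m. s i j m + s k i m"
  have 1: "E i j * E k i - sgn2 i j k i * (E k i * E i j)
      = T ?u * (B i j * B k i) - sgn2 i j k i * (qz (-1) * (T ?u * (B k i * B i j)))"
    using assms E_E[of i j k i] E_E'[of k i i j] unfolding a by (simp add: qz_0)
  have R: "E k j * T (V i k) = qz (- sg k) * (T (\<lambda>m. s k j m + V i k m) * B k j)"
    using assms E_T[of k j "V i k"] unfolding V by simp
  \<comment> \<open>For Bose \<open>k\<close> the exponents coincide. For Fermi \<open>k\<close>
    they may differ at \<open>k\<close>, the left index of \<open>B k j\<close>, where N_k acts as
    1.\<close>
  have 2: "T (\<lambda>m. ?u m - sg i * d i m) * B k j = qz (1 - sg k) * (T (\<lambda>m. s k j m + V i k m) * B k j)"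
  proof (cases "fm k")
    case True
    have "T (\<lambda>m. ?u m - sg i * d i m) * B k j = qz ((?u k - sg i * d i k) - (s k j k + V i k k))
        * (T (\<lambda>m. s k j m + V i k m) * B k j)"
      using True assms by (intro T_B_left) (auto simp: s_def V_def d_def)
    moreover have "(?u k - sg i * d i k) - (s k j k + V i k k) = 1 - sg k"
      using assms by (simp add: s_def V_def d_def)
    ultimately show ?thesis by simp
  next
    case False
    then have "(\<lambda>m. ?u m - sg i * d i m) = (\<lambda>m. s k j m + V i k m)"
      using assms by (auto simp: s_def V_def d_def sg_def fun_eq_iff)
    then show ?thesis using False by (simp add: sg_def qz_0)
  qed
  \<comment> \<open>The parity of \<open>i\<close> decides which half of \<open>B_chain\<close> has
    coefficient q before the reversed product; this q cancels the q^(-1) in \<open>1\<close>, and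
    the quadratic terms drop out.\<close>
  have "B k i * B i j = T (\<lambda>m. - sg i * d i m) * B k j + sgn2 i j k i * (qz 1 * (B i j * B k i))"
    using assms B_chain[of k i j] by (cases "fm i") (auto simp: sg_def sgn2_def)
  then show ?thesis unfolding 1 R using 2 f
    by (auto simp: sgn2_def sgn1_def distrib_left qz_left' qz_mult qz_0 T_mult)
qed

text \<open>Again \<open>i\<close> repeats, but the exponents can differ at \<open>j\<close>, the
  right index of \<open>B k j\<close>. A Fermi number operator is 0 there, so no scalar is left
  over.\<close>

lemma mixed_left_gt:
  assumes "i < j" "j < k" "k \<le> M"
  shows "E i j * E k i - sgn2 i j k i * (E k i * E i j) = - (sgn1 i j * (T (V j i) * E k j))"
proof -
  have a: "s k i j - s k i i = - 1" "s i j i - s i j k = 0"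
    using assms by (simp_all add: s_def)
  have f: "fm i \<Longrightarrow> fm j" "fm j \<Longrightarrow> fm k" using assms fm_mono[of i j] fm_mono[of j k] by auto
  let ?u = "\<lambda>m. s i j m + s k i m"
  have 1: "E i j * E k i - sgn2 i j k i * (E k i * E i j)
      = qz (-1) * (T ?u * (B i j * B k i)) - sgn2 i j k i * (T ?u * (B k i * B i j))"
    using assms E_E[of i j k i] E_E'[of k i i j] unfolding a by (simp add: qz_0)
  have R: "T (V j i) * E k j = T (\<lambda>m. V j i m + s k j m) * B k j"
    by (simp add: E_def T_mult)
  have 2: "T (\<lambda>m. ?u m + sg i * d i m) * B k j = T (\<lambda>m. V j i m + s k j m) * B k j"
  proof (cases "fm j")
    case True
    then show ?thesis
      using assms by (intro T_B_right) (auto simp: s_def V_def d_def)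
  next
    case False
    then have "(\<lambda>m. ?u m + sg i * d i m) = (\<lambda>m. V j i m + s k j m)"
      using assms by (auto simp: s_def V_def d_def sg_def fun_eq_iff)
    then show ?thesis by simp
  qed
  have "B k i * B i j = T (\<lambda>m. sg i * d i m) * B k j + sgn2 i j k i * (qz (-1) * (B i j * B k i))"
    using assms B_chain[of k i j] by (cases "fm i") (auto simp: sg_def sgn2_def)
  then show ?thesis unfolding 1 R using 2 f
    by (auto simp: sgn2_def sgn1_def distrib_left qz_left' T_mult)
qed

text \<open>Now \<open>j\<close> repeats and the first product is the one expanded. The Fermi
  correction at \<open>i\<close>, the left index of \<open>B i l\<close>, leaves a scalar, which is
  matched by the one from moving \<open>T (V i j)\<close> across the root vector.\<close>

lemma mixed_right_lt:
  assumes "l < i" "i < j" "j \<le> M"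
  shows "E i j * E j l - sgn2 i j j l * (E j l * E i j) = E i l * T (V i j)"
proof -
  have a: "s j l j - s j l i = 1" "s i j l - s i j j = 0"
    using assms by (simp_all add: s_def)
  have V: "V i j l - V i j i = sg i" using assms by (simp add: V_def d_def)
  let ?u = "\<lambda>m. s i j m + s j l m"
  have 1: "E i j * E j l - sgn2 i j j l * (E j l * E i j)
      = qz 1 * (T ?u * (B i j * B j l)) - sgn2 i j j l * (T ?u * (B j l * B i j))"
    using assms E_E[of i j j l] E_E'[of j l i j] unfolding a by (simp add: qz_0)
  have R: "E i l * T (V i j) = qz (sg i) * (T (\<lambda>m. s i l m + V i j m) * B i l)"
    using assms E_T[of i l "V i j"] unfolding V by simp
  have 2: "T (\<lambda>m. ?u m + sg j * d j m) * B i l = qz (sg i - 1) * (T (\<lambda>m. s i l m + V i j m) * B i l)"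
  proof (cases "fm i")
    case True
    have "T (\<lambda>m. ?u m + sg j * d j m) * B i l = qz ((?u i + sg j * d j i) - (s i l i + V i j i))
        * (T (\<lambda>m. s i l m + V i j m) * B i l)"
      using True assms by (intro T_B_left) (auto simp: s_def V_def d_def)
    moreover have "(?u i + sg j * d j i) - (s i l i + V i j i) = sg i - 1"
      using True assms by (simp add: s_def V_def d_def sg_def)
    ultimately show ?thesis by simp
  next
    case False
    have "(\<lambda>m. ?u m + sg j * d j m) = (\<lambda>m. s i l m + V i j m)"
      using assms False by (auto simp: s_def V_def d_def sg_def fun_eq_iff)
    then show ?thesis using False by (simp add: sg_def qz_0)
  qed
  have "B i j * B j l = T (\<lambda>m. sg j * d j m) * B i l + sgn2 i j j l * (qz (-1) * (B j l * B i j))"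
    using assms B_chain[of i j l] by (cases "fm j") (simp_all add: sg_def sgn2_def)
  then show ?thesis unfolding 1 R using 2
    by (auto simp: sgn2_def distrib_left qz_left' qz_mult qz_0 T_mult)
qed

lemma mixed_right_gt:
  assumes "i < l" "l < j" "j \<le> M"
  shows "E i j * E j l - sgn2 i j j l * (E j l * E i j) = T (V j l) * E i l"
proof -
  have a: "s j l j - s j l i = 0" "s i j l - s i j j = 1"
    using assms by (simp_all add: s_def)
  let ?u = "\<lambda>m. s i j m + s j l m"
  have 1: "E i j * E j l - sgn2 i j j l * (E j l * E i j)
      = T ?u * (B i j * B j l) - sgn2 i j j l * (qz 1 * (T ?u * (B j l * B i j)))"
    using assms E_E[of i j j l] E_E'[of j l i j] unfolding a by (simp add: qz_0)
  have R: "T (V j l) * E i l = T (\<lambda>m. V j l m + s i l m) * B i l"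
    by (simp add: E_def T_mult)
  have 2: "T (\<lambda>m. ?u m - sg j * d j m) * B i l = T (\<lambda>m. V j l m + s i l m) * B i l"
  proof (cases "fm l")
    case True
    then show ?thesis
      using assms by (intro T_B_right) (auto simp: s_def V_def d_def)
  next
    case False
    have "(\<lambda>m. ?u m - sg j * d j m) = (\<lambda>m. V j l m + s i l m)"
      using assms False by (auto simp: s_def V_def d_def sg_def fun_eq_iff)
    then show ?thesis by simp
  qed
  have "B i j * B j l = T (\<lambda>m. - sg j * d j m) * B i l + sgn2 i j j l * (qz 1 * (B j l * B i j))"
    using assms B_chain[of i j l] by (cases "fm j") (simp_all add: sg_def sgn2_def)
  then show ?thesis unfolding 1 R using 2
    by (auto simp: sgn2_def distrib_left qz_left' T_mult)
qed

text \<open>The crossing intervals give \<open>lam\<close> as for roots of equal sign. The exponents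
  of the two sides can differ at both left indices \<open>k\<close> and \<open>i\<close>, and the
  scalars from Fermi corrections there match those from moving \<open>T (V i k)\<close> to the
  left.\<close>

lemma mixed_cross_lt:
  assumes "l < i" "i < k" "k < j" "j \<le> M"
  shows "E i j * E k l - sgn2 i j k l * (E k l * E i j)
    = lam * (of_int (sg k) * (E k j * (E i l * T (V i k))))"
proof -
  have a: "s k l j - s k l i = 1" "s i j l - s i j k = - 1" "s i l j - s i l k = 0"
    using assms by (simp_all add: s_def)
  have V: "V i k l - V i k i + (V i k j - V i k k) = sg i - sg k" using assms by (simp add: V_def d_def)
  let ?u = "\<lambda>m. s i j m + s k l m" and ?v = "\<lambda>m. s k j m + (s i l m + V i k m)"
  have e: "V i k l - V i k i + (s i l j + V i k j - (s i l k + V i k k)) = sg i - sg k"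
    using a(3) V by simp
  have "E k j * (E i l * T (V i k)) = qz (V i k l - V i k i) * (E k j * (T (\<lambda>m. s i l m + V i k m) * B i l))"
    using assms by (subst E_T) (auto simp: qz_left)
  also have "E k j * (T (\<lambda>m. s i l m + V i k m) * B i l)
      = qz (s i l j + V i k j - (s i l k + V i k k)) * (T ?v * (B k j * B i l))"
    using assms by (simp add: E_T mult.assoc flip: mult.assoc[of "E k j"])
  finally have R: "E k j * (E i l * T (V i k)) = qz (sg i - sg k) * (T ?v * (B k j * B i l))"
    using e by (simp only: qz_mult)
  have 1: "B i j * B k l = of_int (sg k) * (B k j * B i l)"
    using assms B_disjoint(2)[of i j k l] fm_mono[of i k] fm_mono[of k j] by (auto simp: sg_def)
  \<comment> \<open>An intermediate exponent that changes \<open>k\<close> before \<open>i\<close>,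
    so that each Fermi index takes one application of \<open>T_BB_left\<close>.\<close>
  define w where "w = (\<lambda>m. if m = k then ?v k else ?u m)"
  have "T ?u * (B k j * B i l) = qz (?u k - w k) * (T w * (B k j * B i l))"
  proof (cases "fm k")
    case True
    then show ?thesis using assms by (intro T_BB_left) (auto simp: w_def)
  next
    case False
    then have "?u = w" using assms by (auto simp: w_def fun_eq_iff s_def V_def d_def sg_def)
    from this fun_cong[OF this, of k] show ?thesis by (simp add: qz_0)
  qed
  moreover have "T w * (B k j * B i l) = qz (w i - ?v i) * (T ?v * (B k j * B i l))"
  proof (cases "fm i")
    case True
    then show ?thesis using assms
      by (intro T_BB_left(2)) (auto simp: w_def s_def V_def d_def)
  next
    case False
    then have "w = ?v" using assms by (auto simp: w_def fun_eq_iff s_def V_def d_def sg_def)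
    from this fun_cong[OF this, of i] show ?thesis by (simp add: qz_0)
  qed
  moreover have "?u k - w k + (w i - ?v i) = sg i - sg k"
    using assms by (simp add: w_def s_def V_def d_def)
  ultimately have "T ?u * (B k j * B i l) = E k j * (E i l * T (V i k))"
    unfolding R by (simp add: qz_mult)
  then show ?thesis
    using assms E_bracket_disjoint[of i j k l] unfolding a 1
    by (simp add: lam_def sg_def)
qed

text \<open>The exponents can differ at the right indices \<open>l\<close> and \<open>j\<close>,
  where the Fermi number operators vanish. The product comes in the order
  \<open>B i l * B k j\<close>, so the regrouping is followed by a supercommutation, and the
  resulting sign is that of \<open>j\<close>.\<close>

lemma mixed_cross_gt:
  assumes "i < l" "l < j" "j < k" "k \<le> M"
  shows "E i j * E k l - sgn2 i j k l * (E k l * E i j)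
    = - (T (V j l) * (lam * (of_int (sg j) * (E i l * E k j))))"
proof -
  have a: "s k l j - s k l i = - 1" "s i j l - s i j k = 1" "s k j l - s k j i = 0"
    using assms by (simp_all add: s_def)
  let ?u = "\<lambda>m. s i j m + s k l m" and ?v = "\<lambda>m. V j l m + (s i l m + s k j m)"
  have R: "T (V j l) * (E i l * E k j) = T ?v * (B i l * B k j)"
    using assms by (simp add: E_E a qz_0 T_mult)
  have "B i j * B k l = (if (fm i \<and> fm j) = (fm k \<and> (fm i \<noteq> fm j)) then B k j * B i l else - (B k j * B i l))"
    using assms by (intro B_disjoint) auto
  moreover have "B k j * B i l = (if (fm k \<noteq> fm j) \<and> (fm i \<noteq> fm l) then - (B i l * B k j) else B i l * B k j)"
    using assms by (intro B_disjoint) auto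
  ultimately have 1: "B i j * B k l = of_int (sg j) * (B i l * B k j)"
    using assms fm_mono[of i l] fm_mono[of l j] fm_mono[of j k] by (auto simp: sg_def)
  define w where "w = (\<lambda>m. if m = l then ?v l else ?u m)"
  have "T ?u * (B i l * B k j) = T w * (B i l * B k j)"
  proof (cases "fm l")
    case True
    then show ?thesis using assms by (intro T_BB_right) (auto simp: w_def)
  next
    case False
    then have "?u = w" using assms by (auto simp: w_def fun_eq_iff s_def V_def d_def sg_def)
    then show ?thesis by simp
  qed
  moreover have "T w * (B i l * B k j) = T ?v * (B i l * B k j)"
  proof (cases "fm j")
    case True
    then show ?thesis using assms
      by (intro T_BB_right(2)) (auto simp: w_def s_def V_def d_def)
  next
    case False
    then have "w = ?v" using assms by (auto simp: w_def fun_eq_iff s_def V_def d_def sg_def)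
    then show ?thesis by simp
  qed
  ultimately have "T ?u * (B i l * B k j) = T (V j l) * (E i l * E k j)"
    unfolding R by simp
  then show ?thesis
    using assms E_bracket_disjoint[of i j k l] unfolding a 1
    by (simp add: lam_left[of "T (V j l)", symmetric] lam_left[of "of_int (sg j)"]) (simp add: lam_def sg_def left_diff_distrib right_diff_distrib qz_left')
qed

text \<open>With \<open>c\<close> = [N_i] and \<open>b\<close> = [N_j] the two products are c times
  y_j x_j and y_i x_i times b. Expanding both by \<open>q_comm_pos\<close> cancels the terms in c b.
  What remains is linear in c or b, and multiplication by \<open>lam\<close> leaves four torus
  terms, two of which cancel.\<close>

lemma lam_E_opposite:
  assumes "i < j" "j \<le> M"
  shows "lam * (E i j * E j i - sgn2 i j j i * (E j i * E i j))
    = T (\<lambda>m. d i m - sg i * sg j * d j m) - T (\<lambda>m. sg i * sg j * d j m - d i m)"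
proof -
  have a: "s j i j - s j i i = 0" "s i j i - s i j j = 0" "(\<lambda>m. s i j m + s j i m) = (\<lambda>m. 0)"
    using assms by (simp_all add: s_def)
  have E: "E i j * E j i = B i j * B j i" "E j i * E i j = B j i * B i j"
    using assms E_E[of i j j i] E_E'[of j i i j] unfolding a by (simp_all add: qz_0 T_0)
  have j: "j \<in> {1..M}" "j \<noteq> 0" using assms by auto
  have f: "fm i \<Longrightarrow> fm j" using assms fm_mono[of i j] by auto
  define b where "b = x j * y j"
  define c where "c = (if i = 0 then P else x i * y i)"
  have lam_b: "lam * b = T (\<lambda>m. d j m) - T (\<lambda>m. - d j m)"
    unfolding b_def by (rule lam_rules(2)[OF j(1)])
  have lam_c: "lam * c = T (\<lambda>m. d i m) - T (\<lambda>m. - d i m)"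
    unfolding c_def using assms lam_rules(2)[of i] lam_rules(4) by auto
  have 1: "B i j * B j i = c * (if fm j then T (\<lambda>m. d j m) - qz 1 * b else T (\<lambda>m. - d j m) + qz 1 * b)"
  proof (cases "i = 0")
    case True
    then show ?thesis using j by (simp add: B_def c_def b_def mult.assoc q_comm_pos)
  next
    case False
    then have i: "i \<in> {1..M}" and ij: "i \<noteq> j" using assms by auto
    have "B i j * B j i = x i * (y j * (x j * y i))"
      using False j by (simp add: B_def mult.assoc)
    also have "\<dots> = x i * (y i * (y j * x j))"
      using ij by (simp add: yx[OF i j(1)] yx'[OF i j(1)] yy'[OF i j(1)])
    finally show ?thesis using False q_comm_pos[OF j(1)] by (simp add: c_def b_def mult.assoc)
  qed
  have 2: "B j i * B i j = (if fm i then T (\<lambda>m. d i m) - qz 1 * c else T (\<lambda>m. - d i m) + qz 1 * c) * b"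
  proof (cases "i = 0")
    case True
    then show ?thesis using j fm_0
      by (simp add: B_def c_def b_def x_P(1)[OF j(1)] distrib_right mult.assoc flip: mult.assoc[of "x j" P])
  next
    case False
    then have i: "i \<in> {1..M}" and ij: "i \<noteq> j" using assms by auto
    have "B j i * B i j = x j * (y i * (x i * y j))"
      using False j by (simp add: B_def mult.assoc)
    also have "\<dots> = y i * (x i * (x j * y j))"
      using ij by (simp add: yx'[OF i j(1)] xx'[OF i j(1)])
    finally show ?thesis
      using False q_comm_pos[OF i] by (simp add: c_def b_def flip: mult.assoc)
  qed
  have 3: "E i j * E j i - sgn2 i j j i * (E j i * E i j)
    = c * T (\<lambda>m. - sg j * d j m) - sgn2 i j j i * (T (\<lambda>m. - sg i * d i m) * b)"
    unfolding E 1 2 using f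
    by (cases "fm i"; cases "fm j")
       (auto simp: sgn2_def sg_def distrib_left distrib_right left_diff_distrib right_diff_distrib qz_left mult.assoc)
  have 4: "lam * (c * T u) = T (\<lambda>m. d i m + u m) - T (\<lambda>m. - d i m + u m)" for u
    unfolding mult.assoc[symmetric] lam_c left_diff_distrib T_add ..
  have 5: "lam * (T u * b) = T (\<lambda>m. u m + d j m) - T (\<lambda>m. u m - d j m)" for u
    unfolding lam_left[of "T u"] lam_b right_diff_distrib T_add by simp
  have "lam * (E i j * E j i - sgn2 i j j i * (E j i * E i j))
    = lam * (c * T (\<lambda>m. - sg j * d j m)) - sgn2 i j j i * (lam * (T (\<lambda>m. - sg i * d i m) * b))"
    unfolding 3 right_diff_distrib[of lam] by (simp add: sgn2_central)
  moreover have "(\<lambda>m. - d i m - d j m) = (\<lambda>m. - d j m - d i m)" by auto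
  ultimately show ?thesis
    unfolding 4 5 using f by (cases "fm i"; cases "fm j") (auto simp: sgn2_def sg_def)
qed

theorem E_mixed:
  assumes "i < j" "l < k" "j \<le> M" "k \<le> M" "i \<noteq> l \<or> j \<noteq> k"
  shows "E i j * E k l - sgn2 i j k l * (E k l * E i j) =
    (lam * (of_bool (j > k \<and> k > i \<and> i > l) * (of_int (sg k) * (E k j * E i l)))
      - of_bool (i = l) * (of_bool (j > k) * (sgn1 k l * E k j))
      + of_bool (j = k) * (of_bool (i > l) * E i l)) * T (V i k)
    + T (V j l) * (- (lam * (of_bool (k > j \<and> j > l \<and> l > i) * (of_int (sg j) * (E i l * E k j))))
      - of_bool (i = l) * (of_bool (k > j) * (sgn1 i j * E k j))
      + of_bool (j = k) * (of_bool (l > i) * E i l))"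
proof -
  consider "i = l" "k < j" | "i = l" "j < k" | "j = k" "l < i" | "j = k" "i < l"
    | "l < i" "i < k" "k < j" | "i < l" "l < j" "j < k"
    | "i \<noteq> l" "j \<noteq> k" "\<not> (l < i \<and> i < k \<and> k < j)" "\<not> (i < l \<and> l < j \<and> j < k)"
    using assms(5) by linarith
  then show ?thesis
  proof cases
    case 1 then show ?thesis using assms mixed_left_lt[of i k j] by (simp add: mult.assoc)
  next
    case 2 then show ?thesis using assms mixed_left_gt[of i j k] by (simp add: sgn1_def)
  next
    case 3 then show ?thesis using assms mixed_right_lt[of l i j] by simp
  next
    case 4 then show ?thesis using assms mixed_right_gt[of i l j] by simp
  next
    case 5 then show ?thesis using assms mixed_cross_lt[of l i k j] by (simp add: mult.assoc)
  next
    case 6 then show ?thesis using assms mixed_cross_gt[of i l j k] by simp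
  next
    case 7
    \<comment> \<open>In the remaining positions the scalars of the two orders coincide: a common
      index \<open>i = k\<close> or \<open>j = l\<close> makes the intervals adjacent, and otherwise
      they are separated or nested.\<close>
    have "E i j * E k l - sgn2 i j k l * (E k l * E i j) = 0"
    proof (cases "i = k \<or> j = l")
      case False
      then show ?thesis using assms 7 E_bracket_disjoint[of i j k l]
        by (auto simp: s_def qz_0)
    next
      case True
      then consider "i = k" | "j = l" "i \<noteq> k" by blast
      then show ?thesis
      proof cases
        case 1
        have "s i l j - s i l i = 0" "s i j l - s i j i = 0"
          using assms 1 by (simp_all add: s_def)
        then have "E i j * E i l = T (\<lambda>m. s i j m + s i l m) * (B i j * B i l)"
          "E i l * E i j = T (\<lambda>m. s i j m + s i l m) * (B i l * B i j)"
          using assms 1 E_E[of i j i l] E_E'[of i l i j] by (simp_all add: qz_0)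
        moreover have "B i j * B i l = sgn2 i j i l * (B i l * B i j)"
        proof (cases "fm i")
          case True
          then show ?thesis using assms 1 B_same_left[of i j l] B_same_left[of i l j] by simp
        next
          case False
          then show ?thesis using assms 1 B_same_left[of i j l] by (simp add: sgn2_def)
        qed
        ultimately show ?thesis using 1 by (simp add: sgn2_central)
      next
        case 2
        have "s k j j - s k j i = 0" "s i j j - s i j k = 0"
          using assms 2 by (simp_all add: s_def)
        then have "E i j * E k j = T (\<lambda>m. s i j m + s k j m) * (B i j * B k j)"
          "E k j * E i j = T (\<lambda>m. s i j m + s k j m) * (B k j * B i j)"
          using assms 2 E_E[of i j k j] E_E'[of k j i j] by (simp_all add: qz_0)
        moreover have "B i j * B k j = sgn2 i j k j * (B k j * B i j)"
        proof (cases "fm j")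
          case True
          then show ?thesis using assms 2 B_same_right[of i j k] B_same_right[of k j i] by simp
        next
          case False
          then show ?thesis using assms 2 B_same_right[of i j k] by (simp add: sgn2_def)
        qed
        ultimately show ?thesis using 2 by (simp add: sgn2_central)
      qed
    qed
    then show ?thesis using assms 7 by auto
  qed
qed

end

section \<open>Evaluation of completed free algebras\<close>

lemma poly_mapping_add_induct:
  assumes "P 0" "\<And>w c. P (Poly_Mapping.single w c)" "\<And>a b. P a \<Longrightarrow> P b \<Longrightarrow> P (a + b)"
  shows "P (a :: 'k \<Rightarrow>\<^sub>0 'c::comm_monoid_add)"
proof (induction a rule: update_induct)
  case const
  then show ?case by (rule assms(1))
next
  case (update f k v)
  have "Poly_Mapping.update k v f = f + Poly_Mapping.single k v"
    using update.hyps
    by (intro poly_mapping_eqI)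
       (auto simp: lookup_update lookup_add lookup_single in_keys_iff when_def)
  then show ?case using update assms by simp
qed

text \<open>A central image of the complex numbers is what makes evaluation at noncommuting images
  multiplicative. It is used for values in a free algebra and in series over one.\<close>

locale scalars =
  fixes \<kappa> :: "complex \<Rightarrow> 'b::ring_1"
  assumes add: "\<kappa> (c + d) = \<kappa> c + \<kappa> d" and mult: "\<kappa> (c * d) = \<kappa> c * \<kappa> d" and one: "\<kappa> 1 = 1"
    and comm: "\<kappa> c * z = z * \<kappa> c"
begin

lemma zero: "\<kappa> 0 = 0" using add[of 0 0] by simp

definition eval :: "('x \<Rightarrow> 'b) \<Rightarrow> 'x free_alg \<Rightarrow> 'b" where
  "eval g a = (\<Sum>w\<in>Poly_Mapping.keys a. \<kappa> (Poly_Mapping.lookup a w) * prod_list (map g w))"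

lemma eval_superset:
  assumes "finite S" "Poly_Mapping.keys a \<subseteq> S"
  shows "eval g a = (\<Sum>w\<in>S. \<kappa> (Poly_Mapping.lookup a w) * prod_list (map g w))"
  unfolding eval_def using assms
  by (intro sum.mono_neutral_left) (auto simp: zero in_keys_iff)

lemma eval_add: "eval g (a + b) = eval g a + eval g b"
proof -
  let ?S = "Poly_Mapping.keys a \<union> Poly_Mapping.keys b"
  have "finite ?S" by simp
  note e = eval_superset[OF this]
  have "Poly_Mapping.keys (a + b) \<subseteq> ?S" by (rule keys_add)
  then show ?thesis
    by (simp add: e lookup_add add distrib_right sum.distrib)
qed

lemma eval_single: "eval g (Poly_Mapping.single w c) = \<kappa> c * prod_list (map g w)"
  by (subst eval_superset[of "{w}"]) auto

lemma eval_zero: "eval g 0 = 0" by (simp add: eval_def)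

lemma eval_mult: "eval g (a * b) = eval g a * eval g b"
proof (induction a rule: poly_mapping_add_induct)
  case (2 v c)
  show ?case
  proof (induction b rule: poly_mapping_add_induct)
    case (2 w d)
    have "prod_list (map g v) * (\<kappa> d * prod_list (map g w))
      = \<kappa> d * (prod_list (map g v) * prod_list (map g w))"
      by (metis comm mult.assoc)
    then show ?case
      by (simp add: mult_single eval_single plus_list_def mult mult.assoc)
  qed (simp_all add: eval_zero eval_add distrib_left)
qed (simp_all add: eval_zero eval_add distrib_right)

lemma eval_const: "eval g (const c) = \<kappa> c"
  by (simp add: const_def eval_single)

lemma eval_one: "eval g 1 = 1"
  using eval_const[of g 1] by (simp add: const_def one flip: zero_list_def)

lemma eval_letter: "eval g (letter x) = g x"
  by (simp add: letter_def eval_single one)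

end

locale unital_hom =
  fixes \<pi> :: "'a::ring_1 \<Rightarrow> 'b::ring_1"
  assumes hom_add: "\<pi> (a + b) = \<pi> a + \<pi> b" and hom_mult: "\<pi> (a * b) = \<pi> a * \<pi> b" and hom_one: "\<pi> 1 = 1"
begin

lemma hom_zero: "\<pi> 0 = 0" using hom_add[of 0 0] by simp

lemma hom_uminus: "\<pi> (- a) = - \<pi> a"
  using hom_add[of a "- a"] by (simp add: hom_zero eq_neg_iff_add_eq_0 add.commute)

lemma hom_diff: "\<pi> (a - b) = \<pi> a - \<pi> b"
  using hom_add[of a "- b"] by (simp add: hom_uminus)

lemma hom_sum: "\<pi> (sum f A) = (\<Sum>i\<in>A. \<pi> (f i))"
  by (induction A rule: infinite_finite_induct) (auto simp: hom_zero hom_add)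

lemma hom_power: "\<pi> (a ^ k) = \<pi> a ^ k"
  by (induction k) (auto simp: hom_one hom_mult)

lemma hom_of_nat: "\<pi> (of_nat k) = of_nat k"
  by (induction k) (auto simp: hom_zero hom_one hom_add)

lemma hom_of_int: "\<pi> (of_int z) = of_int z"
  by (cases z rule: int_cases2) (auto simp: hom_of_nat hom_uminus)

lemma hom_of_bool: "\<pi> (of_bool b) = of_bool b"
  by (cases b) (auto simp: hom_zero hom_one)

definition cmap :: "'a fps \<Rightarrow> 'b fps" where "cmap f = Abs_fps (\<lambda>k. \<pi> (fps_nth f k))"

lemma cmap_nth [simp]: "fps_nth (cmap f) k = \<pi> (fps_nth f k)"
  by (simp add: cmap_def)

lemma unital_hom_cmap: "unital_hom cmap"
proof
  show "cmap (f + g) = cmap f + cmap g" for f g by (rule fps_ext) (simp add: hom_add)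
  show "cmap (f * g) = cmap f * cmap g" for f g
    by (rule fps_ext) (simp add: fps_mult_nth hom_sum hom_mult)
  show "cmap 1 = 1" by (rule fps_ext) (simp add: hom_one hom_zero)
qed

end

text \<open>The images of the generators are themselves series in h, so a map on coefficients alone
  does not suffice for the extension.\<close>

locale fps_valued_hom = unital_hom \<phi> for \<phi> :: "'a::ring_1 \<Rightarrow> 'b::ring_1 fps"
begin

text \<open>The \<open>h\<close>-linear continuous extension \<open>\<Sum>\<^sub>i h\<^sup>i a\<^sub>i \<mapsto> \<Sum>\<^sub>i h\<^sup>i \<phi>(a\<^sub>i)\<close>.\<close>

definition ext :: "'a fps \<Rightarrow> 'b fps" where
  "ext f = Abs_fps (\<lambda>k. \<Sum>i=0..k. fps_nth (\<phi> (fps_nth f i)) (k - i))"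

lemma ext_nth: "fps_nth (ext f) k = (\<Sum>i=0..k. fps_nth (\<phi> (fps_nth f i)) (k - i))"
  by (simp add: ext_def)

text \<open>This is h-adic continuity; it makes preimages of closed ideals closed.\<close>

lemma ext_cong: "(\<And>k. k < N \<Longrightarrow> fps_nth f k = fps_nth g k) \<Longrightarrow> k < N \<Longrightarrow> fps_nth (ext f) k = fps_nth (ext g) k"
  by (auto simp: ext_nth intro!: sum.cong)

lemma ext_const: "ext (fps_const a) = \<phi> a"
proof (rule fps_ext)
  fix k
  have "fps_nth (ext (fps_const a)) k = (\<Sum>i=0..k. if i = 0 then fps_nth (\<phi> a) k else 0)"
    unfolding ext_nth by (rule sum.cong) (auto simp: hom_zero)
  then show "fps_nth (ext (fps_const a)) k = fps_nth (\<phi> a) k" by simp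
qed

lemma ext_mult: "ext (f * g) = ext f * ext g"
proof (rule fps_ext)
  fix k
  let ?u = "\<lambda>i c. fps_nth (\<phi> (fps_nth f i)) c" and ?v = "\<lambda>i c. fps_nth (\<phi> (fps_nth g i)) c"
  have s: "fps_nth (\<Sum>i\<in>A. F i) n = (\<Sum>i\<in>A. fps_nth (F i) n)" for A :: "nat set" and F :: "nat \<Rightarrow> 'b fps" and n
    by (rule fps_sum_nth)
  have "fps_nth (ext f * ext g) k = (\<Sum>a=0..k. \<Sum>i=0..a. \<Sum>j=0..k-a. ?u i (a - i) * ?v j (k - a - j))"
    by (simp add: fps_mult_nth ext_nth sum_product)
  also have "\<dots> = (\<Sum>(a, i, j)\<in>(SIGMA a:{0..k}. {0..a} \<times> {0..k-a}). ?u i (a - i) * ?v j (k - a - j))"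
    by (simp add: sum.Sigma sum.cartesian_product)
  \<comment> \<open>Here \<open>n\<close> is the total h-degree of the two source coefficients and
    \<open>c\<close> the degree taken from the first image.\<close>
  also have "\<dots> = (\<Sum>(n, i, c)\<in>(SIGMA n:{0..k}. {0..n} \<times> {0..k-n}). ?u i c * ?v (n - i) (k - n - c))"
    by (rule sum.reindex_bij_witness[of _ "\<lambda>(n, i, c). (i + c, i, n - i)" "\<lambda>(a, i, j). (i + j, i, a - i)"])
       (auto simp: algebra_simps)
  also have "\<dots> = (\<Sum>n=0..k. \<Sum>i=0..n. \<Sum>c=0..k-n. ?u i c * ?v (n - i) (k - n - c))"
    by (simp add: sum.Sigma sum.cartesian_product)
  also have "\<dots> = fps_nth (ext (f * g)) k"
    by (simp add: ext_nth fps_mult_nth hom_sum hom_mult s)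
  finally show "fps_nth (ext (f * g)) k = fps_nth (ext f * ext g) k" ..
qed

lemma unital_hom_ext: "unital_hom ext"
proof
  show "ext (f + g) = ext f + ext g" for f g
    by (rule fps_ext) (simp add: ext_nth hom_add sum.distrib)
  show "ext 1 = 1" using ext_const[of 1] by (simp add: hom_one)
qed (rule ext_mult)

end

text \<open>The basic neighbourhoods of a series are given by fixing its first \<open>N\<close>
  coefficients.\<close>

lemma closed_fps_iff:
  "closed (I :: 'a::group_add fps set) \<longleftrightarrow>
    (\<forall>f. (\<forall>N. \<exists>g\<in>I. \<forall>k<N. fps_nth f k = fps_nth g k) \<longrightarrow> f \<in> I)"
proof -
  have c: "fps_cutoff N g = fps_cutoff N f \<longleftrightarrow> (\<forall>k<N. fps_nth f k = fps_nth g k)" for N and f g :: "'a fps"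
    by (auto simp: fps_eq_iff)
  show ?thesis
    unfolding closed_def open_fps_iff c by (auto simp: subset_iff) (meson | blast)+
qed

section \<open>Homomorphisms between presented algebras\<close>

abbreviation fr :: "'x set \<Rightarrow> 'x free_alg fps set" where "fr X \<equiv> carrier (free_ring X)"

lemma fr_iff: "f \<in> fr X \<longleftrightarrow> (\<forall>k. Poly_Mapping.keys (fps_nth f k) \<subseteq> lists X)"
  by (simp add: free_ring_def)

lemma keys_add_lists:
  "Poly_Mapping.keys a \<subseteq> lists X \<Longrightarrow> Poly_Mapping.keys b \<subseteq> lists X \<Longrightarrow> Poly_Mapping.keys (a + b) \<subseteq> lists X"
  using keys_add[of a b] by blast

lemma keys_const_lists: "Poly_Mapping.keys (const c) \<subseteq> lists X"
  by (simp add: const_def)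

lemma keys_letter_lists: "x \<in> X \<Longrightarrow> Poly_Mapping.keys (letter x) \<subseteq> lists X"
  by (simp add: letter_def)

lemma keys_one_lists: "Poly_Mapping.keys (1 :: 'x free_alg) \<subseteq> lists X"
  by (simp add: zero_list_def)

lemma keys_power_lists: "Poly_Mapping.keys a \<subseteq> lists X \<Longrightarrow> Poly_Mapping.keys (a ^ k :: 'x free_alg) \<subseteq> lists X"
  by (induction k) (auto simp: keys_mult_lists zero_list_def)

lemma keys_diff_lists:
  "Poly_Mapping.keys a \<subseteq> lists X \<Longrightarrow> Poly_Mapping.keys b \<subseteq> lists X \<Longrightarrow>
    Poly_Mapping.keys (a - b :: 'x free_alg) \<subseteq> lists X"
  using keys_diff[of a b] by blast

lemma keys_sum_lists:
  "(\<And>i. i \<in> A \<Longrightarrow> Poly_Mapping.keys (f i) \<subseteq> lists X) \<Longrightarrow> Poly_Mapping.keys (sum f A :: 'x free_alg) \<subseteq> lists X"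
  by (induction A rule: infinite_finite_induct) (simp_all add: keys_add_lists)

lemma fr_zero: "0 \<in> fr X" and fr_one: "1 \<in> fr X"
  using ring.ring_simprules(2,6)[OF ring_free_ring[of X]] by (simp_all add: free_ring_def)

lemma fr_add: "f \<in> fr X \<Longrightarrow> g \<in> fr X \<Longrightarrow> f + g \<in> fr X"
  using ring.ring_simprules(1)[OF ring_free_ring[of X]] by (simp add: free_ring_def)

lemma fr_mult: "f \<in> fr X \<Longrightarrow> g \<in> fr X \<Longrightarrow> f * g \<in> fr X"
  using ring.ring_simprules(5)[OF ring_free_ring[of X]] by (simp add: free_ring_def)

lemma fr_uminus: "f \<in> fr X \<Longrightarrow> - f \<in> fr X"
  by (simp add: fr_iff)

lemma fr_diff: "f \<in> fr X \<Longrightarrow> g \<in> fr X \<Longrightarrow> f - g \<in> fr X"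
  using fr_add[OF _ fr_uminus] by fastforce

lemma fr_power: "f \<in> fr X \<Longrightarrow> f ^ k \<in> fr X"
  by (induction k) (auto simp: fr_one fr_mult)

lemma fr_of_bool: "of_bool b \<in> fr X"
  by (cases b) (auto simp: fr_one fr_zero)

lemma fr_of_nat: "of_nat k \<in> fr X"
  by (induction k) (auto simp: fr_one fr_zero fr_add)

lemma fr_of_int: "of_int z \<in> fr X"
  by (cases z rule: int_cases2) (auto simp: fr_of_nat fr_uminus)

lemma fr_scal: "scal s \<in> fr X"
  by (simp add: fr_iff scal_def keys_const_lists)

lemma fr_const: "Poly_Mapping.keys a \<subseteq> lists X \<Longrightarrow> fps_const a \<in> fr X"
  by (simp add: fr_iff)

lemma fr_gen: "x \<in> X \<Longrightarrow> gen x \<in> fr X"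
  unfolding gen_def by (intro fr_const keys_letter_lists)

lemma fr_qpow: "Poly_Mapping.keys a \<subseteq> lists X \<Longrightarrow> qpow a \<in> fr X"
  by (simp add: fr_iff qpow_def keys_mult_lists keys_const_lists keys_power_lists)

lemma fr_over_qdiff: "z \<in> fr X \<Longrightarrow> over_qdiff z \<in> fr X"
  unfolding over_qdiff_def by (intro fr_mult fr_scal) (simp add: fr_iff)

lemma fr_qnum: "Poly_Mapping.keys a \<subseteq> lists X \<Longrightarrow> qnum a \<in> fr X"
  unfolding qnum_def by (intro fr_over_qdiff fr_diff fr_qpow) simp_all

lemma fr_qnum_ratio: "Poly_Mapping.keys a \<subseteq> lists X \<Longrightarrow> qnum_ratio a \<in> fr X"
  unfolding qnum_ratio_def
  by (intro fr_over_qdiff) (simp add: fr_iff keys_mult_lists keys_const_lists keys_power_lists)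

lemmas fr_closed = fr_zero fr_one fr_add fr_mult fr_uminus fr_diff fr_power fr_of_bool fr_of_nat
  fr_of_int fr_scal fr_gen fr_over_qdiff

lemma free_ring_ops [simp]:
  "f \<otimes>\<^bsub>free_ring X\<^esub> g = f * g" "f \<oplus>\<^bsub>free_ring X\<^esub> g = f + g"
  "\<one>\<^bsub>free_ring X\<^esub> = 1" "\<zero>\<^bsub>free_ring X\<^esub> = 0"
  by (simp_all add: free_ring_def)

lemma free_ring_uminus: "f \<in> fr X \<Longrightarrow> \<ominus>\<^bsub>free_ring X\<^esub> f = - f"
proof -
  interpret ring "free_ring X" by (rule ring_free_ring)
  assume "f \<in> fr X"
  then show ?thesis by (intro minus_equality) (auto intro: fr_uminus)
qed

lemma ideal_free_ringI:
  assumes "I \<subseteq> fr X" "0 \<in> I" "\<And>a b. a \<in> I \<Longrightarrow> b \<in> I \<Longrightarrow> a + b \<in> I"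
    and "\<And>a x. a \<in> I \<Longrightarrow> x \<in> fr X \<Longrightarrow> x * a \<in> I" "\<And>a x. a \<in> I \<Longrightarrow> x \<in> fr X \<Longrightarrow> a * x \<in> I"
  shows "ideal I (free_ring X)"
proof (rule idealI)
  interpret ring "free_ring X" by (rule ring_free_ring)
  show "subgroup I (add_monoid (free_ring X))"
  proof (rule add.subgroupI)
    fix a assume a: "a \<in> I"
    have "(- 1) * a \<in> I" using a by (intro assms fr_uminus fr_one)
    then show "\<ominus>\<^bsub>free_ring X\<^esub> a \<in> I"
      using a assms(1) free_ring_uminus[of a X] by auto
  qed (use assms in auto)
qed (use assms ring_free_ring in auto)

locale presentation =
  fixes X :: "'x set" and R :: "'x free_alg fps \<Rightarrow> 'x free_alg fps \<Rightarrow> bool"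
  assumes rel_carrier: "R l r \<Longrightarrow> l \<in> fr X" "R l r \<Longrightarrow> r \<in> fr X"
begin

sublocale ring "free_ring X" by (rule ring_free_ring)

abbreviation I where "I \<equiv> rel_idl X R"

lemma rel_subset: "{l - r | l r. R l r} \<subseteq> fr X"
  using rel_carrier by (auto intro!: fr_diff)

lemma closed_fr: "closed (fr X)"
  unfolding closed_fps_iff
proof (intro allI impI)
  fix f :: "'x free_alg fps"
  assume *: "\<forall>N. \<exists>g\<in>fr X. \<forall>k<N. fps_nth f k = fps_nth g k"
  have "Poly_Mapping.keys (fps_nth f k) \<subseteq> lists X" for k
  proof -
    obtain g where "g \<in> fr X" "\<forall>j<Suc k. fps_nth f j = fps_nth g j" using * by blast
    then show ?thesis unfolding fr_iff by (metis lessI)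
  qed
  then show "f \<in> fr X" by (simp add: fr_iff)
qed

lemma ideal_fr: "ideal (fr X) (free_ring X)"
  by (rule ideal_free_ringI) (auto simp: fr_closed)

lemma ideal_I: "ideal I (free_ring X)"
proof -
  let ?F = "{J. ideal J (free_ring X) \<and> closed J \<and> {l - r | l r. R l r} \<subseteq> J}"
  \<comment> \<open>An empty family would have the whole type as its intersection; the carrier
    itself is a member.\<close>
  have "?F \<noteq> {}" using ideal_fr closed_fr rel_subset by blast
  then show ?thesis
    unfolding rel_idl_def closed_idl_def by (intro i_Intersect) auto
qed

sublocale idl: ideal I "free_ring X" by (rule ideal_I)

lemma closed_I: "closed I"
  unfolding rel_idl_def closed_idl_def by (intro closed_Inter) auto

lemma rel_in_I: "R l r \<Longrightarrow> l - r \<in> I"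
  unfolding rel_idl_def closed_idl_def by blast

lemma I_least:
  "ideal J (free_ring X) \<Longrightarrow> closed J \<Longrightarrow> (\<And>l r. R l r \<Longrightarrow> l - r \<in> J) \<Longrightarrow> I \<subseteq> J"
  unfolding rel_idl_def closed_idl_def by blast

lemma I_zero: "0 \<in> I" using idl.zero_closed by simp
lemma I_add: "a \<in> I \<Longrightarrow> b \<in> I \<Longrightarrow> a + b \<in> I" using idl.a_closed by simp
lemma I_left: "a \<in> I \<Longrightarrow> x \<in> fr X \<Longrightarrow> x * a \<in> I" using idl.I_l_closed by simp
lemma I_right: "a \<in> I \<Longrightarrow> x \<in> fr X \<Longrightarrow> a * x \<in> I" using idl.I_r_closed by simp

lemma I_limit: "(\<And>N. \<exists>g\<in>I. \<forall>k<N. fps_nth f k = fps_nth g k) \<Longrightarrow> f \<in> I"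
  using closed_I unfolding closed_fps_iff by blast

lemma cls_eq_iff: "f \<in> fr X \<Longrightarrow> g \<in> fr X \<Longrightarrow> cls X R f = cls X R g \<longleftrightarrow> f - g \<in> I"
  using quotient_eq_iff_same_a_r_cos[OF ideal_I, of f g]
  by (simp add: cls_def a_minus_def free_ring_uminus)

lemma carrier_presented: "carrier (presented X R) = cls X R ` fr X"
  by (auto simp: presented_def FactRing_def A_RCOSETS_def' cls_def)

lemma presented_ops:
  assumes "f \<in> fr X" "g \<in> fr X"
  shows "cls X R f \<otimes>\<^bsub>presented X R\<^esub> cls X R g = cls X R (f * g)"
    and "cls X R f \<oplus>\<^bsub>presented X R\<^esub> cls X R g = cls X R (f + g)"
  using idl.rcoset_mult_add[OF assms] idl.a_rcos_sum[OF assms]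
  by (simp_all add: presented_def FactRing_def cls_def)

lemma presented_one: "\<one>\<^bsub>presented X R\<^esub> = cls X R 1"
  by (simp add: presented_def FactRing_def cls_def)

end

text \<open>The preimage \<open>J\<close> of the target ideal is an ideal containing the relations,
  and it is closed because \<open>\<phi>\<close> respects truncation. It therefore contains the
  source ideal, and the map descends to classes.\<close>

lemma presented_hom_exists:
  assumes "presentation X R" "presentation Y S"
    and \<phi>: "unital_hom \<phi>" and carr: "\<And>f. f \<in> fr X \<Longrightarrow> \<phi> f \<in> fr Y"
    and cong: "\<And>f g N k. (\<And>k. k < N \<Longrightarrow> fps_nth f k = fps_nth g k) \<Longrightarrow> k < N \<Longrightarrow> fps_nth (\<phi> f) k = fps_nth (\<phi> g) k"
    and scal: "\<And>s. \<phi> (scal s) = scal s"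
    and rel: "\<And>l r. R l r \<Longrightarrow> \<phi> l - \<phi> r \<in> rel_idl Y S"
  shows "\<exists>\<rho>\<in>extensional (carrier (presented X R)). presented_hom X R Y S \<rho> \<and>
    (\<forall>f\<in>fr X. \<rho> (cls X R f) = cls Y S (\<phi> f))"
proof -
  interpret X: presentation X R by fact
  interpret Y: presentation Y S by fact
  interpret \<phi>: unital_hom \<phi> by fact
  define J where "J = {f \<in> fr X. \<phi> f \<in> Y.I}"
  have "X.I \<subseteq> J"
  proof (rule X.I_least)
    show "ideal J (free_ring X)"
      by (rule ideal_free_ringI)
         (auto simp: J_def fr_closed \<phi>.hom_zero \<phi>.hom_add \<phi>.hom_mult Y.I_zero intro: Y.I_add Y.I_left Y.I_right carr)
    show "closed J"
      unfolding closed_fps_iff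
    proof (intro allI impI)
      fix f assume *: "\<forall>N. \<exists>g\<in>J. \<forall>k<N. fps_nth f k = fps_nth g k"
      have "f \<in> fr X" using X.closed_fr * unfolding closed_fps_iff J_def by blast
      moreover have "\<phi> f \<in> Y.I"
      proof (rule Y.I_limit)
        fix N
        obtain g where "g \<in> J" "\<forall>k<N. fps_nth f k = fps_nth g k" using * by blast
        then show "\<exists>g\<in>Y.I. \<forall>k<N. fps_nth (\<phi> f) k = fps_nth g k"
          using cong[of N f g] unfolding J_def by blast
      qed
      ultimately show "f \<in> J" by (simp add: J_def)
    qed
    show "l - r \<in> J" if "R l r" for l r
      using rel[OF that] X.rel_carrier[OF that] by (simp add: J_def fr_diff \<phi>.hom_diff)
  qed
  then have wd: "cls Y S (\<phi> f) = cls Y S (\<phi> g)" if "cls X R f = cls X R g" "f \<in> fr X" "g \<in> fr X" for f g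
    using that by (auto simp: X.cls_eq_iff Y.cls_eq_iff carr J_def \<phi>.hom_diff)
  define \<rho> where "\<rho> = (\<lambda>C\<in>carrier (presented X R). cls Y S (\<phi> (SOME f. f \<in> fr X \<and> cls X R f = C)))"
  have \<rho>: "\<rho> (cls X R f) = cls Y S (\<phi> f)" if "f \<in> fr X" for f
  proof -
    let ?g = "SOME g. g \<in> fr X \<and> cls X R g = cls X R f"
    have "?g \<in> fr X \<and> cls X R ?g = cls X R f"
      by (rule someI[of _ f]) (use that in simp)
    then show ?thesis
      using that wd[of ?g f] by (simp add: \<rho>_def X.carrier_presented)
  qed
  have "presented_hom X R Y S \<rho>"
    unfolding presented_hom_def
  proof (intro conjI allI ring_hom_memI)
    show "\<rho> (cls X R (scal s)) = cls Y S (scal s)" for s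
      by (simp add: \<rho> fr_scal scal)
    show "\<rho> \<one>\<^bsub>presented X R\<^esub> = \<one>\<^bsub>presented Y S\<^esub>"
      by (simp add: X.presented_one Y.presented_one \<rho> fr_one \<phi>.hom_one)
    show "\<rho> C \<in> carrier (presented Y S)" if "C \<in> carrier (presented X R)" for C
      using that carr unfolding X.carrier_presented Y.carrier_presented by (auto simp: \<rho>)
    show "\<rho> (C \<otimes>\<^bsub>presented X R\<^esub> D) = \<rho> C \<otimes>\<^bsub>presented Y S\<^esub> \<rho> D"
      if "C \<in> carrier (presented X R)" "D \<in> carrier (presented X R)" for C D
      using that unfolding X.carrier_presented
      by (auto simp: \<rho> X.presented_ops Y.presented_ops carr fr_mult \<phi>.hom_mult)
    show "\<rho> (C \<oplus>\<^bsub>presented X R\<^esub> D) = \<rho> C \<oplus>\<^bsub>presented Y S\<^esub> \<rho> D"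
      if "C \<in> carrier (presented X R)" "D \<in> carrier (presented X R)" for C D
      using that unfolding X.carrier_presented
      by (auto simp: \<rho> X.presented_ops Y.presented_ops carr fr_add \<phi>.hom_add)
  qed
  moreover have "\<rho> \<in> extensional (carrier (presented X R))"
    by (simp add: \<rho>_def)
  ultimately show ?thesis using \<rho> by blast
qed

lemma scal_fps_const: "scal (fps_const c) = fps_const (const c)"
  by (rule fps_ext) (simp add: scal_def const_def)

lemma scal_fps_X_power: "scal (fps_X ^ N) = fps_X ^ N"
  by (rule fps_ext) (simp add: scal_def const_def fps_X_power_nth flip: zero_list_def)

lemma fps_const_sum: "fps_const (sum f A :: 'a::comm_monoid_add) = (\<Sum>i\<in>A. fps_const (f i))"
  by (rule fps_ext) (simp add: fps_sum_nth)

lemma sum_monomials: "(\<Sum>w\<in>Poly_Mapping.keys a. Poly_Mapping.single w (Poly_Mapping.lookup a w)) = a"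
  by (rule poly_mapping_eqI) (simp add: lookup_sum lookup_single when_def in_keys_iff)

section \<open>The subring on which two homomorphisms agree\<close>

locale two_presented_homs = X: presentation X R + Y: presentation Y S
  for X :: "'x set" and R and Y :: "'y set" and S +
  fixes \<rho> \<rho>' :: "'x free_alg fps set \<Rightarrow> 'y free_alg fps set"
  assumes hom: "presented_hom X R Y S \<rho>" and hom': "presented_hom X R Y S \<rho>'"
begin

definition agree :: "'x free_alg fps set" where
  "agree = {f \<in> fr X. \<rho> (cls X R f) = \<rho>' (cls X R f)}"

lemma hom_ops:
  assumes "presented_hom X R Y S \<sigma>" "f \<in> fr X" "g \<in> fr X"
  shows "\<sigma> (cls X R (f + g)) = \<sigma> (cls X R f) \<oplus>\<^bsub>presented Y S\<^esub> \<sigma> (cls X R g)"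
    and "\<sigma> (cls X R (f * g)) = \<sigma> (cls X R f) \<otimes>\<^bsub>presented Y S\<^esub> \<sigma> (cls X R g)"
  using assms ring_hom_add[of \<sigma> "presented X R" "presented Y S" "cls X R f" "cls X R g"]
    ring_hom_mult[of \<sigma> "presented X R" "presented Y S" "cls X R f" "cls X R g"]
  by (simp_all add: presented_hom_def X.presented_ops X.carrier_presented)

lemma hom_carrier:
  assumes "presented_hom X R Y S \<sigma>" "f \<in> fr X"
  obtains u where "u \<in> fr Y" "\<sigma> (cls X R f) = cls Y S u"
  using assms ring_hom_closed[of \<sigma> "presented X R" "presented Y S" "cls X R f"]
  unfolding presented_hom_def X.carrier_presented Y.carrier_presented by blast

lemma agree_carrier: "f \<in> agree \<Longrightarrow> f \<in> fr X"
  by (simp add: agree_def)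

lemma agree_add: "f \<in> agree \<Longrightarrow> g \<in> agree \<Longrightarrow> f + g \<in> agree"
  by (simp add: agree_def fr_add hom_ops[OF hom] hom_ops[OF hom'])

lemma agree_mult: "f \<in> agree \<Longrightarrow> g \<in> agree \<Longrightarrow> f * g \<in> agree"
  by (simp add: agree_def fr_mult hom_ops[OF hom] hom_ops[OF hom'])

lemma agree_scal: "scal s \<in> agree"
  using hom hom' by (simp add: agree_def fr_scal presented_hom_def)

lemma scal_minus_one: "scal (- 1) = - 1"
  by (rule fps_ext) (simp add: scal_def const_def single_uminus flip: single_one zero_list_def)

lemma agree_uminus: "f \<in> agree \<Longrightarrow> - f \<in> agree"
  using agree_mult[OF agree_scal[of "- 1"], of f] by (simp add: scal_minus_one)

lemma agree_diff: "f \<in> agree \<Longrightarrow> g \<in> agree \<Longrightarrow> f - g \<in> agree"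
  using agree_add[OF _ agree_uminus] by fastforce

lemma agree_rel:
  assumes "f \<in> fr X" "g \<in> agree" "f - g \<in> X.I"
  shows "f \<in> agree"
  using assms X.cls_eq_iff[of f g] by (simp add: agree_def)

lemma agree_zero: "0 \<in> agree" and agree_one: "1 \<in> agree"
proof -
  show 1: "1 \<in> agree" using agree_scal[of 1] by (simp add: scal_one)
  show "0 \<in> agree" using agree_diff[OF 1 1] by simp
qed

lemma agree_sum: "(\<And>i. i \<in> A \<Longrightarrow> f i \<in> agree) \<Longrightarrow> sum f A \<in> agree"
  by (induction A rule: infinite_finite_induct) (auto simp: agree_zero agree_add)

text \<open>Only linearity over the power series ring is assumed, not continuity. Writing f = g +
  h^N t, the two images of f differ modulo the target ideal by a multiple of h^N, for every N, and
  that ideal is closed.\<close>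

lemma agree_limit:
  assumes f: "f \<in> fr X" and approx: "\<And>N. \<exists>g\<in>agree. \<forall>k<N. fps_nth f k = fps_nth g k"
  shows "f \<in> agree"
proof -
  obtain u where u: "u \<in> fr Y" "\<rho> (cls X R f) = cls Y S u" by (rule hom_carrier[OF hom f])
  obtain v where v: "v \<in> fr Y" "\<rho>' (cls X R f) = cls Y S v" by (rule hom_carrier[OF hom' f])
  have "u - v \<in> Y.I"
  proof (rule Y.I_limit)
    fix N
    obtain g where g: "g \<in> agree" "\<forall>k<N. fps_nth f k = fps_nth g k" using approx by blast
    define t where "t = fps_shift N (f - g)"
    have t: "t \<in> fr X" using f agree_carrier[OF g(1)] by (simp add: t_def fr_iff keys_diff_lists)
    have fg: "f = g + fps_X ^ N * t"
      by (rule fps_ext) (use g(2) in \<open>simp add: fps_X_power_mult_nth t_def\<close>)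
    obtain w where w: "w \<in> fr Y" "\<rho> (cls X R t) = cls Y S w" by (rule hom_carrier[OF hom t])
    obtain z where z: "z \<in> fr Y" "\<rho>' (cls X R t) = cls Y S z" by (rule hom_carrier[OF hom' t])
    obtain c where c: "c \<in> fr Y" "\<rho> (cls X R g) = cls Y S c"
      by (rule hom_carrier[OF hom agree_carrier[OF g(1)]])
    then have c': "\<rho>' (cls X R g) = cls Y S c" using g(1) by (simp add: agree_def)
    have "\<sigma> (cls X R f) = \<sigma> (cls X R g) \<oplus>\<^bsub>presented Y S\<^esub> (cls Y S (scal (fps_X ^ N)) \<otimes>\<^bsub>presented Y S\<^esub> \<sigma> (cls X R t))"
      if "presented_hom X R Y S \<sigma>" for \<sigma>
    proof -
      have "\<sigma> (cls X R f) = \<sigma> (cls X R (g + scal (fps_X ^ N) * t))" using fg by (simp add: scal_fps_X_power)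
      then show ?thesis
        using that t agree_carrier[OF g(1)]
        by (simp add: hom_ops[OF that] fr_mult fr_scal) (simp add: presented_hom_def)
    qed
    from this[OF hom] this[OF hom']
    have "cls Y S u = cls Y S (c + scal (fps_X ^ N) * w)" "cls Y S v = cls Y S (c + scal (fps_X ^ N) * z)"
      using u v w z c c' by (simp_all add: Y.presented_ops fr_mult fr_scal)
    then have "u - (c + scal (fps_X ^ N) * w) \<in> Y.I" "v - (c + scal (fps_X ^ N) * z) \<in> Y.I"
      using u v w z c by (simp_all add: Y.cls_eq_iff fr_closed)
    then have "(u - (c + scal (fps_X ^ N) * w)) + (- 1) * (v - (c + scal (fps_X ^ N) * z)) \<in> Y.I"
      by (intro Y.I_add Y.I_left fr_closed)
    then show "\<exists>g\<in>Y.I. \<forall>k<N. fps_nth (u - v) k = fps_nth g k"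
      by (intro bexI) (auto simp: scal_fps_X_power fps_X_power_mult_nth)
  qed
  then show ?thesis using f u v by (simp add: agree_def Y.cls_eq_iff)
qed

text \<open>Agreement spreads from letters to words, from words to polynomials by sums, and to
  series by limits of their truncations.\<close>

lemma agree_eq:
  assumes "\<And>x. x \<in> X \<Longrightarrow> gen x \<in> agree"
    and ext: "\<rho> \<in> extensional (carrier (presented X R))" "\<rho>' \<in> extensional (carrier (presented X R))"
  shows "\<rho> = \<rho>'"
proof -
  have const: "fps_const (const c) \<in> agree" for c
    using agree_scal[of "fps_const c"] by (simp add: scal_fps_const)
  have word: "fps_const (Poly_Mapping.single w c) \<in> agree" if "w \<in> lists X" for w c
    using that
  proof (induction w)
    case Nil
    then show ?case using const[of c] by (simp add: const_def)
  next
    case (Cons x w)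
    have "Poly_Mapping.single (x # w) c = letter x * Poly_Mapping.single w c"
      by (simp add: letter_def mult_single plus_list_def)
    then have "fps_const (Poly_Mapping.single (x # w) c) = gen x * fps_const (Poly_Mapping.single w c)"
      by (simp add: gen_def)
    then show ?case using Cons assms(1) agree_mult by simp
  qed
  have poly: "fps_const a \<in> agree" if "Poly_Mapping.keys a \<subseteq> lists X" for a
  proof -
    have "a = (\<Sum>w\<in>Poly_Mapping.keys a. Poly_Mapping.single w (Poly_Mapping.lookup a w))"
      by (rule sum_monomials[symmetric])
    then have "fps_const a = (\<Sum>w\<in>Poly_Mapping.keys a. fps_const (Poly_Mapping.single w (Poly_Mapping.lookup a w)))"
      by (metis fps_const_sum)
    also have "\<dots> \<in> agree" using that word by (intro agree_sum) blast
    finally show ?thesis .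
  qed
  have all: "f \<in> agree" if f: "f \<in> fr X" for f
  proof (rule agree_limit[OF f])
    fix N
    let ?g = "\<Sum>i<N. scal (fps_X ^ i) * fps_const (fps_nth f i)"
    have "fps_nth ?g k = fps_nth f k" if "k < N" for k
    proof -
      have "fps_nth ?g k = (\<Sum>i<N. if i = k then fps_nth f k else 0)"
        unfolding fps_sum_nth by (rule sum.cong) (auto simp: scal_fps_X_power fps_X_power_mult_nth)
      then show ?thesis using that by simp
    qed
    moreover have "?g \<in> agree"
      using f by (intro agree_sum agree_mult agree_scal poly) (simp add: fr_iff)
    ultimately show "\<exists>g\<in>agree. \<forall>k<N. fps_nth f k = fps_nth g k" by metis
  qed
  show ?thesis
  proof (rule extensionalityI[OF ext])
    fix C assume "C \<in> carrier (presented X R)"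
    then show "\<rho> C = \<rho>' C" using all unfolding X.carrier_presented agree_def by blast
  qed
qed

end

section \<open>The oscillator superalgebra over the power series ring\<close>

lemma fps_const_intertwine:
  fixes f g :: "'b::ring_1 fps"
  assumes "\<And>k. c * fps_nth f k = fps_nth g k * c"
  shows "fps_const c * f = g * fps_const c"
  by (rule fps_ext) (simp add: assms)

lemma fps_commute:
  fixes f g :: "'b::ring_1 fps"
  assumes "\<And>i j. fps_nth f i * fps_nth g j = fps_nth g j * fps_nth f i"
  shows "f * g = g * f"
proof (rule fps_ext)
  fix k
  have "fps_nth (f * g) k = (\<Sum>i=0..k. fps_nth g (k - i) * fps_nth f i)"
    by (simp add: fps_mult_nth assms)
  also have "\<dots> = (\<Sum>i=0..k. fps_nth g i * fps_nth f (k - i))"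
    by (rule sum.reindex_bij_witness[of _ "\<lambda>i. k - i" "\<lambda>i. k - i"]) auto
  finally show "fps_nth (f * g) k = fps_nth (g * f) k" by (simp add: fps_mult_nth)
qed

lemma power_intertwine:
  fixes c :: "'b::monoid_mult"
  assumes "c * a = b * c"
  shows "c * a ^ k = b ^ k * c"
proof (induction k)
  case (Suc k)
  have "c * a ^ Suc k = (c * a) * a ^ k" by (simp add: mult.assoc)
  also have "\<dots> = b ^ Suc k * c" using Suc by (simp add: assms mult.assoc)
  finally show ?case .
qed simp

text \<open>Powers of \<open>b\<close> acting on \<open>c\<close> may be computed with the commuting
  \<open>a\<close>. This evaluates functions of a Fermi number operator next to an
  oscillator.\<close>

lemma power_eq_right:
  fixes c :: "'b::monoid_mult"
  assumes "b * c = a * c" "a * b = b * a"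
  shows "b ^ k * c = a ^ k * c"
proof (induction k)
  case (Suc k)
  have "b ^ Suc k * c = b ^ k * (b * c)" by (simp add: power_Suc2 mult.assoc del: power_Suc)
  also have "\<dots> = (b ^ k * a) * c" by (simp add: assms mult.assoc)
  also have "\<dots> = a * (b ^ k * c)" using power_intertwine[OF assms(2), of k] by (simp flip: mult.assoc)
  finally show ?case using Suc by (simp add: mult.assoc)
qed simp

text \<open>Surjectivity makes the images of the complex scalars central. Series over the quotient
  replace the quotient of the series by a closed ideal.\<close>

locale q_quotient = unital_hom \<pi> for \<pi> :: "'x free_alg \<Rightarrow> 'b::ring_1" +
  assumes surj: "surj \<pi>"
begin

sublocale c: unital_hom cmap by (rule unital_hom_cmap)

definition kap :: "complex \<Rightarrow> 'b" where "kap c = \<pi> (const c)"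

lemma kap_comm: "kap c * z = z * kap c"
proof -
  obtain a where "z = \<pi> a" using surj by auto
  then show ?thesis by (simp add: kap_def const_commute flip: hom_mult)
qed

lemma kap_left: "z * (kap c * w) = kap c * (z * w)"
  using kap_comm by (metis mult.assoc)

lemma kap_mult: "kap a * kap b = kap (a * b)"
  by (simp add: kap_def const_mult flip: hom_mult)

lemma kap_mult_left: "kap a * (kap b * z) = kap (a * b) * z"
  by (simp flip: kap_mult mult.assoc)

lemma kap_add: "kap a + kap b = kap (a + b)"
  by (simp add: kap_def const_def single_add flip: hom_add)

lemma kap_one: "kap 1 = 1"
  using hom_one by (simp add: kap_def const_def flip: zero_list_def)

lemma kap_zero: "kap 0 = 0"
  by (simp add: kap_def const_def hom_zero)

lemma kap_power: "kap c ^ k = kap (c ^ k)"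
  by (induction k) (simp_all add: kap_one kap_mult)

lemma kap_of_int: "kap (of_int z) = of_int z"
proof -
  have "kap (of_nat k) = of_nat k" for k
    by (induction k) (simp_all add: kap_zero kap_one flip: kap_add)
  moreover have "kap (- c) = - kap c" for c
    using kap_add[of c "- c"] by (simp add: kap_zero eq_neg_iff_add_eq_0 add.commute)
  ultimately show ?thesis by (cases z rule: int_cases2) auto
qed

definition qp :: "'b \<Rightarrow> 'b fps" where "qp a = Abs_fps (\<lambda>k. kap (1 / fact k) * a ^ k)"

lemma qp_nth: "fps_nth (qp a) k = kap (1 / fact k) * a ^ k"
  by (simp add: qp_def)

lemma cmap_qpow: "cmap (qpow a) = qp (\<pi> a)"
  by (rule fps_ext) (simp add: qpow_def qp_nth hom_mult hom_power kap_def)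

lemma qp_zero: "qp 0 = 1"
  by (rule fps_ext) (simp add: qp_nth power_0_left kap_one)

text \<open>Both sides solve F' = (a+b)F with F(0) = 1. The induction compares coefficients:
  \<open>(i+1) f_(i+1) = a f_i\<close> for each factor, and in the Cauchy product the two weights
  \<open>i\<close> and \<open>Suc k - i\<close> add up to \<open>Suc k\<close>.\<close>

lemma qp_add:
  assumes "a * b = b * a"
  shows "qp a * qp b = qp (a + b)"
proof -
  have S: "kap (1 / fact (Suc k)) * (z ^ Suc k) = kap (1 / of_nat (Suc k)) * (z * (kap (1 / fact k) * z ^ k))" for z k
    by (simp add: kap_left[of z] kap_mult_left)
  have "fps_nth (qp a * qp b) k = fps_nth (qp (a + b)) k" for k
  proof (induction k)
    case 0
    show ?case by (simp add: qp_nth kap_one)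
  next
    case (Suc k)
    let ?f = "fps_nth (qp a)" and ?g = "fps_nth (qp b)" and ?r = "\<lambda>k. kap (of_nat k)"
    have f: "a * ?f i = ?r (Suc i) * ?f (Suc i)" and g: "b * ?g i = ?r (Suc i) * ?g (Suc i)" for i
      by (simp_all add: qp_nth kap_left[of a] kap_left[of b] kap_mult_left del: of_nat_Suc)
    have bf: "b * ?f i = ?f i * b" for i
      using power_intertwine[of b a a i] assms
      by (simp add: qp_nth kap_left[of b] mult.assoc)
    have rr: "?f j * (?r i * w) = ?r i * (?f j * w)" for w i j
      by (rule kap_left)
    have sh: "(\<Sum>i=0..k. ?r (Suc i) * ?f (Suc i) * ?g (k - i)) = (\<Sum>i=0..Suc k. ?r i * ?f i * ?g (Suc k - i))"
      by (subst sum.atLeast0_atMost_Suc_shift) (simp add: kap_zero)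
    have sg: "(\<Sum>i=0..k. ?f i * (?r (Suc (k - i)) * ?g (Suc (k - i)))) = (\<Sum>i=0..Suc k. ?f i * (?r (Suc k - i) * ?g (Suc k - i)))"
      by (simp add: kap_zero Suc_diff_le add_diff_eq)
    have "(a + b) * fps_nth (qp a * qp b) k = (\<Sum>i=0..k. (a * ?f i) * ?g (k - i)) + (\<Sum>i=0..k. ?f i * (b * ?g (k - i)))"
      by (simp add: fps_mult_nth distrib_right distrib_left sum.distrib sum_distrib_left bf flip: mult.assoc)
    also have "\<dots> = (\<Sum>i=0..Suc k. ?r i * ?f i * ?g (Suc k - i)) + (\<Sum>i=0..Suc k. ?f i * (?r (Suc k - i) * ?g (Suc k - i)))"
      unfolding f g sh sg ..
    also have "\<dots> = (\<Sum>i=0..Suc k. (?r i + ?r (Suc k - i)) * (?f i * ?g (Suc k - i)))"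
      by (simp only: sum.distrib[symmetric] rr distrib_right mult.assoc)
    also have "\<dots> = (\<Sum>i=0..Suc k. ?r (Suc k) * (?f i * ?g (Suc k - i)))"
      by (rule sum.cong) (auto simp: kap_add simp del: of_nat_Suc simp flip: of_nat_add)
    also have "\<dots> = ?r (Suc k) * fps_nth (qp a * qp b) (Suc k)"
      by (simp only: fps_mult_nth sum_distrib_left)
    finally have "kap (1 / of_nat (Suc k)) * ((a + b) * fps_nth (qp (a + b)) k) = fps_nth (qp a * qp b) (Suc k)"
      unfolding Suc by (simp add: kap_mult kap_one del: of_nat_Suc flip: mult.assoc)
    then show ?case using S[of k "a + b"] by (simp only: qp_nth)
  qed
  then show ?thesis by (rule fps_ext)
qed

lemma qp_intertwine: "c * a = b * c \<Longrightarrow> fps_const c * qp a = qp b * fps_const c"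
  by (rule fps_const_intertwine) (simp add: qp_nth kap_left[of c] power_intertwine mult.assoc)

lemma qp_eq_right:
  assumes "b * c = a * c" "a * b = b * a"
  shows "qp b * fps_const c = qp a * fps_const c"
  by (rule fps_ext) (simp add: qp_nth mult.assoc power_eq_right[OF assms])

lemma qp_commute: "a * b = b * a \<Longrightarrow> qp a * qp b = qp b * qp a"
  using qp_add[of a b] qp_add[of b a] by (simp add: add.commute)

definition qz :: "int \<Rightarrow> 'b fps" where "qz a = cmap (scal (fps_exp (of_int a)))"

lemma qz_qp: "qz a = qp (of_int a)"
  by (rule fps_ext) (simp add: qz_def scal_def qp_nth kap_power kap_mult flip: kap_def kap_of_int)

lemma surj_cmap: "\<exists>g. f = cmap g"
proof
  show "f = cmap (Abs_fps (\<lambda>k. SOME a. \<pi> a = fps_nth f k))"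
    by (rule fps_ext) (use surj in \<open>auto intro!: someI_ex[THEN sym] simp: surj_def; metis\<close>)
qed

lemma cmap_scal_comm: "cmap (scal s) * f = f * cmap (scal s)"
  using surj_cmap[of f] by (auto simp: scal_commute simp flip: c.hom_mult)

lemma lam_qdiff: "qz 1 - qz (-1) = cmap (scal qdiff)"
  by (rule fps_ext) (simp add: qz_def qdiff_def scal_def const_def single_diff flip: hom_diff)

text \<open>The series q - q^(-1) is h times a unit with constant term 2; multiplying by the inverse
  of the unit leaves h, which only shifts coefficients.\<close>

lemma lam_cancel:
  assumes "(qz 1 - qz (-1)) * f = (qz 1 - qz (-1)) * g"
  shows "f = g"
proof -
  define u where "u = fps_shift 1 qdiff"
  have u0: "fps_nth u 0 \<noteq> 0" by (simp add: u_def qdiff_def)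
  have X: "inverse u * qdiff = fps_X"
  proof -
    have "qdiff = u * fps_X"
      unfolding u_def by (rule fps_ext) (simp add: qdiff_def)
    then have "inverse u * qdiff = (inverse u * u) * fps_X" by (simp only: mult.assoc)
    then show ?thesis using inverse_mult_eq_1[OF u0] by simp
  qed
  have "cmap (scal (inverse u)) * (cmap (scal qdiff) * f) = cmap (scal (inverse u)) * (cmap (scal qdiff) * g)"
    using assms by (simp add: lam_qdiff)
  then have "cmap (scal fps_X) * f = cmap (scal fps_X) * g"
    by (simp add: X flip: mult.assoc c.hom_mult scal_mult)
  moreover have "cmap (scal fps_X) = fps_X"
    by (rule fps_ext) (simp add: scal_def fps_X_def kap_one kap_zero flip: kap_def)
  ultimately have "fps_X * f = fps_X * g" by simp
  then have "fps_nth (fps_X * f) (Suc k) = fps_nth (fps_X * g) (Suc k)" for k by simp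
  then show ?thesis by (intro fps_ext) simp
qed

end

section \<open>Bose and Fermi number operators in the quotient\<close>

locale oscillator = q_quotient \<pi> for \<pi> :: "wgen free_alg \<Rightarrow> 'b::ring_1" +
  fixes n m :: nat and p :: complex
  assumes rel: "W_rel n m l r \<Longrightarrow> cmap l = cmap r"
begin

abbreviation M where "M \<equiv> n + m"
abbreviation fm :: "nat \<Rightarrow> bool" where "fm i \<equiv> n < i"

definition cp where "cp i = \<pi> (letter (Cplus i))"
definition cm where "cm i = \<pi> (letter (Cminus i))"
definition N where "N i = (if i = 0 then kap p - (\<Sum>j=1..M. cp j * cm j) else cp i * cm i)"

lemma parity_sign: "(-1) ^ (\<theta> n i * \<theta> n j) = (if fm i \<and> fm j then -1 else 1 :: 'c::ring_1)"
  by (simp add: \<theta>_def)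

lemma rel_const:
  assumes "W_rel n m (sbracket (wdeg n) 1 a b) (of_bool \<beta>)"
  shows "\<pi> (letter a) * \<pi> (letter b) = of_bool \<beta> + (-1) ^ (wdeg n a * wdeg n b) * (\<pi> (letter b) * \<pi> (letter a))"
proof -
  have "cmap (gen a) = fps_const (\<pi> (letter a))" for a
    by (rule fps_ext) (simp add: gen_def hom_zero)
  then have "fps_const (\<pi> (letter a)) * fps_const (\<pi> (letter b))
    - (-1) ^ (wdeg n a * wdeg n b) * (fps_const (\<pi> (letter b)) * fps_const (\<pi> (letter a))) = of_bool \<beta>"
    using rel[OF assms]
    by (simp add: sbracket_def scal_one c.hom_diff c.hom_mult c.hom_power c.hom_uminus c.hom_one c.hom_of_bool mult.assoc)
  then have "fps_nth (fps_const (\<pi> (letter a)) * fps_const (\<pi> (letter b))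
    - (-1) ^ (wdeg n a * wdeg n b) * (fps_const (\<pi> (letter b)) * fps_const (\<pi> (letter a)))) 0 = fps_nth (of_bool \<beta>) 0"
    by (rule arg_cong)
  then show ?thesis
    by (cases \<beta>) (auto simp: algebra_simps minus_one_power_iff split: if_splits)
qed

lemma cm_cp:
  assumes "i \<in> {1..M}" "j \<in> {1..M}"
  shows "cm i * cp j = of_bool (i = j) + (if fm i \<and> fm j then - (cp j * cm i) else cp j * cm i)"
  using rel_const[OF W_rel.intros(1)[OF assms]] by (simp add: cm_def cp_def parity_sign)

lemma cp_cp:
  assumes "i \<in> {1..M}" "j \<in> {1..M}"
  shows "cp i * cp j = (if fm i \<and> fm j then - (cp j * cp i) else cp j * cp i)"
  using rel_const[of _ _ False] W_rel.intros(2)[OF assms] by (simp add: cm_def cp_def parity_sign)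

lemma cm_cm:
  assumes "i \<in> {1..M}" "j \<in> {1..M}"
  shows "cm i * cm j = (if fm i \<and> fm j then - (cm j * cm i) else cm j * cm i)"
  using rel_const[of _ _ False] W_rel.intros(3)[OF assms] by (simp add: cm_def cp_def parity_sign)

text \<open>The complex scalars contain 1/2, so the bracket of a Fermi operator with itself yields a
  vanishing square.\<close>

lemma eq_uminus_zero: "(z :: 'b) = - z \<Longrightarrow> z = 0"
proof -
  assume "z = - z"
  then have "kap (1/2) * (z + z) = 0" by (metis add.right_inverse mult_zero_right)
  moreover have "z + z = kap 2 * z"
    using kap_of_int[of 2] by (simp add: mult_2)
  ultimately show "z = 0" by (simp add: kap_mult_left kap_one)
qed

lemma cp_sq: "i \<in> {1..M} \<Longrightarrow> fm i \<Longrightarrow> cp i * cp i = 0"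
  by (intro eq_uminus_zero) (metis cp_cp)

lemma cm_sq: "i \<in> {1..M} \<Longrightarrow> fm i \<Longrightarrow> cm i * cm i = 0"
  by (intro eq_uminus_zero) (metis cm_cm)

lemma cp_N:
  assumes i: "i \<in> {1..M}" and j: "j \<in> {1..M}"
  shows "cp i * N j = (N j - of_bool (i = j)) * cp i"
proof (cases "i = j")
  case True
  \<comment> \<open>In the Fermi case both sides are 0 by \<open>cp_sq\<close>.\<close>
  have "cp i * (cp i * cm i) = (cp i * cm i - 1) * cp i"
    using cm_cp[OF i i] cp_sq[OF i] 
    by (cases "fm i") (simp_all add: mult.assoc left_diff_distrib distrib_left right_diff_distrib, simp add: mult.assoc[symmetric])
  then show ?thesis using True i by (simp add: N_def)
next
  case False
  have "cp i * (cp j * cm j) = (cp j * cm j) * cp i"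
    using cm_cp[OF j i] cp_cp[OF i j] False
    by (cases "fm i \<and> fm j") (auto simp: mult.assoc, simp_all flip: mult.assoc)
  then show ?thesis using False j by (simp add: N_def)
qed

lemma cm_N:
  assumes i: "i \<in> {1..M}" and j: "j \<in> {1..M}"
  shows "cm i * N j = (N j + of_bool (i = j)) * cm i"
proof (cases "i = j")
  case True
  have "cm i * (cp i * cm i) = (cp i * cm i + 1) * cm i"
    using cm_cp[OF i i] cm_sq[OF i]
    by (cases "fm i") (simp_all add: mult.assoc left_diff_distrib distrib_right flip: mult.assoc[of "cm i"])
  then show ?thesis using True i by (simp add: N_def)
next
  case False
  have "cm i * (cp j * cm j) = (cp j * cm j) * cm i"
    using cm_cp[OF i j] cm_cm[OF i j] False
    by (cases "fm i \<and> fm j") (auto simp: mult.assoc simp flip: mult.assoc[of "cm i"])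
  then show ?thesis using False j by (simp add: N_def)
qed

lemma N_0: "N 0 = kap p - (\<Sum>j=1..M. N j)"
  by (simp add: N_def)

lemma cp_N0:
  assumes "i \<in> {1..M}"
  shows "cp i * N 0 = (N 0 + 1) * cp i"
proof -
  have "cp i * (\<Sum>j=1..M. N j) = (\<Sum>j=1..M. N j * cp i - (if j = i then cp i else 0))"
    unfolding sum_distrib_left by (rule sum.cong) (auto simp: cp_N[OF assms] left_diff_distrib)
  also have "\<dots> = (\<Sum>j=1..M. N j) * cp i - cp i"
    using assms by (simp add: sum_subtractf sum_distrib_right)
  finally show ?thesis
    by (simp add: N_0 right_diff_distrib left_diff_distrib distrib_right kap_comm)
qed

lemma cm_N0:
  assumes "i \<in> {1..M}"
  shows "cm i * N 0 = (N 0 - 1) * cm i"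
proof -
  have "cm i * (\<Sum>j=1..M. N j) = (\<Sum>j=1..M. N j * cm i + (if j = i then cm i else 0))"
    unfolding sum_distrib_left by (rule sum.cong) (auto simp: cm_N[OF assms] distrib_right)
  also have "\<dots> = (\<Sum>j=1..M. N j) * cm i + cm i"
    using assms by (simp add: sum.distrib sum_distrib_right)
  finally show ?thesis
    by (simp add: N_0 right_diff_distrib left_diff_distrib distrib_right kap_comm)
qed

lemma N_N: 
  assumes "i \<in> {1..M}" "j \<in> {1..M}"
  shows "N i * N j = N j * N i"
proof -
  have "(cp i * cm i) * N j = cp i * ((N j + of_bool (i = j)) * cm i)"
    using cm_N[OF assms] by (simp add: mult.assoc)
  also have "\<dots> = (cp i * N j) * cm i + of_bool (i = j) * (cp i * cm i)"
    by (simp add: distrib_right distrib_left mult.assoc)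
  also have "\<dots> = N j * (cp i * cm i)"
    using cp_N[OF assms] by (simp add: left_diff_distrib mult.assoc)
  finally show ?thesis using assms(1) by (simp add: N_def)
qed

lemma N_comm:
  assumes "i \<le> M" "j \<le> M"
  shows "N i * N j = N j * N i"
proof -
  have 0: "N 0 * N j = N j * N 0" if "j \<in> {1..M}" for j
    using that unfolding N_0
    by (simp add: left_diff_distrib right_diff_distrib sum_distrib_left sum_distrib_right kap_comm N_N[of _ j])
  show ?thesis
    using assms 0[of i] 0[of j] N_N[of i j] by (cases "i = 0"; cases "j = 0") (auto simp: Suc_le_eq)
qed

definition nu :: "(nat \<Rightarrow> int) \<Rightarrow> 'b" where "nu u = (\<Sum>k=0..M. of_int (u k) * N k)"

lemma of_int_comm: "(z :: 'b) * of_int k = of_int k * z"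
  by (metis kap_of_int kap_comm)

lemma of_int_left: "z * (of_int k * w) = of_int k * (z * (w :: 'b))"
  by (metis mult.assoc of_int_comm)

lemma nu_add: "nu u + nu v = nu (\<lambda>k. u k + v k)"
  by (simp add: nu_def sum.distrib distrib_right)

lemma nu_comm: "nu u * nu v = nu v * nu u"
proof -
  have "of_int (u i) * N i * (of_int (v j) * N j) = of_int (v j) * N j * (of_int (u i) * N i)"
    if "i \<in> {0..M}" "j \<in> {0..M}" for i j
  proof -
    have "of_int (u i) * N i * (of_int (v j) * N j) = of_int (u i * v j) * (N i * N j)"
      by (simp add: mult.assoc of_int_left[of "N i"])
    also have "\<dots> = of_int (v j * u i) * (N j * N i)"
      using N_comm[of i j] that by (simp add: mult.commute[of "u i"])
    also have "\<dots> = of_int (v j) * N j * (of_int (u i) * N i)"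
      by (simp add: mult.assoc of_int_left[of "N j"])
    finally show ?thesis .
  qed
  then show ?thesis
    unfolding nu_def sum_product by (subst sum.swap, intro sum.cong refl) auto
qed

lemma nu_delta: "i \<le> M \<Longrightarrow> nu (\<lambda>k. of_bool (k = i)) = N i"
  unfolding nu_def by (subst sum.remove[of _ i]) auto

lemma nu_uminus: "nu (\<lambda>k. - u k) = - nu u"
  by (simp add: nu_def sum_negf)

lemma nu_zero: "nu (\<lambda>_. 0) = 0"
  by (simp add: nu_def)

lemma cp_nu:
  assumes "i \<in> {1..M}"
  shows "cp i * nu u = (nu u + of_int (u 0 - u i)) * cp i"
proof -
  have "cp i * nu u = (\<Sum>k=0..M. of_int (u k) * (cp i * N k))"
    by (simp add: nu_def sum_distrib_left of_int_left)
  also have "\<dots> = (\<Sum>k=0..M. of_int (u k) * N k * cp i + (if k = 0 then of_int (u 0) * cp i else 0)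
      - (if k = i then of_int (u i) * cp i else 0))"
  proof (rule sum.cong)
    fix k assume "k \<in> {0..M}"
    then show "of_int (u k) * (cp i * N k) = of_int (u k) * N k * cp i + (if k = 0 then of_int (u 0) * cp i else 0)
      - (if k = i then of_int (u i) * cp i else 0)"
      using assms cp_N[OF assms, of k] cp_N0[OF assms]
      by (cases "k = 0") (auto simp: mult.assoc distrib_right distrib_left left_diff_distrib right_diff_distrib)
  qed simp
  also have "\<dots> = nu u * cp i + of_int (u 0) * cp i - of_int (u i) * cp i"
    using assms by (simp add: sum.distrib sum_subtractf nu_def sum_distrib_right)
  finally show ?thesis by (simp add: distrib_right left_diff_distrib)
qed

lemma cm_nu:
  assumes "i \<in> {1..M}"
  shows "cm i * nu u = (nu u + of_int (u i - u 0)) * cm i"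
proof -
  have "cm i * nu u = (\<Sum>k=0..M. of_int (u k) * (cm i * N k))"
    by (simp add: nu_def sum_distrib_left of_int_left)
  also have "\<dots> = (\<Sum>k=0..M. of_int (u k) * N k * cm i - (if k = 0 then of_int (u 0) * cm i else 0)
      + (if k = i then of_int (u i) * cm i else 0))"
  proof (rule sum.cong)
    fix k assume "k \<in> {0..M}"
    then show "of_int (u k) * (cm i * N k) = of_int (u k) * N k * cm i - (if k = 0 then of_int (u 0) * cm i else 0)
      + (if k = i then of_int (u i) * cm i else 0)"
      using assms cm_N[OF assms, of k] cm_N0[OF assms]
      by (cases "k = 0") (auto simp: mult.assoc distrib_right distrib_left left_diff_distrib right_diff_distrib)
  qed simp
  also have "\<dots> = nu u * cm i - of_int (u 0) * cm i + of_int (u i) * cm i"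
    using assms by (simp add: sum.distrib sum_subtractf nu_def sum_distrib_right)
  finally show ?thesis by (simp add: distrib_right left_diff_distrib)
qed

end

lemma power_commute2:
  fixes a b :: "'b::monoid_mult"
  assumes "a * b = b * a" shows "a ^ i * b ^ j = b ^ j * a ^ i"
  by (metis assms power_intertwine)

section \<open>Quantum numbers and division by q - q^(-1)\<close>

context q_quotient begin

lemma lam_left: "f * ((qz 1 - qz (-1)) * g) = (qz 1 - qz (-1)) * (f * g)"
  unfolding lam_qdiff by (metis cmap_scal_comm mult.assoc)

text \<open>Quantum numbers and their ratios are accessible through their products with q - q^(-1).
  Intertwining relations are therefore checked for these products and then divided.\<close>

lemma lam_transfer:
  assumes "(qz 1 - qz (-1)) * f = F" "(qz 1 - qz (-1)) * g = G" "c * F = G * c"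
  shows "c * f = g * c"
proof (rule lam_cancel)
  have "(qz 1 - qz (-1)) * (c * f) = c * F"
    using lam_left[of c f] assms(1) by simp
  also have "\<dots> = (qz 1 - qz (-1)) * (g * c)"
    using assms(2,3) by (simp only: mult.assoc[symmetric])
  finally show "(qz 1 - qz (-1)) * (c * f) = (qz 1 - qz (-1)) * (g * c)" .
qed

text \<open>The series (q^b - q^(-b))/b, written out so that no inverse of \<open>b\<close> is
  involved.\<close>

definition oddpart :: "'b \<Rightarrow> 'b fps" where
  "oddpart b = Abs_fps (\<lambda>k. if odd k then kap (2 / fact k) * b ^ (k - 1) else 0)"

lemma oddpart_nth: "fps_nth (oddpart b) k = (if odd k then kap (2 / fact k) * b ^ (k - 1) else 0)"
  by (simp add: oddpart_def)

lemma lam_qnum_ratio: "(qz 1 - qz (-1)) * cmap (qnum_ratio a) = oddpart (\<pi> a)"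
proof -
  let ?F = "Abs_fps (\<lambda>k. if odd k then const (2 / fact k) * a ^ (k - 1) else 0)"
  have "scal qdiff * qnum_ratio a = ?F"
    unfolding qnum_ratio_def by (rule over_qdiff) simp
  moreover have "cmap ?F = oddpart (\<pi> a)"
    by (rule fps_ext) (simp add: oddpart_nth hom_mult hom_power hom_zero kap_def)
  ultimately show ?thesis
    unfolding lam_qdiff by (simp flip: c.hom_mult)
qed

lemma lam_qnum: "(qz 1 - qz (-1)) * cmap (qnum a) = qp (\<pi> a) - qp (- \<pi> a)"
proof -
  have "scal qdiff * qnum a = qpow a - qpow (- a)"
    unfolding qnum_def by (rule over_qdiff) (simp add: qpow_def)
  then show ?thesis
    unfolding lam_qdiff by (simp add: c.hom_diff cmap_qpow hom_uminus flip: c.hom_mult)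
qed

lemma oddpart_intertwine: "c * a = b * c \<Longrightarrow> fps_const c * oddpart a = oddpart b * fps_const c"
  by (rule fps_const_intertwine) (simp add: oddpart_nth kap_left[of c] power_intertwine mult.assoc)

lemma kap_swap: "kap c * a * (kap d * b) = kap (c * d) * (a * b)"
  by (simp add: mult.assoc kap_left[of a] kap_mult_left)

lemma oddpart_qp: "a * b = b * a \<Longrightarrow> oddpart a * qp b = qp b * oddpart a"
  by (rule fps_commute) (simp add: oddpart_nth qp_nth kap_swap power_commute2 mult.commute)

lemma oddpart_oddpart: "a * b = b * a \<Longrightarrow> oddpart a * oddpart b = oddpart b * oddpart a"
  by (rule fps_commute) (simp add: oddpart_nth kap_swap power_commute2 mult.commute)

lemma oddpart_mult: "oddpart b * fps_const b = qp b - qp (- b)"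
proof (rule fps_ext)
  fix k
  show "fps_nth (oddpart b * fps_const b) k = fps_nth (qp b - qp (- b)) k"
  proof (cases "odd k")
    case True
    then obtain j where "k = Suc j" by (cases k) auto
    then have "b ^ (k - 1) * b = b ^ k" by (simp add: power_Suc2 del: power_Suc)
    moreover have "kap (2 / fact k) = kap (1 / fact k) + kap (1 / fact k)"
      by (simp add: kap_add)
    ultimately show ?thesis using True
      by (simp add: oddpart_nth qp_nth mult.assoc distrib_right)
  qed (simp add: oddpart_nth qp_nth)
qed

lemma oddpart_eq_right:
  assumes "b * c = a * c" "a * b = b * a"
  shows "oddpart b * fps_const c = oddpart a * fps_const c"
  by (rule fps_ext) (simp add: oddpart_nth mult.assoc power_eq_right[OF assms])

lemma qz_mult: "qz (a + b) = qz a * qz b"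
  unfolding qz_def by (simp add: fps_exp_add_mult scal_mult c.hom_mult)

lemma qz_central: "qz a * f = f * qz a"
  unfolding qz_def by (rule cmap_scal_comm)

lemma qz_0: "qz 0 = 1"
  by (simp add: qz_qp qp_zero)

end

section \<open>The q-oscillators built from the Bose and Fermi operators\<close>

context oscillator begin

definition tor where "tor u = qp (nu u)"
definition ox where "ox i = fps_const (cp i)"
definition rt where "rt i = cmap (qnum_ratio (Num i + 1))"
definition oy where "oy i = rt i * fps_const (cm i)"
definition oP where "oP = cmap (qnum (const p - NumTot n m))"

lemma pi_Num: "1 \<le> i \<Longrightarrow> \<pi> (Num i) = N i"
  by (simp add: Num_def N_def cp_def cm_def hom_mult)

lemma pi_N0: "\<pi> (const p - NumTot n m) = N 0"
  by (simp add: NumTot_def N_0 hom_diff hom_sum pi_Num kap_def)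

lemma lam_rt: "1 \<le> i \<Longrightarrow> (qz 1 - qz (-1)) * rt i = oddpart (N i + 1)"
  unfolding rt_def lam_qnum_ratio by (simp add: hom_add hom_one pi_Num)

lemma lam_oP: "(qz 1 - qz (-1)) * oP = qp (N 0) - qp (- N 0)"
  unfolding oP_def lam_qnum pi_N0 ..

lemma nu_N: "i \<le> M \<Longrightarrow> nu u * N i = N i * nu u"
  using nu_comm[of u "\<lambda>k. of_bool (k = i)"] by (simp add: nu_delta)

lemma rt_const:
  assumes "1 \<le> i" "c * N i = N i * c"
  shows "fps_const c * rt i = rt i * fps_const c"
  using assms by (intro lam_transfer[OF lam_rt lam_rt] oddpart_intertwine) (auto simp: distrib_left distrib_right)

lemma rt_qp:
  assumes "1 \<le> i" "a * N i = N i * a"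
  shows "qp a * rt i = rt i * qp a"
  using assms by (intro lam_transfer[OF lam_rt lam_rt] oddpart_qp[symmetric]) (auto simp: distrib_left distrib_right)

lemma rt_rt:
  assumes "1 \<le> i" "1 \<le> j" "N i * N j = N j * N i"
  shows "rt i * rt j = rt j * rt i"
proof -
  have "oddpart (N j + 1) * oddpart (N i + 1) = oddpart (N i + 1) * oddpart (N j + 1)"
    using assms(3) by (intro oddpart_oddpart) (simp add: distrib_left distrib_right)
  \<comment> \<open>The factor q - q^(-1) is removed from one ratio at a time.\<close>
  then have "oddpart (N j + 1) * rt i = rt i * oddpart (N j + 1)"
    using assms by (intro lam_transfer[OF lam_rt lam_rt])
  from this[symmetric] show ?thesis
    using assms by (intro lam_transfer[OF lam_rt lam_rt])
qed

lemma oP_qp: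
  assumes "a * N 0 = N 0 * a"
  shows "qp a * oP = oP * qp a"
  using qp_commute[of a "N 0"] qp_commute[of a "- N 0"] assms
  by (intro lam_transfer[OF lam_oP lam_oP]) (simp add: left_diff_distrib right_diff_distrib)

lemma rt_oP:
  assumes "i \<in> {1..M}"
  shows "rt i * oP = oP * rt i"
proof -
  have "N 0 * N i = N i * N 0" using assms N_comm[of 0 i] by simp
  then have "rt i * (qp (N 0) - qp (- N 0)) = (qp (N 0) - qp (- N 0)) * rt i"
    using assms rt_qp[of i "N 0"] rt_qp[of i "- N 0"] by (simp add: left_diff_distrib right_diff_distrib)
  then show ?thesis by (intro lam_transfer[OF lam_oP lam_oP])
qed

lemma tor_const: "qp (nu u + of_int c) = qz c * tor u"
  unfolding qz_qp tor_def by (simp add: qp_add add.commute flip: of_int_comm)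

lemma nu_upd: "i \<le> M \<Longrightarrow> nu (u(i := a)) = nu u + of_int (a - u i) * N i"
proof -
  assume "i \<le> M"
  then have "nu (\<lambda>k. (a - u i) * of_bool (k = i)) = of_int (a - u i) * N i"
    unfolding nu_def by (subst sum.remove[of _ i]) auto
  moreover have "u(i := a) = (\<lambda>k. u k + (a - u i) * of_bool (k = i))" by auto
  ultimately show ?thesis by (metis nu_add)
qed

lemma oy_tor:
  assumes "i \<in> {1..M}"
  shows "oy i * tor u = qz (u i - u 0) * (tor u * oy i)"
proof -
  have "oy i * tor u = rt i * (fps_const (cm i) * qp (nu u))"
    by (simp add: oy_def tor_def mult.assoc)
  also have "\<dots> = rt i * (qz (u i - u 0) * (tor u * fps_const (cm i)))"
    unfolding qp_intertwine[OF cm_nu[OF assms]] tor_const by (simp add: mult.assoc)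
  also have "\<dots> = qz (u i - u 0) * ((rt i * tor u) * fps_const (cm i))"
    by (metis qz_central mult.assoc)
  also have "rt i * tor u = tor u * rt i"
    using assms rt_qp[of i "nu u"] nu_N[of i u] by (simp add: tor_def)
  finally show ?thesis by (simp add: oy_def mult.assoc)
qed

lemma cm_rt:
  assumes "i \<in> {1..M}" "j \<in> {1..M}" "i \<noteq> j"
  shows "fps_const (cm i) * rt j = rt j * fps_const (cm i)" "fps_const (cp i) * rt j = rt j * fps_const (cp i)"
  using assms cm_N[of i j] cp_N[of i j] by (intro rt_const; simp)+

lemma oy_oy:
  assumes "i \<in> {1..M}" "j \<in> {1..M}" "i \<noteq> j"
  shows "oy i * oy j = rt i * rt j * fps_const (cm i * cm j)"
proof -
  have "oy i * oy j = rt i * ((fps_const (cm i) * rt j) * fps_const (cm j))"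
    by (simp only: oy_def mult.assoc)
  then show ?thesis by (simp add: cm_rt[OF assms] mult.assoc)
qed

text \<open>The ratio between the two factors c_i^- moves out to the left with N_i shifted, and
  c_i^- squares to zero.\<close>

lemma oy_sq:
  assumes "i \<in> {1..M}" "fm i"
  shows "oy i * oy i = 0"
proof (rule lam_cancel)
  have "(qz 1 - qz (-1)) * (oy i * oy i) = rt i * (fps_const (cm i) * (((qz 1 - qz (-1)) * rt i) * fps_const (cm i)))"
    unfolding oy_def mult.assoc lam_left ..
  also have "fps_const (cm i) * (((qz 1 - qz (-1)) * rt i) * fps_const (cm i))
    = oddpart (N i + 2) * (fps_const (cm i) * fps_const (cm i))"
  proof -
    have "cm i * (N i + 1) = (N i + 2) * cm i"
      using cm_N[OF assms(1,1)] by (simp add: distrib_left distrib_right mult_2)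
    from oddpart_intertwine[OF this] show ?thesis
      using assms by (simp add: lam_rt mult.assoc[symmetric] del: fps_const_mult)
  qed
  finally show "(qz 1 - qz (-1)) * (oy i * oy i) = (qz 1 - qz (-1)) * 0"
    using cm_sq[OF assms] by simp
qed

text \<open>Moving c_i^+ across the ratio lowers its argument: c^+ [N+1]/(N+1) c^- = [N]/N times c^+
  c^-, and c^+ c^- = N.\<close>

lemma lam_ox_oy:
  assumes "i \<in> {1..M}"
  shows "(qz 1 - qz (-1)) * (ox i * oy i) = qp (N i) - qp (- N i)"
proof -
  have e: "cp i * (N i + 1) = N i * cp i"
    using cp_N[OF assms assms] by (simp add: distrib_left left_diff_distrib)
  have "(qz 1 - qz (-1)) * (ox i * oy i) = fps_const (cp i) * oddpart (N i + 1) * fps_const (cm i)"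
  proof -
    have "(qz 1 - qz (-1)) * (ox i * oy i) = fps_const (cp i) * (((qz 1 - qz (-1)) * rt i) * fps_const (cm i))"
      unfolding ox_def oy_def mult.assoc lam_left ..
    moreover have "(qz 1 - qz (-1)) * rt i = oddpart (N i + 1)" using assms lam_rt[of i] by simp
    ultimately show ?thesis by (simp only: mult.assoc)
  qed
  also have "\<dots> = oddpart (N i) * fps_const (N i)"
    unfolding oddpart_intertwine[OF e] using assms by (simp add: N_def mult.assoc)
  finally show ?thesis by (simp add: oddpart_mult)
qed

lemma lam_oy_ox:
  assumes "i \<in> {1..M}"
  shows "(qz 1 - qz (-1)) * (oy i * ox i) =
    (if fm i then qp (1 - N i) - qp (N i - 1) else qp (N i + 1) - qp (- N i - 1))"
proof -
  have 1: "(qz 1 - qz (-1)) * (oy i * ox i) = oddpart (N i + 1) * fps_const (cm i * cp i)"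
  proof -
    have "(qz 1 - qz (-1)) * (oy i * ox i) = ((qz 1 - qz (-1)) * rt i) * fps_const (cm i * cp i)"
      by (simp add: ox_def oy_def mult.assoc)
    then show ?thesis using assms lam_rt[of i] by simp
  qed
  show ?thesis
  proof (cases "fm i")
    case False
    have "cm i * cp i = N i + 1" using cm_cp[OF assms assms] False assms by (simp add: N_def add.commute)
    then show ?thesis unfolding 1 using False by (simp add: oddpart_mult)
  next
    case True
    define e where "e = 1 - N i"
    have ce: "cm i * cp i = e" using cm_cp[OF assms assms] True assms by (simp add: N_def e_def)
    have "N i * N i = N i"
      using cm_cp[OF assms assms] cp_sq[OF assms True] True assms
      by (simp add: N_def mult.assoc flip: mult.assoc[of "cm i"])
         (simp add: left_diff_distrib right_diff_distrib mult.assoc flip: mult.assoc[of "cp i" "cp i"])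
    then have "(N i + 1) * e = e * e" "e * (N i + 1) = (N i + 1) * e"
      by (simp_all add: e_def algebra_simps)
    then have "oddpart (N i + 1) * fps_const e = oddpart e * fps_const e"
      by (intro oddpart_eq_right)
    then show ?thesis unfolding 1 ce using True by (simp add: oddpart_mult e_def)
  qed
qed

sublocale Q: qosc M fm qz tor ox oy oP
proof
  show "\<not> fm 0" by simp
  show "i \<le> j \<Longrightarrow> fm i \<Longrightarrow> fm j" for i j by simp
  show "qz 0 = 1" by (rule qz_0)
  show "qz (a + b) = qz a * qz b" for a b by (rule qz_mult)
  show "qz a * z = z * qz a" for a z by (rule qz_central)
  show "(qz 1 - qz (-1)) * z = (qz 1 - qz (-1)) * z' \<Longrightarrow> z = z'" for z z' by (rule lam_cancel)
  show "tor (\<lambda>_. 0) = 1" by (simp add: tor_def nu_zero qp_zero)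
  show "tor u * tor v = tor (\<lambda>k. u k + v k)" for u v
    by (simp add: tor_def qp_add[OF nu_comm] nu_add)
  show "oP * tor u = tor u * oP" for u
    using oP_qp[of "nu u"] nu_N[of 0 u] by (simp add: tor_def)
  show "(qz 1 - qz (- 1)) * oP = tor (\<lambda>k. of_bool (k = 0)) - tor (\<lambda>k. - of_bool (k = 0))"
    unfolding lam_oP tor_def nu_uminus by (simp add: nu_delta)
  fix i assume i: "i \<in> {1..M}"
  then have iM: "i \<le> M" by simp
  show "ox i * tor u = qz (u 0 - u i) * (tor u * ox i)" for u
    unfolding ox_def tor_def qp_intertwine[OF cp_nu[OF i]] tor_const by (simp add: mult.assoc tor_def)
  show "oy i * tor u = qz (u i - u 0) * (tor u * oy i)" for u
    by (rule oy_tor[OF i])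
  show "ox i * ox i = 0" if "fm i" using cp_sq[OF i that] by (simp add: ox_def)
  show "oy i * oy i = 0" if "fm i" using oy_sq[OF i that] .
  show "(qz 1 - qz (- 1)) * (ox i * oy i) = tor (\<lambda>k. of_bool (k = i)) - tor (\<lambda>k. - of_bool (k = i))"
    unfolding lam_ox_oy[OF i] tor_def nu_uminus nu_delta[OF iM] ..
  have z: "qz 1 * qp a = qp (a + 1)" "qz (- 1) * qp a = qp (a - 1)" for a
    by (simp_all add: qz_qp qp_add of_int_comm[of _ 1] add.commute)
  show "(qz 1 - qz (- 1)) * (oy i * ox i) =
      (if fm i then qz 1 * tor (\<lambda>k. - of_bool (k = i)) - qz (- 1) * tor (\<lambda>k. of_bool (k = i))
       else qz 1 * tor (\<lambda>k. of_bool (k = i)) - qz (- 1) * tor (\<lambda>k. - of_bool (k = i)))"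
    unfolding lam_oy_ox[OF i] tor_def nu_uminus nu_delta[OF iM] z by simp
  show "tor (u(i := a)) * ox i = qz (a - u i) * (tor u * ox i)" if f: "fm i" for u a
  proof -
    \<comment> \<open>A Fermi creation operator annihilates from the left what is already occupied;
      commuting it past N_i gives N_i c_i^+ = c_i^+.\<close>
    have "cp i * N i = 0" using cp_sq[OF i f] i by (simp add: N_def flip: mult.assoc)
    then have "N i * cp i = cp i" using cp_N[OF i i] by (simp add: left_diff_distrib)
    then have "nu (u(i := a)) * cp i = (nu u + of_int (a - u i)) * cp i"
      by (simp add: nu_upd[OF iM] distrib_right mult.assoc)
    moreover have "(nu u + of_int (a - u i)) * nu (u(i := a)) = nu (u(i := a)) * (nu u + of_int (a - u i))"
      by (simp only: distrib_left distrib_right nu_comm[of u] of_int_comm)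
    ultimately show ?thesis
      using qp_eq_right[of "nu (u(i := a))" "cp i" "nu u + of_int (a - u i)"]
      unfolding tor_const by (simp add: tor_def ox_def mult.assoc)
  qed
  show "tor (u(i := a)) * oy i = tor u * oy i" if f: "fm i" for u a
  proof -
    have "N i * cm i = 0" using cm_sq[OF i f] i by (simp add: N_def mult.assoc)
    then have "nu (u(i := a)) * cm i = nu u * cm i"
      by (simp add: nu_upd[OF iM] distrib_right mult.assoc)
    from qp_eq_right[OF this nu_comm] have "tor (u(i := a)) * fps_const (cm i) = tor u * fps_const (cm i)"
      by (simp add: tor_def)
    moreover have "tor v * rt i = rt i * tor v" for v
      using i rt_qp[of i "nu v"] nu_N[of i v] by (simp add: tor_def)
    ultimately show ?thesis by (simp add: oy_def flip: mult.assoc) (simp add: mult.assoc)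
  qed
  fix j assume j: "j \<in> {1..M}" and ij: "i \<noteq> j"
  show "ox i * ox j = (if fm i \<and> fm j then - (ox j * ox i) else ox j * ox i)"
    using cp_cp[OF i j] by (simp add: ox_def fps_const_neg[symmetric] del: fps_const_neg)
  show "oy i * oy j = (if fm i \<and> fm j then - (oy j * oy i) else oy j * oy i)"
  proof -
    have "rt j * rt i = rt i * rt j" using i j rt_rt[of i j] N_N[OF i j] by simp
    then have "oy j * oy i = rt i * rt j * fps_const (cm j * cm i)" using oy_oy[OF j i] ij by simp
    then show ?thesis
      using oy_oy[OF i j ij] cm_cm[OF i j]
      by (simp add: fps_const_neg[symmetric] del: fps_const_neg)
  qed
  show "oy i * ox j = (if fm i \<and> fm j then - (ox j * oy i) else ox j * oy i)"
  proof -
    have "ox j * oy i = rt i * fps_const (cp j * cm i)"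
      using cm_rt(2)[OF j i] ij by (simp add: ox_def oy_def flip: mult.assoc) (simp add: mult.assoc)
    moreover have "oy i * ox j = rt i * fps_const (cm i * cp j)"
      by (simp add: ox_def oy_def mult.assoc)
    ultimately show ?thesis using cm_cp[OF i j] ij
      by (simp add: fps_const_neg[symmetric] del: fps_const_neg)
  qed
qed

end

section \<open>The Dyson map on the generators\<close>

text \<open>For \<open>i, j \<ge> 1\<close> the value on \<open>e\<^sub>i\<^sub>j\<close> is forced by the bracket of \<open>a\<^sub>j\<^sup>-\<close> and \<open>a\<^sub>i\<^sup>+\<close>.\<close>

fun dyson_gen :: "nat \<Rightarrow> nat \<Rightarrow> complex \<Rightarrow> ugen \<Rightarrow> wgen free_alg fps" where
  "dyson_gen n m p (Hgen i) = fps_const (const p - (-1) ^ \<theta> n i * Num i - NumTot n m)"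
| "dyson_gen n m p (Egen i j) =
    (if i = 0 then qpow (\<Sum>k=1..<j. Num k) * qnum_ratio (Num j + 1) * qnum (const p - NumTot n m) * gen (Cminus j)
     else if j = 0 then qpow (- (\<Sum>k=1..<i. Num k)) * gen (Cplus i)
     else (if i < j then qpow (\<Sum>k=Suc i..<j. Num k) else qpow (- (\<Sum>k=Suc j..<i. Num k)))
       * (gen (Cplus i) * (qnum_ratio (Num j + 1) * gen (Cminus j))))"

lemma scalars_fps_const: "scalars (\<lambda>c. fps_const (const c) :: 'x free_alg fps)"
proof
  fix c d :: complex and z :: "'x free_alg fps"
  show "fps_const (const (c + d)) = fps_const (const c) + (fps_const (const d) :: 'x free_alg fps)"
    by (simp add: const_def single_add)
  show "fps_const (const (c * d)) = fps_const (const c) * (fps_const (const d) :: 'x free_alg fps)"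
    by (simp add: const_mult)
  show "fps_const (const 1) = (1 :: 'x free_alg fps)"
    by (simp add: const_def flip: zero_list_def)
  show "fps_const (const c) * z = z * fps_const (const c)"
    using scal_commute[of "fps_const c" z] by (simp add: scal_fps_const)
qed

definition dyson_poly :: "nat \<Rightarrow> nat \<Rightarrow> complex \<Rightarrow> ugen free_alg \<Rightarrow> wgen free_alg fps" where
  "dyson_poly n m p = scalars.eval (\<lambda>c. fps_const (const c)) (dyson_gen n m p)"

interpretation dyson: fps_valued_hom "dyson_poly n m p" for n m p
proof -
  interpret scalars "\<lambda>c. fps_const (const c) :: wgen free_alg fps" by (rule scalars_fps_const)
  show "fps_valued_hom (dyson_poly n m p)"
    unfolding dyson_poly_def by unfold_locales (simp_all add: eval_add eval_mult eval_one)
qed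

definition dyson :: "nat \<Rightarrow> nat \<Rightarrow> complex \<Rightarrow> ugen free_alg fps \<Rightarrow> wgen free_alg fps" where
  "dyson n m p = fps_valued_hom.ext (dyson_poly n m p)"

interpretation dyson_ext: unital_hom "dyson n m p" for n m p
  unfolding dyson_def by (rule dyson.unital_hom_ext)

lemma dyson_poly_const: "dyson_poly n m p (const c) = fps_const (const c)"
  unfolding dyson_poly_def by (rule scalars.eval_const[OF scalars_fps_const])

lemma dyson_of_gen: "dyson n m p (gen x) = dyson_gen n m p x"
proof -
  have "dyson n m p (gen x) = dyson_poly n m p (letter x)"
    by (simp add: dyson_def gen_def dyson.ext_const)
  also have "\<dots> = dyson_gen n m p x"
    unfolding dyson_poly_def by (rule scalars.eval_letter[OF scalars_fps_const])
  finally show ?thesis .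
qed

lemma dyson_scal: "dyson n m p (scal s) = scal s"
proof (rule fps_ext)
  fix k
  have "fps_nth (dyson n m p (scal s)) k = (\<Sum>i=0..k. if i = k then const (fps_nth s k) else 0)"
    unfolding dyson_def dyson.ext_nth by (rule sum.cong) (auto simp: scal_def dyson_poly_const)
  then show "fps_nth (dyson n m p (scal s)) k = fps_nth (scal s) k"
    by (simp add: scal_def)
qed

text \<open>The argument has an image free of h, so its powers do not mix h-degrees and the
  exponential is mapped term by term.\<close>

lemma dyson_qpow:
  assumes "dyson_poly n m p a = fps_const b"
  shows "dyson n m p (qpow a) = qpow b"
proof (rule fps_ext)
  fix k
  have "dyson_poly n m p (const c * a ^ i) = fps_const (const c * b ^ i)" for c i
    by (simp add: dyson.hom_mult dyson.hom_power assms dyson_poly_const fps_const_power)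
  then have "fps_nth (dyson n m p (qpow a)) k = (\<Sum>i=0..k. if i = k then const (1 / fact k) * b ^ k else 0)"
    unfolding dyson_def dyson.ext_nth by (intro sum.cong) (auto simp: qpow_def)
  then show "fps_nth (dyson n m p (qpow a)) k = fps_nth (qpow b) k"
    by (simp add: qpow_def)
qed

lemma dyson_cong:
  "(\<And>k. k < K \<Longrightarrow> fps_nth f k = fps_nth g k) \<Longrightarrow> k < K \<Longrightarrow>
    fps_nth (dyson n m p f) k = fps_nth (dyson n m p g) k"
  unfolding dyson_def by (rule dyson.ext_cong)

section \<open>The relations of the quantum superalgebra under the Dyson map\<close>

context oscillator begin

definition Psi :: "ugen free_alg fps \<Rightarrow> 'b fps" where "Psi f = cmap (dyson n m p f)"

sublocale P: unital_hom Psi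
  by unfold_locales
     (simp_all add: Psi_def dyson_ext.hom_add dyson_ext.hom_mult dyson_ext.hom_one c.hom_add c.hom_mult c.hom_one)

lemma cmap_fps_const: "cmap (fps_const a) = fps_const (\<pi> a)"
  by (rule fps_ext) (simp add: hom_zero)

lemma cmap_gen: "cmap (gen x) = fps_const (\<pi> (letter x))"
  unfolding gen_def by (rule cmap_fps_const)

lemma nu_s:
  assumes "i \<le> M" "j \<le> M"
  shows "nu (Q.s i j) = (if i < j then (\<Sum>k=Suc i..<j. N k) else - (\<Sum>k=Suc j..<i. N k))"
proof -
  have "(\<Sum>k=0..M. of_bool (a < k \<and> k < b) * N k) = (\<Sum>k=Suc a..<b. N k)" if "b \<le> M" for a b
    using that by (intro sum.mono_neutral_cong_right) auto
  then show ?thesis using assms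
    by (auto simp: nu_def Q.s_def sum_negf)
qed

text \<open>For \<open>i = 0\<close> the factor [p-N] of the Dyson formula stands after the ratio
  but before it in P y_j; \<open>rt_oP\<close> exchanges them.\<close>

lemma Psi_E:
  assumes "i \<le> M" "j \<le> M" "i \<noteq> j"
  shows "Psi (rv i j) = Q.E i j"
proof -
  have num: "\<pi> (\<Sum>k=Suc a..<b. Num k) = (\<Sum>k=Suc a..<b. N k)" for a b
    by (simp add: hom_sum pi_Num)
  have 1: "cmap (qpow (if i < j then (\<Sum>k=Suc i..<j. Num k) else - (\<Sum>k=Suc j..<i. Num k))) = tor (Q.s i j)"
    unfolding tor_def nu_s[OF assms(1,2)] cmap_qpow by (simp add: hom_uminus num)
  have g: "cmap (gen (Cplus k)) = ox k" "cmap (gen (Cminus k)) = fps_const (cm k)" for k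
    by (simp_all add: cmap_gen ox_def cp_def cm_def)
  have r: "cmap (qnum_ratio (Num k + 1)) = rt k" for k by (simp add: rt_def)
  consider "i = 0" | "i \<noteq> 0" "j = 0" | "i \<noteq> 0" "j \<noteq> 0" by blast
  then show ?thesis
  proof cases
    case 1
    then have "j \<in> {1..M}" using assms by auto
    have "Psi (rv i j) = tor (Q.s i j) * rt j * oP * fps_const (cm j)"
      using 1 assms \<open>cmap _ = tor (Q.s i j)\<close> by (simp add: Psi_def dyson_of_gen c.hom_mult g r oP_def)
    then show ?thesis
      using 1 rt_oP[OF \<open>j \<in> _\<close>] by (simp add: Q.E_def Q.B_def oy_def mult.assoc)
  next
    case 2
    then show ?thesis using assms 1
      by (simp add: Psi_def dyson_of_gen c.hom_mult g Q.E_def Q.B_def)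
  next
    case 3
    then show ?thesis using assms 1
      by (cases "i < j") (simp_all add: Psi_def dyson_of_gen c.hom_mult g r Q.E_def Q.B_def oy_def)
  qed
qed

text \<open>The coefficients of N_0, ..., N_M in the image N_0 - (-1)^\<theta> N_i of H_i. The
  vector vanishes for \<open>i = 0\<close>, in accordance with L_0 = 1.\<close>

definition wH where "wH i = (\<lambda>k. Q.d 0 k - Q.sg i * Q.d i k)"

lemma sg_theta: "(-1) ^ \<theta> n i = (of_int (Q.sg i) :: 'c::ring_1)"
  by (simp add: \<theta>_def Q.sg_def)

lemma pi_H: "1 \<le> i \<Longrightarrow> i \<le> M \<Longrightarrow> \<pi> (const p - (-1) ^ \<theta> n i * Num i - NumTot n m) = nu (wH i)"
proof -
  assume i: "1 \<le> i" "i \<le> M"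
  have "nu (wH i) = nu (Q.d 0) - of_int (Q.sg i) * nu (Q.d i)"
    by (simp add: nu_def wH_def left_diff_distrib sum_subtractf sum_distrib_left mult.assoc)
  moreover have "nu (Q.d k) = N k" if "k \<le> M" for k
    using nu_delta[OF that] by (simp add: Q.d_def[abs_def])
  ultimately have "nu (wH i) = N 0 - of_int (Q.sg i) * N i" using i by simp
  then show ?thesis
    using i pi_N0 by (simp add: sg_theta hom_diff hom_mult hom_of_int pi_Num)
qed

lemma Psi_H: "1 \<le> i \<Longrightarrow> i \<le> M \<Longrightarrow> Psi (gen (Hgen i)) = fps_const (nu (wH i))"
  by (simp add: Psi_def dyson_of_gen cmap_fps_const pi_H)

lemma dyson_poly_letter: "dyson_poly n m p (letter x) = dyson_gen n m p x"
  using dyson_of_gen[of n m p x] unfolding gen_def dyson_def dyson.ext_const .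

lemma Psi_Lq:
  assumes "i \<le> M"
  shows "Psi (Lq i z) = tor (\<lambda>k. z * wH i k)"
proof (cases "i = 0")
  case True
  then have "(\<lambda>k. z * wH i k) = (\<lambda>_. 0)" by (auto simp: wH_def Q.d_def Q.sg_def)
  then show ?thesis using True by (simp add: Lq_def P.hom_one Q.T_0)
next
  case False
  have "dyson_poly n m p (of_int z * letter (Hgen i))
    = fps_const (of_int z * (const p - (-1) ^ \<theta> n i * Num i - NumTot n m))"
    unfolding dyson.hom_mult dyson.hom_of_int dyson_poly_letter by (simp add: fps_of_int[symmetric])
  then have "Psi (Lq i z) = qp (\<pi> (of_int z * (const p - (-1) ^ \<theta> n i * Num i - NumTot n m)))"
    using False by (simp add: Lq_def Psi_def dyson_qpow cmap_qpow)
  also have "\<dots> = qp (of_int z * nu (wH i))"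
    using False assms by (simp add: hom_mult hom_of_int pi_H del: hom_diff)
  also have "of_int z * nu (wH i) = nu (\<lambda>k. z * wH i k)"
    by (simp add: nu_def sum_distrib_left mult.assoc)
  finally show ?thesis by (simp add: tor_def)
qed

lemma Psi_scal: "Psi (scal s) = cmap (scal s)"
  by (simp add: Psi_def dyson_scal)

lemma Psi_qz: "Psi (scal (fps_exp (of_int a))) = qz a"
  by (simp add: Psi_scal qz_def)

lemma Psi_lam: "Psi (scal qdiff) = Q.lam"
  by (simp add: Psi_scal Q.lam_def lam_qdiff)

lemma Psi_bracket:
  assumes "i \<le> M" "j \<le> M" "k \<le> M" "l \<le> M" "i \<noteq> j" "k \<noteq> l"
  shows "Psi (sbracket (udeg n) (fps_exp (of_int a)) (Egen i j) (Egen k l))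
    = Q.E i j * Q.E k l - Q.sgn2 i j k l * (qz a * (Q.E k l * Q.E i j))"
proof -
  have "(-1) ^ (udeg n (Egen i j) * udeg n (Egen k l)) = (Q.sgn2 i j k l :: 'b fps)"
    by (simp add: \<theta>2_def \<theta>_def Q.sgn2_def)
  then show ?thesis
    using assms
    by (simp add: sbracket_def P.hom_diff P.hom_mult P.hom_power P.hom_uminus P.hom_one Psi_qz Psi_E mult.assoc
        del: udeg.simps)
qed

text \<open>The additive counterpart of \<open>Q.B_T\<close>, needed for the brackets with H_i. It
  is proved on the concrete operators because the locale \<open>qosc\<close> speaks of powers of q
  only.\<close>

lemma E_nu:
  assumes "j \<le> M" "k \<le> M" "j \<noteq> k"
  shows "Q.E j k * fps_const (nu u) = (fps_const (nu u) + of_int (u k - u j)) * Q.E j k"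
proof -
  have shift: "fps_const (a + of_int c) = fps_const a + (of_int c :: 'b fps)" for a c
    by (simp flip: fps_const_add add: fps_of_int)
  have x: "ox i * fps_const (nu u) = (fps_const (nu u) + of_int (u 0 - u i)) * ox i" if "i \<in> {1..M}" for i
    by (simp only: ox_def fps_const_mult cp_nu[OF that] shift[symmetric])
  have y: "oy i * fps_const (nu u) = (fps_const (nu u) + of_int (u i - u 0)) * oy i" if "i \<in> {1..M}" for i
  proof -
    have "oy i * fps_const (nu u) = (rt i * fps_const (nu u + of_int (u i - u 0))) * fps_const (cm i)"
      using cm_nu[OF that, of u] by (simp add: oy_def mult.assoc)
    also have "rt i * fps_const (nu u + of_int (u i - u 0)) = fps_const (nu u + of_int (u i - u 0)) * rt i"
      using that nu_N[of i u]
      by (intro rt_const[symmetric]) (auto simp: distrib_left distrib_right of_int_comm[of "N i"] simp del: of_int_diff)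
    finally show ?thesis by (simp only: oy_def shift mult.assoc)
  qed
  have Pc: "oP * fps_const (nu u) = fps_const (nu u) * oP"
  proof -
    have "fps_const (nu u) * (qp (N 0) - qp (- N 0)) = (qp (N 0) - qp (- N 0)) * fps_const (nu u)"
      using qp_intertwine[of "nu u" "N 0" "N 0"] qp_intertwine[of "nu u" "- N 0" "- N 0"] nu_N[of 0 u]
      by (simp add: left_diff_distrib right_diff_distrib)
    from lam_transfer[OF lam_oP lam_oP this] show ?thesis ..
  qed
  have Tc: "tor v * fps_const (nu u) = fps_const (nu u) * tor v" for v
    unfolding tor_def by (rule qp_intertwine[symmetric]) (rule nu_comm)
  have of_int_fps: "(z :: 'b fps) * of_int c = of_int c * z" for z c
    by (metis mult_of_int_commute)
  have B: "Q.B j k * fps_const (nu u) = (fps_const (nu u) + of_int (u k - u j)) * Q.B j k"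
  proof -
    consider "j = 0" | "j \<noteq> 0" "k = 0" | "j \<noteq> 0" "k \<noteq> 0" by blast
    then show ?thesis
    proof cases
      case 1
      have "oP * oy k * fps_const (nu u) = (oP * fps_const (nu u) + oP * of_int (u k - u 0)) * oy k"
        using 1 assms y[of k] by (simp add: mult.assoc distrib_left distrib_right del: of_int_diff)
      then show ?thesis using 1
        by (simp add: Q.B_def Pc of_int_fps[of oP] distrib_right mult.assoc del: of_int_diff)
    next
      case 2
      then show ?thesis using assms x[of j] by (simp add: Q.B_def)
    next
      case 3
      have "ox j * oy k * fps_const (nu u) = (ox j * fps_const (nu u) + ox j * of_int (u k - u 0)) * oy k"
        using 3 assms y[of k] by (simp add: mult.assoc distrib_left distrib_right del: of_int_diff)
      also have "ox j * fps_const (nu u) + ox j * of_int (u k - u 0) = (fps_const (nu u) + of_int (u k - u j)) * ox j"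
        using 3 assms x[of j] unfolding of_int_fps[of "ox j"] by (simp add: distrib_right left_diff_distrib)
      finally show ?thesis using 3 by (simp add: Q.B_def mult.assoc)
    qed
  qed
  have "Q.E j k * fps_const (nu u) = (tor (Q.s j k) * fps_const (nu u) + tor (Q.s j k) * of_int (u k - u j)) * Q.B j k"
    by (simp add: Q.E_def mult.assoc B distrib_left distrib_right del: of_int_diff)
  then show ?thesis
    by (simp add: Q.E_def Tc of_int_fps[of "tor _"] distrib_right mult.assoc del: of_int_diff)
qed

end

context oscillator begin

text \<open>When the indicator \<open>b\<close> is false the indices may coincide, and such a letter
  is no root vector. Hence the side conditions are required only under \<open>b\<close>.\<close>

lemma Psi_lam_term:
  assumes "b \<Longrightarrow> i \<le> M \<and> j \<le> M \<and> i \<noteq> j \<and> k \<le> M \<and> l \<le> M \<and> k \<noteq> l"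
  shows "Psi (scal qdiff * (-1) ^ \<theta> n t * of_bool b * rv i j * rv k l)
      = Q.lam * (of_int (Q.sg t) * (of_bool b * (Q.E i j * Q.E k l)))"
    and "Psi (scal qdiff * of_bool b * (-1) ^ \<theta> n t * rv i j * rv k l)
      = Q.lam * (of_bool b * (of_int (Q.sg t) * (Q.E i j * Q.E k l)))"
proof -
  show "Psi (scal qdiff * (-1) ^ \<theta> n t * of_bool b * rv i j * rv k l)
      = Q.lam * (of_int (Q.sg t) * (of_bool b * (Q.E i j * Q.E k l)))"
    unfolding sg_theta P.hom_mult P.hom_of_int P.hom_of_bool Psi_lam mult.assoc
    using assms by (cases b) (simp_all add: Psi_E)
  show "Psi (scal qdiff * of_bool b * (-1) ^ \<theta> n t * rv i j * rv k l)
      = Q.lam * (of_bool b * (of_int (Q.sg t) * (Q.E i j * Q.E k l)))"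
    unfolding sg_theta P.hom_mult P.hom_of_int P.hom_of_bool Psi_lam mult.assoc
    using assms by (cases b) (simp_all add: Psi_E)
qed

lemma Psi_of_bool_mult: "(b \<Longrightarrow> Psi f = g) \<Longrightarrow> Psi (of_bool b * f) = of_bool b * g"
  by (cases b) (auto simp: P.hom_zero)

lemma Psi_sgn1: "Psi ((-1) ^ \<theta>2 n i j * f) = Q.sgn1 i j * Psi f"
  by (simp add: \<theta>2_def \<theta>_def Q.sgn1_def P.hom_uminus)

lemma Psi_LL: "i \<le> M \<Longrightarrow> k \<le> M \<Longrightarrow> Psi (Lq i 1 * Lq k (-1)) = tor (Q.V i k)"
proof -
  assume "i \<le> M" "k \<le> M"
  then have "Psi (Lq i 1 * Lq k (-1)) = tor (\<lambda>m. 1 * wH i m + (-1) * wH k m)"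
    by (simp add: P.hom_mult Psi_Lq Q.T_add)
  also have "(\<lambda>m. 1 * wH i m + (-1) * wH k m) = Q.V i k"
    by (auto simp: wH_def Q.V_def)
  finally show ?thesis .
qed

lemma Lq_0: "fps_nth (Lq i z) 0 = 1"
  by (simp add: Lq_def qpow_def const_def flip: zero_list_def)

lemma Psi_opposite:
  assumes "i < j" "j \<le> M"
  shows "Psi (over_qdiff (Lq j ((-1) ^ \<theta> n i) * Lq i (- ((-1) ^ \<theta> n i))
      - Lq j (- ((-1) ^ \<theta> n i)) * Lq i ((-1) ^ \<theta> n i)))
    = Q.E i j * Q.E j i - Q.sgn2 i j j i * (Q.E j i * Q.E i j)" (is "Psi (over_qdiff ?z) = _")
proof (rule lam_cancel)
  have t: "(-1) ^ \<theta> n i = Q.sg i" using sg_theta[of i, where 'c=int] by simp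
  have sq: "Q.sg i * (Q.sg i * a) = a" for a by (simp add: Q.sg_def)
  have w: "(\<lambda>k. Q.sg i * wH j k + - Q.sg i * wH i k) = (\<lambda>m. Q.d i m - Q.sg i * Q.sg j * Q.d j m)"
    "(\<lambda>k. - Q.sg i * wH j k + Q.sg i * wH i k) = (\<lambda>m. Q.sg i * Q.sg j * Q.d j m - Q.d i m)"
    by (auto simp: wH_def fun_eq_iff right_diff_distrib sq mult.assoc)
  have "Q.lam * Psi (over_qdiff ?z) = Psi ?z"
    \<comment> \<open>Every L has constant term 1, so the difference has constant term 0 and the
      division by q - q^(-1) is genuine.\<close>
    unfolding Psi_lam[symmetric] P.hom_mult[symmetric] by (rule arg_cong[OF over_qdiff]) (simp add: Lq_0)
  also have "\<dots> = Q.lam * (Q.E i j * Q.E j i - Q.sgn2 i j j i * (Q.E j i * Q.E i j))"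
    unfolding Q.lam_E_opposite[OF assms] t using assms
    by (simp add: P.hom_diff P.hom_mult Psi_Lq Q.T_add w[simplified])
  finally show "(qz 1 - qz (- 1)) * Psi (over_qdiff ?z) =
    (qz 1 - qz (- 1)) * (Q.E i j * Q.E j i - Q.sgn2 i j j i * (Q.E j i * Q.E i j))"
    unfolding Q.lam_def .
qed

theorem Psi_rel:
  assumes "U_rel n m l r"
  shows "Psi l = Psi r"
  using assms
proof cases
  case (HH i j)
  have "fps_const (nu (wH i)) * fps_const (nu (wH j)) = fps_const (nu (wH j)) * fps_const (nu (wH i))"
    by (simp add: nu_comm[of "wH i"])
  then show ?thesis using HH by (simp add: P.hom_diff P.hom_mult P.hom_zero Psi_H)
next
  case (HE i j k)
  then have r: "j \<le> M" "k \<le> M" "j \<noteq> k" by (auto simp: is_root_def)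
  have "(of_bool (0 = j) - of_bool (0 = k) - (-1) ^ \<theta> n i * (of_bool (i = j) - of_bool (i = k)) :: int)
      = wH i j - wH i k"
    using sg_theta[of i, where 'c=int] by (auto simp: wH_def Q.d_def)
  then have "Psi r = of_int (wH i j - wH i k) * Q.E j k"
    unfolding HE(2) P.hom_mult P.hom_of_int Psi_E[OF r] by simp
  moreover have "Psi l = of_int (wH i j - wH i k) * Q.E j k"
    unfolding HE(1) P.hom_mult P.hom_diff Psi_E[OF r] using HE(3)
    by (simp add: Psi_H E_nu[OF r] distrib_right left_diff_distrib)
  ultimately show ?thesis by simp
next
  case (sq i j)
  then have r: "i \<le> M" "j \<le> M" "i \<noteq> j" by (auto simp: is_root_def)
  have "fm i \<noteq> fm j" using sq by (auto simp: \<theta>2_def \<theta>_def split: if_splits)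
  then show ?thesis
    using sq Q.E_sq[OF r(1,2)] by (simp add: power2_eq_square P.hom_mult P.hom_zero Psi_E[OF r])
next
  case (pos i j k l)
  then have a: "i < j" "k < l" "j \<le> M" "l \<le> M" "i < k \<or> i = k \<and> j < l"
    by (auto simp: pos_root_def is_root_def root_less_def)
  have t: "(-1) ^ \<theta> n x = Q.sg x" for x using sg_theta[of x, where 'c=int] by simp
  have "Psi (of_bool (j = k) * rv i l) = of_bool (j = k) * Q.E i l"
    using a by (intro Psi_of_bool_mult Psi_E) auto
  moreover have "Psi (scal qdiff * (-1) ^ \<theta> n k * of_bool (l > j \<and> j > k \<and> k > i) * rv k j * rv i l)
      = Q.lam * (of_int (Q.sg k) * (of_bool (l > j \<and> j > k \<and> k > i) * (Q.E k j * Q.E i l)))"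
    using a by (intro Psi_lam_term) auto
  ultimately show ?thesis
    unfolding pos(1,2) P.hom_add
    using a Q.E_pos[of i j k l] by (subst Psi_bracket) (simp_all add: t)
next
  case (neg i j k l)
  then have a: "i > j" "k > l" "i \<le> M" "k \<le> M" "k < i \<or> k = i \<and> l < j"
    by (auto simp: neg_root_def is_root_def root_less_def)
  have t: "(-1) ^ \<theta> n x = Q.sg x" for x using sg_theta[of x, where 'c=int] by simp
  have "Psi (of_bool (j = k) * rv i l) = of_bool (j = k) * Q.E i l"
    using a by (intro Psi_of_bool_mult Psi_E) auto
  moreover have "Psi (scal qdiff * (-1) ^ \<theta> n k * of_bool (i > k \<and> k > j \<and> j > l) * rv k j * rv i l)
      = Q.lam * (of_int (Q.sg k) * (of_bool (i > k \<and> k > j \<and> j > l) * (Q.E k j * Q.E i l)))"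
    using a by (intro Psi_lam_term) auto
  ultimately show ?thesis
    unfolding neg(1,2) P.hom_diff
    using a Q.E_neg[of j i l k] by (subst Psi_bracket) (simp_all add: t)
next
  case (mixed i j k l)
  then have a: "i < j" "l < k" "i \<le> M" "j \<le> M" "l \<le> M" "k \<le> M"
    by (auto simp: pos_root_def neg_root_def is_root_def)
  have lhs: "Psi l' = Q.E i j * Q.E k l - Q.sgn2 i j k l * (Q.E k l * Q.E i j)"
    if "l' = sbracket (udeg n) 1 (Egen i j) (Egen k l)" for l'
    using Psi_bracket[of i j k l 0] a that by (simp add: Q.qz_0)
  show ?thesis
  proof (cases "i = l \<and> j = k")
    case True
    then show ?thesis
      unfolding lhs[OF mixed(1)] unfolding mixed(2) using a Psi_opposite[of i j] by simp
  next
    case False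
    have 1: "Psi (scal qdiff * of_bool (j > k \<and> k > i \<and> i > l) * (-1) ^ \<theta> n k * rv k j * rv i l)
        = Q.lam * (of_bool (j > k \<and> k > i \<and> i > l) * (of_int (Q.sg k) * (Q.E k j * Q.E i l)))"
      using a by (intro Psi_lam_term) auto
    have 2: "Psi (of_bool (i = l) * of_bool (j > k) * (-1) ^ \<theta>2 n k l * rv k j)
        = of_bool (i = l) * (of_bool (j > k) * (Q.sgn1 k l * Q.E k j))"
      using a unfolding mult.assoc
      by (intro Psi_of_bool_mult) (simp add: Psi_sgn1 Psi_E)
    have 3: "Psi (of_bool (j = k) * of_bool (i > l) * rv i l) = of_bool (j = k) * (of_bool (i > l) * Q.E i l)"
      using a unfolding mult.assoc by (intro Psi_of_bool_mult) (simp add: Psi_E)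
    have 4: "Psi (- scal qdiff * of_bool (k > j \<and> j > l \<and> l > i) * (-1) ^ \<theta> n j * rv i l * rv k j)
        = - (Q.lam * (of_bool (k > j \<and> j > l \<and> l > i) * (of_int (Q.sg j) * (Q.E i l * Q.E k j))))"
      unfolding mult_minus_left P.hom_uminus using a by (intro arg_cong[of _ _ uminus] Psi_lam_term) auto
    have 5: "Psi (of_bool (i = l) * of_bool (k > j) * (-1) ^ \<theta>2 n i j * rv k j)
        = of_bool (i = l) * (of_bool (k > j) * (Q.sgn1 i j * Q.E k j))"
      using a unfolding mult.assoc
      by (intro Psi_of_bool_mult) (simp add: Psi_sgn1 Psi_E)
    have 6: "Psi (of_bool (j = k) * of_bool (l > i) * rv i l) = of_bool (j = k) * (of_bool (l > i) * Q.E i l)"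
      using a unfolding mult.assoc by (intro Psi_of_bool_mult) (simp add: Psi_E)
    \<comment> \<open>For roots that are not opposite the torus term has indicator 0, so its image
      need not be computed.\<close>
    have 0: "of_bool (i = l) * of_bool (j = k) * z = (0 :: ugen free_alg fps)" for z
      using False by auto
    have "Psi (A * Lq i 1 * Lq k (- 1)) = Psi A * tor (Q.V i k)" for A
      using Psi_LL[of i k] a by (simp add: P.hom_mult mult.assoc)
    moreover have "Psi (Lq j 1 * Lq l (- 1) * A) = tor (Q.V j l) * Psi A" for A
      using Psi_LL[of j l] a by (simp add: P.hom_mult)
    moreover have "i \<noteq> l \<or> j \<noteq> k" using False by simp
    ultimately show ?thesis
      unfolding lhs[OF mixed(1)] mixed(2) 0 P.hom_add P.hom_zero
      using Q.E_mixed[OF a(1,2,4,6)]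
      by (simp only: P.hom_add P.hom_diff 1 2 3 4 5 6 add_0_left)
  qed
qed

end

section \<open>The homomorphism and its uniqueness\<close>

lemma W_rel_const: "W_rel n m l r \<Longrightarrow> \<exists>a. l - r = fps_const a \<and> l = fps_const (fps_nth l 0) \<and> r = fps_const (fps_nth r 0)"
proof -
  assume "W_rel n m l r"
  moreover have "\<exists>c. sbracket (wdeg n) 1 a b = fps_const c" for a b
  proof
    have "(-1 :: wgen free_alg fps) ^ k = fps_const ((-1) ^ k)" for k
      by (simp add: minus_one_power_iff fps_const_neg[symmetric] del: fps_const_neg)
    then show "sbracket (wdeg n) 1 a b = fps_const (letter a * letter b - (-1) ^ (wdeg n a * wdeg n b) * letter b * letter a)"
      by (simp add: sbracket_def scal_one gen_def)
  qed
  moreover have "\<exists>c. (of_bool \<beta> :: wgen free_alg fps) = fps_const c" for \<beta>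
    by (cases \<beta>) (auto intro: exI[of _ 1] exI[of _ 0])
  moreover have "\<exists>c. (0 :: wgen free_alg fps) = fps_const c" by (rule exI[of _ 0]) simp
  ultimately have "(\<exists>c. l = fps_const c) \<and> (\<exists>c. r = fps_const c)"
    by cases metis+
  then show ?thesis by auto
qed

lemma scalars_const: "scalars (const :: complex \<Rightarrow> 'x free_alg)"
proof
  show "const (c * d) = (const c * const d :: 'x free_alg)" for c d by (rule const_mult[symmetric])
  show "const c * z = z * const c" for c and z :: "'x free_alg" by (rule const_commute)
qed (simp_all add: const_def single_add flip: zero_list_def)

section \<open>Passage from the quotient over the complex numbers to the closed ideals\<close>

lemma presentation_W: "presentation (W_gens n m) (W_rel n m)"
proof
  have g: "i \<in> {1..n+m} \<Longrightarrow> gen (Cplus i) \<in> fr (W_gens n m)" "i \<in> {1..n+m} \<Longrightarrow> gen (Cminus i) \<in> fr (W_gens n m)" for i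
    by (auto simp: W_gens_def intro!: fr_gen)
  show "l \<in> fr (W_gens n m)" if "W_rel n m l r" for l r
    using that by cases (simp_all add: sbracket_def fr_closed g)
  show "r \<in> fr (W_gens n m)" if "W_rel n m l r" for l r
    using that by cases (simp_all add: fr_closed)
qed

lemma Lq_in_fr: "i \<le> n + m \<Longrightarrow> Lq i z \<in> fr (U_gens n m)"
proof -
  assume i: "i \<le> n + m"
  have "Poly_Mapping.keys (of_int z * letter (Hgen i)) \<subseteq> lists (U_gens n m)" if "i \<noteq> 0"
  proof -
    have "fps_const (of_int z * letter (Hgen i)) = (of_int z * gen (Hgen i) :: ugen free_alg fps)"
      by (simp add: gen_def fps_of_int[symmetric])
    also have "\<dots> \<in> fr (U_gens n m)"
      using i that by (intro fr_closed) (auto simp: U_gens_def)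
    finally have "fps_const (of_int z * letter (Hgen i)) \<in> fr (U_gens n m)" .
    from this[unfolded fr_iff, rule_format, of 0] show ?thesis by simp
  qed
  then show ?thesis by (auto simp: Lq_def fr_one intro: fr_qpow)
qed

text \<open>The right-hand sides may mention letters that are not generators, such as e_ii, under a
  false indicator. The auxiliary facts therefore ask for roots only when the indicators
  hold.\<close>

lemma presentation_U: "presentation (U_gens n m) (U_rel n m)"
proof
  have H: "i \<in> {1..n+m} \<Longrightarrow> gen (Hgen i) \<in> fr (U_gens n m)" for i
    by (auto simp: U_gens_def intro!: fr_gen)
  have E: "i \<le> n + m \<Longrightarrow> j \<le> n + m \<Longrightarrow> i \<noteq> j \<Longrightarrow> rv i j \<in> fr (U_gens n m)" for i j
    by (auto simp: U_gens_def intro!: fr_gen)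
  have b: "(\<beta> \<Longrightarrow> f \<in> fr (U_gens n m)) \<Longrightarrow> of_bool \<beta> * f \<in> fr (U_gens n m)" for \<beta> f
    by (cases \<beta>) (auto simp: fr_zero)
  note cl = fr_zero fr_one fr_add fr_mult fr_uminus fr_diff fr_power fr_of_int fr_scal H E
  have L: "Lq i z \<in> fr (U_gens n m)" if "i \<in> {0..n+m}" for i z
    using that by (simp add: Lq_in_fr)
  have T1: "scal s * of_bool \<beta> * (-1) ^ t * rv a b * rv c d \<in> fr (U_gens n m)"
    and T1': "scal s * (-1) ^ t * of_bool \<beta> * rv a b * rv c d \<in> fr (U_gens n m)"
    and T1'': "- scal s * of_bool \<beta> * (-1) ^ t * rv a b * rv c d \<in> fr (U_gens n m)"
    if "\<beta> \<Longrightarrow> is_root n m a b \<and> is_root n m c d" for \<beta> t a b c d s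
    using that by (cases \<beta>; simp add: is_root_def cl)+
  have T2: "of_bool \<alpha> * of_bool \<beta> * (-1) ^ t * rv a b \<in> fr (U_gens n m)"
    and T3: "of_bool \<alpha> * of_bool \<beta> * rv a b \<in> fr (U_gens n m)"
    if "\<alpha> \<Longrightarrow> \<beta> \<Longrightarrow> is_root n m a b" for \<alpha> \<beta> t a b
    using that by (cases \<alpha>; cases \<beta>; simp add: is_root_def cl)+
  have T3': "of_bool \<alpha> * rv a b \<in> fr (U_gens n m)" if "\<alpha> \<Longrightarrow> is_root n m a b" for \<alpha> a b
    using that by (cases \<alpha>) (simp_all add: is_root_def cl)
  show "l \<in> fr (U_gens n m)" if "U_rel n m l r" for l r
    using that
    by cases (simp_all add: sbracket_def is_root_def pos_root_def neg_root_def power2_eq_square cl)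
  show "r \<in> fr (U_gens n m)" if "U_rel n m l r" for l r
    using that
  proof cases
    case (mixed i j k l)
    show ?thesis
      unfolding mixed(2)
      by (rule fr_add[OF fr_add[OF fr_mult[OF fr_mult[OF fr_of_bool fr_of_bool] fr_over_qdiff[OF
            fr_diff[OF fr_mult[OF L L] fr_mult[OF L L]]]]
          fr_mult[OF fr_mult[OF fr_add[OF fr_diff[OF T1 T2] T3] L] L]]
          fr_mult[OF fr_mult[OF L L] fr_add[OF fr_diff[OF T1'' T2] T3]]])
         (use mixed in \<open>auto simp: is_root_def pos_root_def neg_root_def\<close>)
  next
    case (pos i j k l)
    show ?thesis
      unfolding pos(2)
      by (rule fr_add[OF T3' T1'])
         (use pos in \<open>auto simp: is_root_def pos_root_def neg_root_def root_less_def\<close>)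
  next
    case (neg i j k l)
    show ?thesis
      unfolding neg(2)
      by (rule fr_diff[OF T3' T1'])
         (use neg in \<open>auto simp: is_root_def pos_root_def neg_root_def root_less_def\<close>)
  next
    case (HE i j k)
    then show ?thesis by (simp add: cl is_root_def)
  qed (simp_all add: fr_zero)
qed

text \<open>The letters outside \<open>W_gens n m\<close> stay free in the quotient; mapping them to \<open>0\<close> brings the ideal
  back to \<open>W_gens n m\<close>.\<close>

inductive_set osc_ideal :: "nat \<Rightarrow> nat \<Rightarrow> wgen free_alg set" for n m where
  zero: "0 \<in> osc_ideal n m"
| rel: "W_rel n m l r \<Longrightarrow> fps_nth (l - r) 0 \<in> osc_ideal n m"
| add: "a \<in> osc_ideal n m \<Longrightarrow> b \<in> osc_ideal n m \<Longrightarrow> a + b \<in> osc_ideal n m"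
| mult: "a \<in> osc_ideal n m \<Longrightarrow> x * a * y \<in> osc_ideal n m"

definition restrict_letters :: "'x set \<Rightarrow> 'x free_alg \<Rightarrow> 'x free_alg" where
  "restrict_letters X = scalars.eval const (\<lambda>x. if x \<in> X then letter x else 0)"

lemma restrict_letters_hom:
  fixes X :: "'x set"
  shows "unital_hom (restrict_letters X)"
proof -
  interpret scalars "const :: complex \<Rightarrow> 'x free_alg" by (rule scalars_const)
  show ?thesis unfolding restrict_letters_def
    by unfold_locales (rule eval_add eval_mult eval_one)+
qed

lemma keys_restrict_letters:
  fixes X :: "'x set"
  shows "Poly_Mapping.keys (restrict_letters X a) \<subseteq> lists X"
proof -
  interpret scalars "const :: complex \<Rightarrow> 'x free_alg" by (rule scalars_const)
  have "Poly_Mapping.keys (prod_list (map (\<lambda>x. if x \<in> X then letter x else 0) w)) \<subseteq> lists X" for w :: "'x list"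
    by (induction w) (simp_all add: keys_mult_lists keys_letter_lists zero_list_def)
  then show ?thesis
    unfolding restrict_letters_def eval_def
    by (intro keys_sum_lists keys_mult_lists keys_const_lists)
qed

lemma restrict_letters_id:
  fixes X :: "'x set"
  assumes "Poly_Mapping.keys a \<subseteq> lists X" shows "restrict_letters X a = a"
proof -
  interpret scalars "const :: complex \<Rightarrow> 'x free_alg" by (rule scalars_const)
  have w: "prod_list (map (\<lambda>x. if x \<in> X then letter x else 0) w) = Poly_Mapping.single w 1" if "w \<in> lists X" for w :: "'x list"
    using that
  proof (induction w)
    case Nil
    have "Poly_Mapping.single [] 1 = (1 :: 'x free_alg)" by (metis single_one zero_list_def)
    then show ?case by simp
  qed (simp add: letter_def mult_single plus_list_def)
  have "restrict_letters X a = (\<Sum>w\<in>Poly_Mapping.keys a. Poly_Mapping.single w (Poly_Mapping.lookup a w))"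
    unfolding restrict_letters_def eval_def
    by (rule sum.cong) (use assms in \<open>auto simp: w[OF subsetD] const_def mult_single plus_list_def simp del: in_lists_conv_set\<close>)
  then show ?thesis by (simp add: sum_monomials)
qed

text \<open>The relations use generators only and are fixed by the restriction, while the arbitrary
  cofactors of the ideal are mapped into the free ring on the generators.\<close>

lemma osc_ideal_restrict:
  assumes "a \<in> osc_ideal n m"
  shows "fps_const (restrict_letters (W_gens n m) a) \<in> rel_idl (W_gens n m) (W_rel n m)"
proof -
  interpret presentation "W_gens n m" "W_rel n m" by (rule presentation_W)
  interpret r: unital_hom "restrict_letters (W_gens n m)" by (rule restrict_letters_hom)
  show ?thesis
    using assms
  proof induction
    case zero
    then show ?case by (simp add: r.hom_zero I_zero)
  next
    case (rel l r)
    have "l - r \<in> fr (W_gens n m)" using rel_carrier[OF rel] by (intro fr_diff)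
    then have "restrict_letters (W_gens n m) (fps_nth (l - r) 0) = fps_nth (l - r) 0"
      unfolding fr_iff by (intro restrict_letters_id) blast
    moreover have "fps_const (fps_nth (l - r) 0) = l - r"
      using W_rel_const[OF rel] by (metis fps_nth_fps_const)
    ultimately show ?case using rel_in_I[OF rel] by simp
  next
    case (add a b)
    then show ?case using I_add by (simp add: r.hom_add flip: fps_const_add)
  next
    case (mult a x y)
    then show ?case
      unfolding r.hom_mult fps_const_mult[symmetric]
      by (intro I_left I_right fr_const keys_restrict_letters)
  qed
qed

definition dyson_respects :: "nat \<Rightarrow> nat \<Rightarrow> bool" where
  "dyson_respects n m \<longleftrightarrow>
    (\<forall>p l r. U_rel n m l r \<longrightarrow> dyson n m p l - dyson n m p r \<in> rel_idl (W_gens n m) (W_rel n m))"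

text \<open>A type cannot depend on \<open>n\<close> and \<open>m\<close>. To compute in the quotient as a type all the same, we
  form it for one pair that is a counterexample if there is any; an ideal containing \<open>1\<close> is
  replaced by \<open>0\<close> to keep the type an instance of \<^class>\<open>ring_1\<close>.\<close>

definition crit :: "nat \<times> nat" where "crit = (SOME nm. \<not> dyson_respects (fst nm) (snd nm))"

definition crit_ideal :: "wgen free_alg set" where
  "crit_ideal = (let I = osc_ideal (fst crit) (snd crit) in if 1 \<in> I then {0} else I)"

lemma crit_ideal_add: "a \<in> crit_ideal \<Longrightarrow> b \<in> crit_ideal \<Longrightarrow> a + b \<in> crit_ideal"
  and crit_ideal_mult: "a \<in> crit_ideal \<Longrightarrow> x * a * y \<in> crit_ideal"
  and crit_ideal_zero: "0 \<in> crit_ideal" and crit_ideal_one: "1 \<notin> crit_ideal"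
  by (auto simp: crit_ideal_def Let_def intro: osc_ideal.intros)

lemma crit_ideal_uminus: "a \<in> crit_ideal \<Longrightarrow> - a \<in> crit_ideal"
  using crit_ideal_mult[of a "- 1" 1] by simp

quotient_type crit_osc = "wgen free_alg" / "\<lambda>a b. a - b \<in> crit_ideal"
proof (rule equivpI)
  show "reflp (\<lambda>a b. a - b \<in> crit_ideal)" by (simp add: reflp_def crit_ideal_zero)
  show "symp (\<lambda>a b. a - b \<in> crit_ideal)"
    by (rule sympI) (use crit_ideal_uminus in force)
  show "transp (\<lambda>a b. a - b \<in> crit_ideal)"
    by (rule transpI) (use crit_ideal_add in force)
qed

instantiation crit_osc :: ring_1
begin

lift_definition zero_crit_osc :: crit_osc is 0 .
lift_definition one_crit_osc :: crit_osc is 1 .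
lift_definition plus_crit_osc :: "crit_osc \<Rightarrow> crit_osc \<Rightarrow> crit_osc" is "(+)"
  using crit_ideal_add by (metis add_diff_add)
lift_definition minus_crit_osc :: "crit_osc \<Rightarrow> crit_osc \<Rightarrow> crit_osc" is "(-)"
proof -
  fix a b c d :: "wgen free_alg" assume "a - b \<in> crit_ideal" "c - d \<in> crit_ideal"
  then have "(a - b) + - (c - d) \<in> crit_ideal" by (intro crit_ideal_add crit_ideal_uminus)
  then show "a - c - (b - d) \<in> crit_ideal" by (simp add: algebra_simps)
qed
lift_definition uminus_crit_osc :: "crit_osc \<Rightarrow> crit_osc" is uminus
  using crit_ideal_uminus by force
lift_definition times_crit_osc :: "crit_osc \<Rightarrow> crit_osc \<Rightarrow> crit_osc" is "(*)"
proof -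
  fix a b c d :: "wgen free_alg" assume "a - b \<in> crit_ideal" "c - d \<in> crit_ideal"
  then have "1 * (a - b) * c + b * (c - d) * 1 \<in> crit_ideal" by (intro crit_ideal_add crit_ideal_mult)
  then show "a * c - b * d \<in> crit_ideal" by (simp add: algebra_simps)
qed

instance
proof
  fix a b c :: crit_osc
  show "a + b + c = a + (b + c)" by transfer (simp add: algebra_simps crit_ideal_zero)
  show "a + b = b + a" by transfer (simp add: algebra_simps crit_ideal_zero)
  show "0 + a = a" by transfer (simp add: crit_ideal_zero)
  show "- a + a = 0" by transfer (simp add: crit_ideal_zero)
  show "a - b = a + - b" by transfer (simp add: crit_ideal_zero)
  show "a * b * c = a * (b * c)" by transfer (simp add: algebra_simps crit_ideal_zero)
  show "1 * a = a" by transfer (simp add: crit_ideal_zero)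
  show "a * 1 = a" by transfer (simp add: crit_ideal_zero)
  show "(a + b) * c = a * c + b * c" by transfer (simp add: algebra_simps crit_ideal_zero)
  show "a * (b + c) = a * b + a * c" by transfer (simp add: algebra_simps crit_ideal_zero)
  show "(0 :: crit_osc) \<noteq> 1"
  proof transfer
    show "0 - 1 \<notin> crit_ideal" using crit_ideal_uminus[of "- 1"] crit_ideal_one by auto
  qed
qed

end

text \<open>The truncations are combinations of the coefficients with powers of h and hence lie in
  the ideal, which is closed.\<close>

lemma all_coeffs_in_rel_idl:
  assumes "presentation X R" "f \<in> fr X" "\<And>k. fps_const (fps_nth f k) \<in> rel_idl X R"
  shows "f \<in> rel_idl X R"
proof -
  interpret presentation X R by fact
  show ?thesis
  proof (rule I_limit)
    fix N
    let ?g = "\<lambda>N. \<Sum>i<N. scal (fps_X ^ i) * fps_const (fps_nth f i)"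
    have "?g N \<in> rel_idl X R"
      by (induction N) (auto intro!: I_zero I_add I_left fr_scal assms)
    moreover have "fps_nth (?g N) k = fps_nth f k" if "k < N" for k
    proof -
      have "fps_nth (?g N) k = (\<Sum>i<N. if i = k then fps_nth f k else 0)"
        unfolding fps_sum_nth by (rule sum.cong) (auto simp: scal_fps_X_power fps_X_power_mult_nth)
      then show ?thesis using that by simp
    qed
    ultimately show "\<exists>g\<in>rel_idl X R. \<forall>k<N. fps_nth f k = fps_nth g k" by metis
  qed
qed

lemma dyson_gen_carrier: "x \<in> U_gens n m \<Longrightarrow> dyson_gen n m p x \<in> fr (W_gens n m)"
proof -
  let ?L = "lists (W_gens n m)"
  have N: "Poly_Mapping.keys (Num i) \<subseteq> ?L" if "i \<in> {1..n+m}" for i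
    using that unfolding Num_def by (intro keys_mult_lists keys_letter_lists) (auto simp: W_gens_def)
  have S: "Poly_Mapping.keys (\<Sum>k=Suc a..<b. Num k) \<subseteq> ?L" if "b \<le> n + m" for a b
    using that by (intro keys_sum_lists N) auto
  have S': "Poly_Mapping.keys (- (\<Sum>k=Suc a..<b. Num k)) \<subseteq> ?L" if "b \<le> n + m" for a b
    using S[OF that] by simp
  have T: "Poly_Mapping.keys (const p - NumTot n m) \<subseteq> ?L"
    unfolding NumTot_def by (intro keys_diff_lists keys_const_lists keys_sum_lists N)
  have R: "Poly_Mapping.keys (Num i + 1) \<subseteq> ?L" if "i \<in> {1..n+m}" for i
    by (intro keys_add_lists N that keys_one_lists)
  have H: "Poly_Mapping.keys (const p - (-1) ^ k * Num i - NumTot n m) \<subseteq> ?L" if "i \<in> {1..n+m}" for i k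
    unfolding NumTot_def using that
    by (intro keys_diff_lists keys_const_lists keys_sum_lists keys_mult_lists keys_power_lists N)
       (simp_all add: zero_list_def)
  have g: "i \<in> {1..n+m} \<Longrightarrow> gen (Cplus i) \<in> fr (W_gens n m)" "i \<in> {1..n+m} \<Longrightarrow> gen (Cminus i) \<in> fr (W_gens n m)" for i
    by (auto simp: W_gens_def intro!: fr_gen)
  assume "x \<in> U_gens n m"
  then consider i where "x = Hgen i" "i \<in> {1..n+m}"
    | i j where "x = Egen i j" "i \<le> n + m" "j \<le> n + m" "i \<noteq> j"
    by (auto simp: U_gens_def)
  then show ?thesis
  proof cases
    case 1
    then show ?thesis by (simp add: fr_const H del: fps_const_sub)
  next
    case 2
    then show ?thesis
      by (auto intro!: fr_mult fr_qpow fr_qnum fr_qnum_ratio S S' T R g)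
  qed
qed

lemma dyson_carrier:
  assumes "f \<in> fr (U_gens n m)"
  shows "dyson n m p f \<in> fr (W_gens n m)"
proof -
  interpret scalars "\<lambda>c. fps_const (const c) :: wgen free_alg fps" by (rule scalars_fps_const)
  have word: "prod_list (map (dyson_gen n m p) w) \<in> fr (W_gens n m)" if "w \<in> lists (U_gens n m)" for w
    using that by (induction w) (auto simp: fr_one intro: fr_mult dyson_gen_carrier)
  have sum: "(\<And>i. i \<in> A \<Longrightarrow> h i \<in> fr X) \<Longrightarrow> sum h A \<in> fr X" for A and X :: "wgen set" and h :: "'i \<Rightarrow> _"
    by (induction A rule: infinite_finite_induct) (auto simp: fr_zero fr_add)
  have "dyson_poly n m p a \<in> fr (W_gens n m)" if "Poly_Mapping.keys a \<subseteq> lists (U_gens n m)" for a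
    unfolding dyson_poly_def eval_def
    using that word by (intro sum fr_mult fr_const keys_const_lists) blast
  then have c: "Poly_Mapping.keys (fps_nth (dyson_poly n m p (fps_nth f i)) k) \<subseteq> lists (W_gens n m)" for i k
    using assms unfolding fr_iff by blast
  show ?thesis
    unfolding fr_iff dyson_def dyson.ext_nth by (intro allI keys_sum_lists c)
qed

lemma dyson_respects_crit: "dyson_respects (fst crit) (snd crit)"
proof -
  define n m where "n = fst crit" and "m = snd crit"
  interpret W: presentation "W_gens n m" "W_rel n m" by (rule presentation_W)
  interpret U: presentation "U_gens n m" "U_rel n m" by (rule presentation_U)
  interpret r: unital_hom "restrict_letters (W_gens n m)" by (rule restrict_letters_hom)
  have "dyson n m p l - dyson n m p r \<in> W.I" if u: "U_rel n m l r" for p l r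
  proof -
    have carr: "dyson n m p l - dyson n m p r \<in> fr (W_gens n m)"
      using U.rel_carrier[OF u] by (intro fr_diff dyson_carrier)
    show ?thesis
    proof (cases "1 \<in> osc_ideal n m")
      case True
      \<comment> \<open>An ideal containing 1 contains the difference of the images at once.\<close>
      from osc_ideal_restrict[OF this] have "1 \<in> W.I" by (simp add: r.hom_one)
      from W.I_left[OF this carr] show ?thesis by simp
    next
      case False
      define J where "J = crit_ideal"
      have J: "J = osc_ideal n m"
        using False by (simp add: J_def crit_ideal_def n_def m_def)
      have hom: "unital_hom abs_crit_osc"
        by unfold_locales (simp_all add: plus_crit_osc.abs_eq times_crit_osc.abs_eq one_crit_osc.abs_eq)
      interpret oscillator abs_crit_osc n m p
      proof (intro oscillator.intro q_quotient.intro hom oscillator_axioms.intro q_quotient_axioms.intro)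
        show "surj abs_crit_osc"
          by (metis Quotient_crit_osc Quotient_abs_rep surjI)
        show "unital_hom.cmap abs_crit_osc l = unital_hom.cmap abs_crit_osc r"
          if w: "W_rel n m l r" for l r
        proof (rule fps_ext)
          fix k
          have "fps_nth l k - fps_nth r k \<in> J"
          proof (cases k)
            case 0
            then show ?thesis using osc_ideal.rel[OF w] by (simp add: J)
          next
            case (Suc k')
            obtain a b where "l = fps_const a" "r = fps_const b" using W_rel_const[OF w] by blast
            then show ?thesis using Suc by (simp add: J osc_ideal.zero)
          qed
          then show "fps_nth (unital_hom.cmap abs_crit_osc l) k = fps_nth (unital_hom.cmap abs_crit_osc r) k"
            by (simp add: unital_hom.cmap_nth[OF hom] crit_osc.abs_eq_iff J_def)
        qed
      qed
      have "Psi l = Psi r" by (rule Psi_rel[OF u])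
      then have "abs_crit_osc (fps_nth (dyson n m p l) k) = abs_crit_osc (fps_nth (dyson n m p r) k)" for k
        unfolding Psi_def by (metis cmap_nth)
      then have "fps_nth (dyson n m p l - dyson n m p r) k \<in> osc_ideal n m" for k
        using J by (simp add: crit_osc.abs_eq_iff J_def)
      \<comment> \<open>The difference lies in the carrier, so the restriction fixes each of its
        coefficients.\<close>
      from osc_ideal_restrict[OF this] show ?thesis
        using carr restrict_letters_id[of "fps_nth (dyson n m p l - dyson n m p r) k" "W_gens n m" for k]
        by (intro all_coeffs_in_rel_idl[OF presentation_W carr]) (simp add: fr_iff)
    qed
  qed
  then show ?thesis by (simp add: dyson_respects_def n_def m_def)
qed

lemma dyson_respects: "dyson_respects n m"
proof (rule ccontr)
  assume "\<not> dyson_respects n m"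
  then have "\<not> dyson_respects (fst (n, m)) (snd (n, m))" by simp
  then have "\<not> dyson_respects (fst crit) (snd crit)"
    unfolding crit_def by (rule someI)
  then show False using dyson_respects_crit by blast
qed

section \<open>Uniqueness on the Jacobson generators\<close>

lemma qpow_minus: "qpow (- a) * qpow a = (1 :: 'x free_alg fps)"
proof -
  \<comment> \<open>The identity is a trivial quotient map, so \<open>qp_add\<close> applies in the
    free algebra itself.\<close>
  interpret q_quotient "\<lambda>a :: 'x free_alg. a" by unfold_locales auto
  have "qpow a = qp a" for a by (rule fps_ext) (simp add: qpow_def qp_nth kap_def)
  then show ?thesis using qp_add[of "- a" a] by (simp add: qp_zero)
qed

context two_presented_homs begin

text \<open>The k-th term of the exponential series has h-degree k, so its partial sums lie in the
  agreement subring and converge h-adically.\<close>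

lemma agree_qpow:
  assumes "fps_const a \<in> agree"
  shows "qpow a \<in> agree"
proof (rule agree_limit)
  have "Poly_Mapping.keys a \<subseteq> lists X"
    using agree_carrier[OF assms] unfolding fr_iff by (metis fps_nth_fps_const)
  then show "qpow a \<in> fr X" by (rule fr_qpow)
  fix N
  have p: "fps_const (a ^ k) \<in> agree" for k
    by (induction k) (auto simp: agree_one agree_mult assms simp flip: fps_const_mult)
  let ?g = "\<Sum>i<N. scal (fps_X ^ i) * (scal (fps_const (1 / fact i)) * fps_const (a ^ i))"
  have "?g \<in> agree" by (intro agree_sum agree_mult agree_scal p)
  moreover have "fps_nth ?g k = fps_nth (qpow a) k" if "k < N" for k
  proof -
    have "fps_nth ?g k = (\<Sum>i<N. if i = k then fps_nth (qpow a) k else 0)"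
      unfolding fps_sum_nth
      by (rule sum.cong) (auto simp: scal_fps_X_power fps_X_power_mult_nth scal_fps_const qpow_def)
    then show ?thesis using that by simp
  qed
  ultimately show "\<exists>g\<in>agree. \<forall>k<N. fps_nth (qpow a) k = fps_nth g k"
    by (intro bexI[of _ ?g]) auto
qed

end

lemma Lq_inverse: "Lq i (- 1) * Lq i 1 = 1" "Lq i 1 * Lq i (- 1) = 1"
  using qpow_minus[of "letter (Hgen i)"] qpow_minus[of "- letter (Hgen i)"] by (simp_all add: Lq_def)

text \<open>Modulo the relations the bracket of a_i^- and a_j^+ is, up to sign, L_i e_ji or e_ji
  times the inverse of L_j, according to the order of \<open>i\<close> and \<open>j\<close>; the L
  factor stands on different sides in the two cases.\<close>

lemma dyson_unique:
  assumes "is_hom_U_W n m \<rho>" "is_hom_U_W n m \<rho>'"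
    and ext: "\<rho> \<in> extensional (carrier (Uq n m))" "\<rho>' \<in> extensional (carrier (Uq n m))"
    and eq: "\<And>i. i \<in> {1..n+m} \<Longrightarrow> \<rho> (clsU n m (gen (Hgen i))) = \<rho>' (clsU n m (gen (Hgen i))) \<and>
      \<rho> (clsU n m (jac_minus i)) = \<rho>' (clsU n m (jac_minus i)) \<and>
      \<rho> (clsU n m (jac_plus i)) = \<rho>' (clsU n m (jac_plus i))"
  shows "\<rho> = \<rho>'"
proof -
  interpret two_presented_homs "U_gens n m" "U_rel n m" "W_gens n m" "W_rel n m" \<rho> \<rho>'
    using assms(1,2)
    by (intro two_presented_homs.intro presentation_U presentation_W two_presented_homs_axioms.intro)
       (simp_all add: is_hom_U_W_def)
  have gens: "gen (Hgen i) \<in> agree" "rv 0 i \<in> agree" "rv i 0 \<in> agree" if "i \<in> {1..n+m}" for i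
  proof -
    have "gen (Hgen i) \<in> fr (U_gens n m)" "rv 0 i \<in> fr (U_gens n m)" "rv i 0 \<in> fr (U_gens n m)"
      using that by (auto simp: U_gens_def intro!: fr_gen)
    then show "gen (Hgen i) \<in> agree" "rv 0 i \<in> agree" "rv i 0 \<in> agree"
      using eq[OF that] by (simp_all add: agree_def clsU_def)
  qed
  have L: "Lq i 1 \<in> agree" "Lq i (- 1) \<in> agree" if "i \<in> {1..n+m}" for i
    using that gens(1)[OF that] agree_uminus[OF gens(1)[OF that]]
    by (auto simp: Lq_def gen_def intro!: agree_qpow)
  have minus1: "(-1) ^ k \<in> agree" for k
    by (induction k) (auto simp: agree_one intro: agree_uminus)
  have E: "rv j i \<in> agree" if i: "i \<in> {1..n+m}" and j: "j \<in> {1..n+m}" and "i \<noteq> j" for i j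
  proof -
    have car: "rv j i \<in> fr (U_gens n m)"
      using that by (auto simp: U_gens_def intro!: fr_gen)
    define b where "b = sbracket (udeg n) 1 (Egen 0 i) (Egen j 0)"
    have b: "b \<in> agree"
      unfolding b_def sbracket_def by (intro agree_diff agree_mult minus1 agree_scal gens i j)
    have root: "pos_root n m 0 i" "neg_root n m j 0"
      using i j by (auto simp: pos_root_def neg_root_def is_root_def)
    have sq: "((-1) ^ k * ((-1) ^ k * z)) = (z :: ugen free_alg fps)" for k z
      by (simp add: minus_one_power_iff)
    note r = X.rel_in_I[OF U_rel.mixed[OF root], folded b_def]
    show ?thesis
    proof (cases "i < j")
      case True
      let ?s = "(-1) ^ \<theta>2 n 0 i :: ugen free_alg fps"
      have I: "b + Lq i 1 * (?s * rv j i) \<in> X.I"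
        using r True i j by (simp add: Lq_def[of 0] mult.assoc)
      \<comment> \<open>Multiplication by the inverse of L_i and by the sign, which is its own
        inverse, isolates e_ji.\<close>
      have "?s * Lq i (- 1) * (b + Lq i 1 * (?s * rv j i)) \<in> X.I"
        using agree_carrier[OF agree_mult[OF minus1 L(2)[OF i]]] by (rule X.I_left[OF I])
      moreover have "?s * Lq i (- 1) * (b + Lq i 1 * (?s * rv j i)) = rv j i - (- (?s * Lq i (- 1) * b))"
      proof -
        have "Lq i (- 1) * (Lq i 1 * z) = z" for z by (simp add: Lq_inverse flip: mult.assoc)
        then show ?thesis by (simp add: distrib_left mult.assoc sq)
      qed
      ultimately show ?thesis
        by (intro agree_rel[OF car, of "- (?s * Lq i (- 1) * b)"] agree_uminus agree_mult minus1 L b i) simp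
    next
      case False
      let ?s = "(-1) ^ \<theta>2 n j 0 :: ugen free_alg fps"
      have I: "b + ?s * rv j i * Lq j (- 1) \<in> X.I"
        using r False i j \<open>i \<noteq> j\<close> by (simp add: Lq_def[of 0] mult.assoc)
      have "?s * ((b + ?s * rv j i * Lq j (- 1)) * Lq j 1) \<in> X.I"
        by (intro X.I_left X.I_right I agree_carrier minus1 L j)
      moreover have "?s * ((b + ?s * rv j i * Lq j (- 1)) * Lq j 1) = rv j i - (- (?s * b * Lq j 1))"
        by (simp add: distrib_left distrib_right mult.assoc sq Lq_inverse)
      ultimately show ?thesis
        by (intro agree_rel[OF car, of "- (?s * b * Lq j 1)"] agree_uminus agree_mult minus1 L b j) simp
    qed
  qed
  show ?thesis
  proof (rule agree_eq)
    fix x assume "x \<in> U_gens n m"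
    then consider i where "x = Hgen i" "i \<in> {1..n+m}"
      | i j where "x = Egen i j" "i \<le> n + m" "j \<le> n + m" "i \<noteq> j"
      by (auto simp: U_gens_def)
    then show "gen x \<in> agree"
    proof cases
      case 1
      then show ?thesis using gens by simp
    next
      case (2 i j)
      then show ?thesis using gens[of i] gens[of j] E[of j i] by (cases "i = 0"; cases "j = 0") auto
    qed
  qed (use ext in \<open>simp_all add: Uq_def\<close>)
qed

theorem theorem7:
  fixes n m :: nat and p :: complex
  assumes "n + m \<ge> 1"
  shows "\<exists>!\<rho>. \<rho> \<in> extensional (carrier (Uq n m)) \<and> is_hom_U_W n m \<rho> \<and>
    (\<forall>i\<in>{1..n+m}.
       \<rho> (clsU n m (gen (Hgen i)))
         = clsW n m (fps_const (const p - ((-1) ^ \<theta> n i) * Num i - NumTot n m)) \<and>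
       \<rho> (clsU n m (jac_minus i))
         = clsW n m (qpow (\<Sum>j=1..<i. Num j) * qnum_ratio (Num i + 1)
                       * qnum (const p - NumTot n m) * gen (Cminus i)) \<and>
       \<rho> (clsU n m (jac_plus i))
         = clsW n m (qpow (- (\<Sum>j=1..<i. Num j)) * gen (Cplus i)))"
proof (rule ex_ex1I)
  have "\<exists>\<rho>\<in>extensional (carrier (Uq n m)). is_hom_U_W n m \<rho> \<and>
    (\<forall>f\<in>fr (U_gens n m). \<rho> (clsU n m f) = clsW n m (dyson n m p f))"
    unfolding Uq_def is_hom_U_W_def clsU_def clsW_def
  proof (rule presented_hom_exists[OF presentation_U presentation_W dyson_ext.unital_hom_axioms])
    show "fps_nth (dyson n m p f) k = fps_nth (dyson n m p g) k"
      if "\<And>k. k < N \<Longrightarrow> fps_nth f k = fps_nth g k" "k < N" for f g N k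
      using that by (rule dyson_cong)
    show "dyson n m p l - dyson n m p r \<in> rel_idl (W_gens n m) (W_rel n m)" if "U_rel n m l r" for l r
      using that dyson_respects[of n m] unfolding dyson_respects_def by blast
  qed (simp_all add: dyson_carrier dyson_scal)
  then obtain \<rho> where \<rho>: "\<rho> \<in> extensional (carrier (Uq n m))" "is_hom_U_W n m \<rho>"
    "\<And>f. f \<in> fr (U_gens n m) \<Longrightarrow> \<rho> (clsU n m f) = clsW n m (dyson n m p f)" by blast
  have "gen (Hgen i) \<in> fr (U_gens n m)" "rv 0 i \<in> fr (U_gens n m)" "rv i 0 \<in> fr (U_gens n m)"
    if "i \<in> {1..n+m}" for i
    using that by (auto simp: U_gens_def intro!: fr_gen)
  then show "\<exists>\<rho>. \<rho> \<in> extensional (carrier (Uq n m)) \<and> is_hom_U_W n m \<rho> \<and>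
    (\<forall>i\<in>{1..n+m}.
       \<rho> (clsU n m (gen (Hgen i)))
         = clsW n m (fps_const (const p - ((-1) ^ \<theta> n i) * Num i - NumTot n m)) \<and>
       \<rho> (clsU n m (jac_minus i))
         = clsW n m (qpow (\<Sum>j=1..<i. Num j) * qnum_ratio (Num i + 1)
                       * qnum (const p - NumTot n m) * gen (Cminus i)) \<and>
       \<rho> (clsU n m (jac_plus i))
         = clsW n m (qpow (- (\<Sum>j=1..<i. Num j)) * gen (Cplus i)))"
    using \<rho> by (intro exI[of _ \<rho>] conjI ballI) (simp_all add: dyson_of_gen)
qed (rule dyson_unique[of n m]; simp)

end
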